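(* Let $A$ be a reduced tabular algebra with trace $\tau$ and with tabular basis $\mathbf B$. Then the category $\mathcal D(A,\mathbf B)$ of table data of $(A,\mathbf B)$ and the category $\mathcal P(A,\mathbf B)$ of based posets associated to $(A,\mathbf B)$ are equivalent.
   Context: **Normalized table algebras.** A normalized table algebra (over $\mathbb Z$) is a pair $(\Gamma,B)$ where $\Gamma$ is an associative unital $\mathbb Z$-algebra with $\mathbb Z$-basis $B=\{b_i: i\in I\}$, $1\in B$, such that: (T1) the structure constants with respect to $B$ are nonnegative integers; (T2) there is an algebra anti-automorphism $\bar{\ }$ of $\Gamma$ whose square is the identity and which maps $B$ to $B$; (T3) writing $\kappa(b,a)$ for the coefficient of $b\in B$ in $a\in\Gamma$, one has $\kappa(b_m,b_ib_j)=\kappa(b_i,b_m\overline{b_j})$ for all $i,j,m$. **Based rings.** A based ring is a pair $(R,B)$ with $R$ a unital $\mathbb Z$-algebra with free $\mathbb Z$-basis $B$ and nonnegative structure constants; an isomorphism of based rings is a ring isomorphism that maps basis bijectively onto basis. For a normalized table algebra $(\Gamma,B)$ and $n\ge 1$, $M_{n,\Gamma,B}$ is the ring of $n\times n$ matrices over $\Gamma$, with basis all $e_{ij}\otimes b$ ($e_{ij}$ matrix units, $b\in B$). **Tabular algebras with trace.** Let $\mathcal A=\mathbb Z[v,v^{-1}]$, $\mathcal A^-=\mathbb Z[v^{-1}]$. For an $\mathcal A$-algebra $A$ with $\mathcal A$-basis $\mathbf B$, write $XY=\sum_{Z\in\mathbf B} g_{X,Y,Z}Z$ for $X,Y\in\mathbf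 B$ and $\mathbf a(Z)=\max_{X,Y\in\mathbf B}\deg g_{X,Y,Z}$, where $\deg$ is the highest power of $v$ occurring with nonzero coefficient; $\gamma_{X,Y,Z}\in\mathbb Z$ is the coefficient of $v^{\mathbf a(Z)}$ in $g_{X,Y,Z}$. A tabular algebra is an $\mathcal A$-algebra $A$ with a table datum $(\Lambda,\Gamma,B,M,C,* )$ satisfying (A1)–(A3); a tabular algebra with trace also satisfies (A4), (A5). (A1) $\Lambda$ is a finite poset; for each $\lambda\in\Lambda$, $(\Gamma(\lambda),B(\lambda))$ is a normalized table algebra over $\mathbb Z$ and $M(\lambda)$ is a nonempty finite set. The map $C:\coprod_{\lambda\in\Lambda}(M(\lambda)\times B(\lambda)\times M(\lambda))\to A$ is injective with image an $\mathcal A$-basis of $A$ (the tabular basis $\mathbf B=\operatorname{Im}(C)$). $\operatorname{Im}(C)$ contains a set of mutually orthogonal idempotents $\{1_\varepsilon:\varepsilon\in\mathcal E\}$ with $A=\sum_{\varepsilon,\varepsilon'}1_\varepsilon A1_{\varepsilon'}$ and such that each $X\in\operatorname{Im}(C)$ satisfies $X=1_\varepsilon X1_{\varepsilon'}$ for some $\varepsilon,\varepsilon'\in\mathcal E$. (A2) Write $C_{S,T}^b=C(S,b,T)$ for $S,T\in M(\lambda)$, $b\in B(\lambda)$. Then $*$ is an $\mathcal A$-linear involutory anti-automorphism of $A$ with $(C_{S,T}^b)^*=C_{T,S}^{\bar b}$. For $g=\sum c_ib_i$ ($b_i\in B(\lambda)$, $c_i$ scalars) put $C_{S,T}^g=\sum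 c_iC_{S,T}^{b_i}$. Write $\mathbf c_\lambda=C(M(\lambda)\times B(\lambda)\times M(\lambda))$. (A3) For $\lambda\in\Lambda$, $g\in\Gamma(\lambda)$, $S,T\in M(\lambda)$ and all $a\in A$: $a\,C_{S,T}^g\equiv\sum_{S'\in M(\lambda)}C_{S',T}^{r_a(S',S)g} \bmod A(<\lambda)$, where $r_a(S',S)\in\mathcal A\otimes_{\mathbb Z}\Gamma(\lambda)$ is independent of $T$ and $g$, and $A(<\lambda)$ is the $\mathcal A$-span of $\bigcup_{\mu<\lambda}\mathbf c_\mu$. (A4) Let $K=C_{S,T}^b$, $K'=C_{U,V}^{b'}$, $K''=C_{X,Y}^{b''}$. Then $\deg g_{K,K',K''}=\mathbf a(K'')$ if and only if $X=S$, $T=U$, $Y=V$ (in particular, all belong to the same $\lambda$) and $\kappa(b'',bb')\neq0$. If these hold and $b=b'=b''=1$, then $\gamma_{K,K',K''}=1$. (A5) There is an $\mathcal A$-linear $\tau:A\to\mathcal A$ (the tabular trace) with $\tau(x)=\tau(x^* )$, $\tau(xy)=\tau(yx)$, such that for $X=C_{S,T}^b$, $\tau(v^{\mathbf a(X)}X)$ is congruent mod $v^{-1}\mathcal A^-$ to $1$ if $S=T$ and $b=1$, and to $0$ otherwise. **Reduced.** A table datum is reduced if there is no strictly coarser partial order $\leq'$ on the set $\Lambda$ (i.e. $\leq$ is a proper refinement of $\leq'$) such that replacing $\leq$ by $\leq'$ still gives a table datum for $A$. A tabular algebra with a reduced table datum is called reduced. **The category $\mathcal D(A,\mathbf B)=\mathcal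 D(A,\mathbf B,\tau)$.** Objects: all $(\Lambda,\Gamma,B,M,* )$ for which there exists $C$ such that $(\Lambda,\Gamma,B,M,C,* )$ is a reduced table datum for $A$ (satisfying (A1)–(A5) with tabular trace $\tau$) with $\operatorname{Im}(C)=\mathbf B$. Morphisms $(\Lambda,\Gamma,B,M,* )\to(\Lambda',\Gamma',B',M',*')$: fix one map $C$ such that $(\Lambda,\Gamma,B,M,C,* )$ is a reduced table datum for $A$ (with trace $\tau$) with $\operatorname{Im}(C)=\mathbf B$; the morphisms are all maps $(C')^{-1}\circ C:\coprod_{\lambda\in\Lambda}(M(\lambda)\times B(\lambda)\times M(\lambda))\to\coprod_{\lambda'\in\Lambda'}(M'(\lambda')\times B'(\lambda')\times M'(\lambda'))$, where $C'$ ranges over all maps such that $(\Lambda',\Gamma',B',M',C',*')$ is a reduced table datum for $A$ (with trace $\tau$) with $\operatorname{Im}(C')=\mathbf B$. Composition is composition of maps. (This is well defined: the set of morphisms does not depend on the choice of $C$.) **The category $\mathcal P(A,\mathbf B)$.** A based poset is a triple $(\Lambda,\leq,f)$ with $(\Lambda,\leq)$ a poset and $f(\lambda)$ a based ring for each $\lambda\in\Lambda$. An isomorphism of based posets $\alpha:(\Lambda,\leq,f)\to(\Pi,\leq',g)$ consists of a poset isomorphism $\alpha:\Lambda\to\Pi$ together with an isomorphism of based rings $\alpha:f(\lambda)\to g(\alpha(\lambda))$ for each $\lambda$. For an object $D=(\Lambda,\Gamma,B,M,* )$ of $\mathcal D(A,\mathbf B)$, $P(D)$ is the based poset $(\Lambda,\leq,f)$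 with $f(\lambda)=M_{|M(\lambda)|,\Gamma(\lambda),B(\lambda)}$. The objects of $\mathcal P(A,\mathbf B)$ are all $P(D)$ for $D$ an object of $\mathcal D(A,\mathbf B)$, and the morphisms are the isomorphisms of based posets. *)

theory Defs
  imports Complex_Main "HOL-Algebra.QuotRing" "HOL-Library.Poly_Mapping" "HOL-Library.FuncSet"
begin

section \<open>Categories and equivalences of categories\<close>

text \<open>Arrows carry no source and target: the hom-sets of different pairs of objects may overlap, and
  identities, composition and the arrow part of a functor take the objects as explicit arguments.
  \<open>Comp K X Y Z g f\<close> is \<open>g\<close> after \<open>f\<close>, for \<open>f : X \<rightarrow> Y\<close> and \<open>g : Y \<rightarrow> Z\<close>.\<close>

record ('o, 'm) cat =
  Obj :: "'o set"
  Hom :: "'o \<Rightarrow> 'o \<Rightarrow> 'm set"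
  Ident :: "'o \<Rightarrow> 'm"
  Comp :: "'o \<Rightarrow> 'o \<Rightarrow> 'o \<Rightarrow> 'm \<Rightarrow> 'm \<Rightarrow> 'm"

definition category :: "('o, 'm) cat \<Rightarrow> bool" where
  "category K \<longleftrightarrow>
     (\<forall>X\<in>Obj K. Ident K X \<in> Hom K X X) \<and>
     (\<forall>X\<in>Obj K. \<forall>Y\<in>Obj K. \<forall>Z\<in>Obj K. \<forall>f\<in>Hom K X Y. \<forall>g\<in>Hom K Y Z.
        Comp K X Y Z g f \<in> Hom K X Z) \<and>
     (\<forall>X\<in>Obj K. \<forall>Y\<in>Obj K. \<forall>f\<in>Hom K X Y.
        Comp K X X Y f (Ident K X) = f \<and> Comp K X Y Y (Ident K Y) f = f) \<and>
     (\<forall>W\<in>Obj K. \<forall>X\<in>Obj K. \<forall>Y\<in>Obj K. \<forall>Z\<in>Obj K.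
        \<forall>f\<in>Hom K W X. \<forall>g\<in>Hom K X Y. \<forall>h\<in>Hom K Y Z.
        Comp K W X Z (Comp K X Y Z h g) f = Comp K W Y Z h (Comp K W X Y g f))"

type_synonym ('o, 'm, 'p, 'n) funct = "('o \<Rightarrow> 'p) \<times> ('o \<Rightarrow> 'o \<Rightarrow> 'm \<Rightarrow> 'n)"

definition is_functor :: "('o, 'm) cat \<Rightarrow> ('p, 'n) cat \<Rightarrow> ('o, 'm, 'p, 'n) funct \<Rightarrow> bool" where
  "is_functor K L F \<longleftrightarrow>
     (\<forall>X\<in>Obj K. fst F X \<in> Obj L) \<and>
     (\<forall>X\<in>Obj K. \<forall>Y\<in>Obj K. \<forall>f\<in>Hom K X Y. snd F X Y f \<in> Hom L (fst F X) (fst F Y)) \<and>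
     (\<forall>X\<in>Obj K. snd F X X (Ident K X) = Ident L (fst F X)) \<and>
     (\<forall>X\<in>Obj K. \<forall>Y\<in>Obj K. \<forall>Z\<in>Obj K. \<forall>f\<in>Hom K X Y. \<forall>g\<in>Hom K Y Z.
        snd F X Z (Comp K X Y Z g f) =
        Comp L (fst F X) (fst F Y) (fst F Z) (snd F Y Z g) (snd F X Y f))"

definition id_functor :: "('o, 'm, 'o, 'm) funct" where
  "id_functor = (\<lambda>X. X, \<lambda>X Y f. f)"

definition comp_functor ::
  "('p, 'n, 'q, 'k) funct \<Rightarrow> ('o, 'm, 'p, 'n) funct \<Rightarrow> ('o, 'm, 'q, 'k) funct" where
  "comp_functor G F =
     (\<lambda>X. fst G (fst F X), \<lambda>X Y f. snd G (fst F X) (fst F Y) (snd F X Y f))"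

definition is_iso :: "('o, 'm) cat \<Rightarrow> 'o \<Rightarrow> 'o \<Rightarrow> 'm \<Rightarrow> bool" where
  "is_iso K X Y f \<longleftrightarrow> f \<in> Hom K X Y \<and>
     (\<exists>g\<in>Hom K Y X. Comp K X Y X g f = Ident K X \<and> Comp K Y X Y f g = Ident K Y)"

definition natural_iso :: "('o, 'm) cat \<Rightarrow> ('p, 'n) cat \<Rightarrow>
    ('o, 'm, 'p, 'n) funct \<Rightarrow> ('o, 'm, 'p, 'n) funct \<Rightarrow> ('o \<Rightarrow> 'n) \<Rightarrow> bool" where
  "natural_iso K L F G \<eta> \<longleftrightarrow>
     (\<forall>X\<in>Obj K. is_iso L (fst F X) (fst G X) (\<eta> X)) \<and>
     (\<forall>X\<in>Obj K. \<forall>Y\<in>Obj K. \<forall>f\<in>Hom K X Y.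
        Comp L (fst F X) (fst F Y) (fst G Y) (\<eta> Y) (snd F X Y f) =
        Comp L (fst F X) (fst G X) (fst G Y) (snd G X Y f) (\<eta> X))"

definition equivalent_categories :: "('o, 'm) cat \<Rightarrow> ('p, 'n) cat \<Rightarrow> bool" where
  "equivalent_categories K L \<longleftrightarrow> category K \<and> category L \<and>
     (\<exists>F G \<eta> \<epsilon>. is_functor K L F \<and> is_functor L K G \<and>
        natural_iso K K id_functor (comp_functor G F) \<eta> \<and>
        natural_iso L L (comp_functor F G) id_functor \<epsilon>)"


section \<open>Based rings and normalized table algebras\<close>

text \<open>The integer linear combination with coefficients \<open>c\<close> (of finite support).\<close>

definition zcomb :: "('g, 'r) ring_scheme \<Rightarrow> ('g \<Rightarrow> int) \<Rightarrow> 'g" where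
  "zcomb R c = finsum R (\<lambda>b. add_pow R (c b) b) {b. c b \<noteq> 0}"

definition zcoords :: "('g, 'r) ring_scheme \<Rightarrow> 'g set \<Rightarrow> 'g \<Rightarrow> ('g \<Rightarrow> int) \<Rightarrow> bool" where
  "zcoords R B x c \<longleftrightarrow> finite {b. c b \<noteq> 0} \<and> {b. c b \<noteq> 0} \<subseteq> B \<and> x = zcomb R c"

definition zbasis :: "('g, 'r) ring_scheme \<Rightarrow> 'g set \<Rightarrow> bool" where
  "zbasis R B \<longleftrightarrow> B \<subseteq> carrier R \<and> (\<forall>x\<in>carrier R. \<exists>!c. zcoords R B x c)"

definition kappa :: "('g, 'r) ring_scheme \<Rightarrow> 'g set \<Rightarrow> 'g \<Rightarrow> 'g \<Rightarrow> int" where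
  "kappa R B b x = (THE c. zcoords R B x c) b"

definition based_ring :: "('g, 'r) ring_scheme \<Rightarrow> 'g set \<Rightarrow> bool" where
  "based_ring R B \<longleftrightarrow> ring R \<and> zbasis R B \<and>
     (\<forall>a\<in>B. \<forall>b\<in>B. \<forall>c\<in>B. 0 \<le> kappa R B c (a \<otimes>\<^bsub>R\<^esub> b))"

definition based_ring_iso :: "('g, 'r) ring_scheme \<times> 'g set \<Rightarrow> ('h, 's) ring_scheme \<times> 'h set \<Rightarrow>
    ('g \<Rightarrow> 'h) set" where
  "based_ring_iso R S = {\<phi>. \<phi> \<in> extensional (carrier (fst R)) \<and>
     \<phi> \<in> ring_iso (fst R) (fst S) \<and> bij_betw \<phi> (snd R) (snd S)}"

definition table_involution :: "('g, 'r) ring_scheme \<Rightarrow> 'g set \<Rightarrow> ('g \<Rightarrow> 'g) \<Rightarrow> bool" where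
  "table_involution R B bar \<longleftrightarrow>
     (\<forall>x\<in>carrier R. bar x \<in> carrier R \<and> bar (bar x) = x) \<and>
     (\<forall>x\<in>carrier R. \<forall>y\<in>carrier R.
        bar (x \<oplus>\<^bsub>R\<^esub> y) = bar x \<oplus>\<^bsub>R\<^esub> bar y \<and> bar (x \<otimes>\<^bsub>R\<^esub> y) = bar y \<otimes>\<^bsub>R\<^esub> bar x) \<and>
     (\<forall>b\<in>B. bar b \<in> B) \<and>
     (\<forall>bi\<in>B. \<forall>bj\<in>B. \<forall>bm\<in>B. kappa R B bm (bi \<otimes>\<^bsub>R\<^esub> bj) = kappa R B bi (bm \<otimes>\<^bsub>R\<^esub> bar bj))"

definition table_algebra :: "('g, 'r) ring_scheme \<Rightarrow> 'g set \<Rightarrow> bool" where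
  "table_algebra R B \<longleftrightarrow> based_ring R B \<and> \<one>\<^bsub>R\<^esub> \<in> B \<and> (\<exists>bar. table_involution R B bar)"

text \<open>A table involution is determined on the carrier: taking \<open>bm = 1\<close> in the last clause above
  shows that \<open>bar bj\<close> is the only \<open>b\<close> in \<open>B\<close> such that \<open>1\<close> occurs in \<open>b bj\<close>.
  So the choice below is harmless.\<close>

definition table_bar :: "('g, 'r) ring_scheme \<Rightarrow> 'g set \<Rightarrow> 'g \<Rightarrow> 'g" where
  "table_bar R B = (SOME bar. table_involution R B bar)"

definition matrix_ring :: "nat \<Rightarrow> ('g, 'r) ring_scheme \<Rightarrow> (nat \<times> nat \<Rightarrow> 'g) ring" where
  "matrix_ring n R =
     \<lparr>carrier = ({..<n} \<times> {..<n}) \<rightarrow>\<^sub>E carrier R,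
      monoid.mult = (\<lambda>P Q. \<lambda>(i, j)\<in>{..<n} \<times> {..<n}.
        finsum R (\<lambda>k. P (i, k) \<otimes>\<^bsub>R\<^esub> Q (k, j)) {..<n}),
      one = (\<lambda>(i, j)\<in>{..<n} \<times> {..<n}. if i = j then \<one>\<^bsub>R\<^esub> else \<zero>\<^bsub>R\<^esub>),
      zero = (\<lambda>(i, j)\<in>{..<n} \<times> {..<n}. \<zero>\<^bsub>R\<^esub>),
      add = (\<lambda>P Q. \<lambda>(i, j)\<in>{..<n} \<times> {..<n}. P (i, j) \<oplus>\<^bsub>R\<^esub> Q (i, j))\<rparr>"

definition elem_matrix :: "nat \<Rightarrow> ('g, 'r) ring_scheme \<Rightarrow> nat \<Rightarrow> nat \<Rightarrow> 'g \<Rightarrow> nat \<times> nat \<Rightarrow> 'g" where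
  "elem_matrix n R i j b = (\<lambda>p\<in>{..<n} \<times> {..<n}. if p = (i, j) then b else \<zero>\<^bsub>R\<^esub>)"

definition matrix_based_ring :: "nat \<Rightarrow> ('g, 'r) ring_scheme \<Rightarrow> 'g set \<Rightarrow>
    (nat \<times> nat \<Rightarrow> 'g) ring \<times> (nat \<times> nat \<Rightarrow> 'g) set" where
  "matrix_based_ring n R B =
     (matrix_ring n R, {elem_matrix n R i j b | i j b. i < n \<and> j < n \<and> b \<in> B})"


section \<open>Algebras over the ring of Laurent polynomials\<close>

text \<open>Laurent polynomials over the integers, as the group ring of the integers: \<open>lookup p k\<close> is the
  coefficient of the \<open>k\<close>-th power of \<open>v\<close>.\<close>

type_synonym laurent = "int \<Rightarrow>\<^sub>0 int"

definition laurent_deg :: "laurent \<Rightarrow> int" where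
  "laurent_deg p = Max (Poly_Mapping.keys p)"

definition v_pow :: "int \<Rightarrow> laurent" where
  "v_pow k = Poly_Mapping.single k 1"

definition vinv_Aminus :: "laurent set" where
  "vinv_Aminus = {p. Poly_Mapping.keys p \<subseteq> {..-1}}"

definition laurent_algebra :: "(laurent \<Rightarrow> 'a::ring \<Rightarrow> 'a) \<Rightarrow> bool" where
  "laurent_algebra scale \<longleftrightarrow> module scale \<and>
     (\<forall>c x y. scale c (x * y) = scale c x * y \<and> scale c (x * y) = x * scale c y)"

definition str_const :: "(laurent \<Rightarrow> 'a::ring \<Rightarrow> 'a) \<Rightarrow> 'a set \<Rightarrow> 'a \<Rightarrow> 'a \<Rightarrow> 'a \<Rightarrow> laurent" where
  "str_const scale BB X Y Z = module.representation scale BB (X * Y) Z"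

text \<open>The degree of 0 is minus infinity; zero structure constants therefore never contribute to the
  maximum.\<close>

definition str_degs :: "(laurent \<Rightarrow> 'a::ring \<Rightarrow> 'a) \<Rightarrow> 'a set \<Rightarrow> 'a \<Rightarrow> int set" where
  "str_degs scale BB Z = {laurent_deg (str_const scale BB X Y Z) | X Y.
     X \<in> BB \<and> Y \<in> BB \<and> str_const scale BB X Y Z \<noteq> 0}"

definition a_defined :: "(laurent \<Rightarrow> 'a::ring \<Rightarrow> 'a) \<Rightarrow> 'a set \<Rightarrow> bool" where
  "a_defined scale BB \<longleftrightarrow>
     (\<forall>Z\<in>BB. \<exists>d\<in>str_degs scale BB Z. \<forall>e\<in>str_degs scale BB Z. e \<le> d)"

definition a_fun :: "(laurent \<Rightarrow> 'a::ring \<Rightarrow> 'a) \<Rightarrow> 'a set \<Rightarrow> 'a \<Rightarrow> int" where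
  "a_fun scale BB Z = (GREATEST d. d \<in> str_degs scale BB Z)"

definition gamma :: "(laurent \<Rightarrow> 'a::ring \<Rightarrow> 'a) \<Rightarrow> 'a set \<Rightarrow> 'a \<Rightarrow> 'a \<Rightarrow> 'a \<Rightarrow> int" where
  "gamma scale BB X Y Z = Poly_Mapping.lookup (str_const scale BB X Y Z) (a_fun scale BB Z)"


section \<open>Table data\<close>

text \<open>The tuple \<open>(\<Lambda>, \<Gamma>, B, M, *)\<close>, where \<open>\<Lambda>\<close> comes with its partial order; the map \<open>C\<close> is kept apart.\<close>

record ('l, 'g, 'm, 'a) table_tuple =
  Lam :: "'l set"
  leq :: "('l \<times> 'l) set"
  Gam :: "'l \<Rightarrow> 'g ring"
  Bas :: "'l \<Rightarrow> 'g set"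
  Idx :: "'l \<Rightarrow> 'm set"
  star :: "'a \<Rightarrow> 'a"

type_synonym ('l, 'g, 'm) cell_index = "'l \<times> 'm \<times> 'g \<times> 'm"

definition cells :: "('l, 'g, 'm, 'a) table_tuple \<Rightarrow> ('l, 'g, 'm) cell_index set" where
  "cells D = {(l, S, b, T). l \<in> Lam D \<and> S \<in> Idx D l \<and> b \<in> Bas D l \<and> T \<in> Idx D l}"

definition axiom_A1 :: "(laurent \<Rightarrow> 'a::ring \<Rightarrow> 'a) \<Rightarrow> ('l, 'g, 'm, 'a) table_tuple \<Rightarrow>
    (('l, 'g, 'm) cell_index \<Rightarrow> 'a) \<Rightarrow> bool" where
  "axiom_A1 scale D C \<longleftrightarrow>
     finite (Lam D) \<and> partial_order_on (Lam D) (leq D) \<and>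
     (\<forall>l\<in>Lam D. table_algebra (Gam D l) (Bas D l) \<and> finite (Idx D l) \<and> Idx D l \<noteq> {}) \<and>
     inj_on C (cells D) \<and>
     \<not> module.dependent scale (C ` cells D) \<and> module.span scale (C ` cells D) = UNIV \<and>
     (\<exists>E \<subseteq> C ` cells D.
        (\<forall>e\<in>E. e * e = e) \<and> (\<forall>e\<in>E. \<forall>f\<in>E. e \<noteq> f \<longrightarrow> e * f = 0) \<and>
        module.span scale {e * x * f | e x f. e \<in> E \<and> f \<in> E} = UNIV \<and>
        (\<forall>X\<in>C ` cells D. \<exists>e\<in>E. \<exists>f\<in>E. X = e * X * f))"

definition axiom_A2 :: "(laurent \<Rightarrow> 'a::ring \<Rightarrow> 'a) \<Rightarrow> ('l, 'g, 'm, 'a) table_tuple \<Rightarrow>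
    (('l, 'g, 'm) cell_index \<Rightarrow> 'a) \<Rightarrow> bool" where
  "axiom_A2 scale D C \<longleftrightarrow>
     module_hom scale scale (star D) \<and>
     (\<forall>x y. star D (x * y) = star D y * star D x) \<and>
     (\<forall>x. star D (star D x) = x) \<and>
     (\<forall>(l, S, b, T)\<in>cells D. star D (C (l, S, b, T)) = C (l, T, table_bar (Gam D l) (Bas D l) b, S))"

text \<open>An element of the scalar extension of \<open>R\<close> from the integers to Laurent polynomials is given by
  its finitely supported coefficient function on the basis \<open>B\<close>. \<open>ext_mult\<close> is multiplication on the
  right by an element of \<open>R\<close>, and \<open>C_ext C l x S T\<close> is the linear extension of \<open>b \<mapsto> C (l, S, b, T)\<close>.\<close>

definition ext_carrier :: "'g set \<Rightarrow> ('g \<Rightarrow> laurent) set" where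
  "ext_carrier B = {r. finite {b. r b \<noteq> 0} \<and> {b. r b \<noteq> 0} \<subseteq> B}"

definition ext_of :: "('g, 'r) ring_scheme \<Rightarrow> 'g set \<Rightarrow> 'g \<Rightarrow> 'g \<Rightarrow> laurent" where
  "ext_of R B g = (\<lambda>b. of_int (kappa R B b g))"

definition ext_mult ::
  "('g, 'r) ring_scheme \<Rightarrow> 'g set \<Rightarrow> ('g \<Rightarrow> laurent) \<Rightarrow> 'g \<Rightarrow> 'g \<Rightarrow> laurent" where
  "ext_mult R B r g = (\<lambda>b. \<Sum>c | r c \<noteq> 0. r c * ext_of R B (c \<otimes>\<^bsub>R\<^esub> g) b)"

definition C_ext :: "(laurent \<Rightarrow> 'a::ring \<Rightarrow> 'a) \<Rightarrow> (('l, 'g, 'm) cell_index \<Rightarrow> 'a) \<Rightarrow>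
    'l \<Rightarrow> ('g \<Rightarrow> laurent) \<Rightarrow> 'm \<Rightarrow> 'm \<Rightarrow> 'a" where
  "C_ext scale C l x S T = (\<Sum>b | x b \<noteq> 0. scale (x b) (C (l, S, b, T)))"

definition lower_span :: "(laurent \<Rightarrow> 'a::ring \<Rightarrow> 'a) \<Rightarrow> ('l, 'g, 'm, 'a) table_tuple \<Rightarrow>
    (('l, 'g, 'm) cell_index \<Rightarrow> 'a) \<Rightarrow> 'l \<Rightarrow> 'a set" where
  "lower_span scale D C l =
     module.span scale {C (k, S, b, T) | k S b T. (k, S, b, T) \<in> cells D \<and> (k, l) \<in> leq D \<and> k \<noteq> l}"

definition axiom_A3 :: "(laurent \<Rightarrow> 'a::ring \<Rightarrow> 'a) \<Rightarrow> ('l, 'g, 'm, 'a) table_tuple \<Rightarrow>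
    (('l, 'g, 'm) cell_index \<Rightarrow> 'a) \<Rightarrow> bool" where
  "axiom_A3 scale D C \<longleftrightarrow>
     (\<forall>l\<in>Lam D. \<forall>a. \<exists>r.
        (\<forall>S'\<in>Idx D l. \<forall>S\<in>Idx D l. r S' S \<in> ext_carrier (Bas D l)) \<and>
        (\<forall>g\<in>carrier (Gam D l). \<forall>S\<in>Idx D l. \<forall>T\<in>Idx D l.
           a * C_ext scale C l (ext_of (Gam D l) (Bas D l) g) S T
           - (\<Sum>S'\<in>Idx D l. C_ext scale C l (ext_mult (Gam D l) (Bas D l) (r S' S) g) S' T)
           \<in> lower_span scale D C l))"

definition table_datum :: "(laurent \<Rightarrow> 'a::ring \<Rightarrow> 'a) \<Rightarrow> ('l, 'g, 'm, 'a) table_tuple \<Rightarrow>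
    (('l, 'g, 'm) cell_index \<Rightarrow> 'a) \<Rightarrow> bool" where
  "table_datum scale D C \<longleftrightarrow> axiom_A1 scale D C \<and> axiom_A2 scale D C \<and> axiom_A3 scale D C"

definition axiom_A4 :: "(laurent \<Rightarrow> 'a::ring \<Rightarrow> 'a) \<Rightarrow> ('l, 'g, 'm, 'a) table_tuple \<Rightarrow>
    (('l, 'g, 'm) cell_index \<Rightarrow> 'a) \<Rightarrow> bool" where
  "axiom_A4 scale D C \<longleftrightarrow> (let BB = C ` cells D in
     a_defined scale BB \<and>
     (\<forall>(l, S, b, T)\<in>cells D. \<forall>(l', U, b', V)\<in>cells D. \<forall>(l'', X, b'', Y)\<in>cells D.
        let K = C (l, S, b, T); K' = C (l', U, b', V); K'' = C (l'', X, b'', Y);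
            match = (l = l' \<and> l' = l'' \<and> X = S \<and> T = U \<and> Y = V \<and>
                     kappa (Gam D l) (Bas D l) b'' (b \<otimes>\<^bsub>Gam D l\<^esub> b') \<noteq> 0)
        in (str_const scale BB K K' K'' \<noteq> 0 \<and>
              laurent_deg (str_const scale BB K K' K'') = a_fun scale BB K'' \<longleftrightarrow> match) \<and>
           (match \<and> b = \<one>\<^bsub>Gam D l\<^esub> \<and> b' = \<one>\<^bsub>Gam D l\<^esub> \<and> b'' = \<one>\<^bsub>Gam D l\<^esub> \<longrightarrow>
              gamma scale BB K K' K'' = 1)))"

definition axiom_A5 :: "(laurent \<Rightarrow> 'a::ring \<Rightarrow> 'a) \<Rightarrow> ('a \<Rightarrow> laurent) \<Rightarrow>
    ('l, 'g, 'm, 'a) table_tuple \<Rightarrow> (('l, 'g, 'm) cell_index \<Rightarrow> 'a) \<Rightarrow> bool" where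
  "axiom_A5 scale \<tau> D C \<longleftrightarrow>
     module_hom scale (*) \<tau> \<and>
     (\<forall>x. \<tau> x = \<tau> (star D x)) \<and> (\<forall>x y. \<tau> (x * y) = \<tau> (y * x)) \<and>
     (\<forall>(l, S, b, T)\<in>cells D.
        \<tau> (scale (v_pow (a_fun scale (C ` cells D) (C (l, S, b, T)))) (C (l, S, b, T)))
        - (if S = T \<and> b = \<one>\<^bsub>Gam D l\<^esub> then 1 else 0) \<in> vinv_Aminus)"

definition reduced_datum :: "(laurent \<Rightarrow> 'a::ring \<Rightarrow> 'a) \<Rightarrow> ('l, 'g, 'm, 'a) table_tuple \<Rightarrow>
    (('l, 'g, 'm) cell_index \<Rightarrow> 'a) \<Rightarrow> bool" where
  "reduced_datum scale D C \<longleftrightarrow> table_datum scale D C \<and>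
     \<not> (\<exists>r. r \<subset> leq D \<and> table_datum scale (D\<lparr>leq := r\<rparr>) C)"

definition reduced_datum_with_trace :: "(laurent \<Rightarrow> 'a::ring \<Rightarrow> 'a) \<Rightarrow> ('a \<Rightarrow> laurent) \<Rightarrow>
    ('l, 'g, 'm, 'a) table_tuple \<Rightarrow> (('l, 'g, 'm) cell_index \<Rightarrow> 'a) \<Rightarrow> bool" where
  "reduced_datum_with_trace scale \<tau> D C \<longleftrightarrow>
     reduced_datum scale D C \<and> axiom_A4 scale D C \<and> axiom_A5 scale \<tau> D C"


section \<open>The category of table data\<close>

text \<open>The families \<open>\<Gamma>\<close>, \<open>B\<close>, \<open>M\<close> are indexed by \<open>\<Lambda>\<close> only, so objects are normalized to the dummy
  value \<open>undefined\<close> outside \<open>\<Lambda>\<close>.\<close>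

definition datum_maps :: "(laurent \<Rightarrow> 'a::ring \<Rightarrow> 'a) \<Rightarrow> ('a \<Rightarrow> laurent) \<Rightarrow> 'a set \<Rightarrow>
    ('l, 'g, 'm, 'a) table_tuple \<Rightarrow> (('l, 'g, 'm) cell_index \<Rightarrow> 'a) set" where
  "datum_maps scale \<tau> BB D = {C. reduced_datum_with_trace scale \<tau> D C \<and> C ` cells D = BB}"

definition D_objects :: "(laurent \<Rightarrow> 'a::ring \<Rightarrow> 'a) \<Rightarrow> ('a \<Rightarrow> laurent) \<Rightarrow> 'a set \<Rightarrow>
    ('l, 'g, 'm, 'a) table_tuple set" where
  "D_objects scale \<tau> BB = {D. Gam D \<in> extensional (Lam D) \<and> Bas D \<in> extensional (Lam D) \<and>
     Idx D \<in> extensional (Lam D) \<and> datum_maps scale \<tau> BB D \<noteq> {}}"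

definition D_hom :: "(laurent \<Rightarrow> 'a::ring \<Rightarrow> 'a) \<Rightarrow> ('a \<Rightarrow> laurent) \<Rightarrow> 'a set \<Rightarrow>
    ('l, 'g, 'm, 'a) table_tuple \<Rightarrow> ('l, 'g, 'm, 'a) table_tuple \<Rightarrow>
    (('l, 'g, 'm) cell_index \<Rightarrow> ('l, 'g, 'm) cell_index) set" where
  "D_hom scale \<tau> BB D D' = (let C = (SOME C. C \<in> datum_maps scale \<tau> BB D) in
     {compose (cells D) (inv_into (cells D') C') C | C'. C' \<in> datum_maps scale \<tau> BB D'})"

definition D_cat :: "(laurent \<Rightarrow> 'a::ring \<Rightarrow> 'a) \<Rightarrow> ('a \<Rightarrow> laurent) \<Rightarrow> 'a set \<Rightarrow>
    (('l, 'g, 'm, 'a) table_tuple, ('l, 'g, 'm) cell_index \<Rightarrow> ('l, 'g, 'm) cell_index) cat" where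
  "D_cat scale \<tau> BB =
     \<lparr>Obj = D_objects scale \<tau> BB, Hom = D_hom scale \<tau> BB,
      Ident = (\<lambda>D. \<lambda>p\<in>cells D. p),
      Comp = (\<lambda>D D' D'' g f. compose (cells D) g f)\<rparr>"


section \<open>The category of based posets\<close>

type_synonym ('l, 'x) based_poset = "'l set \<times> ('l \<times> 'l) set \<times> ('l \<Rightarrow> 'x ring \<times> 'x set)"

type_synonym ('l, 'x) based_poset_map = "('l \<Rightarrow> 'l) \<times> ('l \<Rightarrow> 'x \<Rightarrow> 'x)"

definition based_poset_isos ::
  "('l, 'x) based_poset \<Rightarrow> ('l, 'x) based_poset \<Rightarrow> ('l, 'x) based_poset_map set" where
  "based_poset_isos = (\<lambda>(L, r, f) (L', r', f'). {(\<alpha>, \<phi>).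
     \<alpha> \<in> extensional L \<and> bij_betw \<alpha> L L' \<and>
     (\<forall>x\<in>L. \<forall>y\<in>L. (x, y) \<in> r \<longleftrightarrow> (\<alpha> x, \<alpha> y) \<in> r') \<and>
     \<phi> \<in> extensional L \<and> (\<forall>x\<in>L. \<phi> x \<in> based_ring_iso (f x) (f' (\<alpha> x)))})"

definition based_poset_id :: "('l, 'x) based_poset \<Rightarrow> ('l, 'x) based_poset_map" where
  "based_poset_id = (\<lambda>(L, r, f). (\<lambda>x\<in>L. x, \<lambda>x\<in>L. \<lambda>y\<in>carrier (fst (f x)). y))"

definition based_poset_comp :: "('l, 'x) based_poset \<Rightarrow>
    ('l, 'x) based_poset_map \<Rightarrow> ('l, 'x) based_poset_map \<Rightarrow> ('l, 'x) based_poset_map" where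
  "based_poset_comp = (\<lambda>(L, r, f) (\<beta>, \<psi>) (\<alpha>, \<phi>).
     (compose L \<beta> \<alpha>, \<lambda>x\<in>L. compose (carrier (fst (f x))) (\<psi> (\<alpha> x)) (\<phi> x)))"

definition P_obj :: "('l, 'g, 'm, 'a) table_tuple \<Rightarrow> ('l, nat \<times> nat \<Rightarrow> 'g) based_poset" where
  "P_obj D = (Lam D, leq D,
     \<lambda>l\<in>Lam D. matrix_based_ring (card (Idx D l)) (Gam D l) (Bas D l))"

text \<open>The first argument of type \<open>'m itself\<close> fixes the type of the elements of the sets \<open>M(\<lambda>)\<close>,
  which does not occur in the type of \<open>P_obj D\<close>.\<close>

definition P_cat :: "'m itself \<Rightarrow> (laurent \<Rightarrow> 'a::ring \<Rightarrow> 'a) \<Rightarrow> ('a \<Rightarrow> laurent) \<Rightarrow> 'a set \<Rightarrow>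
    (('l, nat \<times> nat \<Rightarrow> 'g) based_poset, ('l, nat \<times> nat \<Rightarrow> 'g) based_poset_map) cat" where
  "P_cat TM scale \<tau> BB =
     \<lparr>Obj = P_obj ` (D_objects scale \<tau> BB :: ('l, 'g, 'm, 'a) table_tuple set),
      Hom = based_poset_isos,
      Ident = based_poset_id,
      Comp = (\<lambda>X Y Z g f. based_poset_comp X g f)\<rparr>"

end

theory Submission
  imports Defs
begin

text \<open>Axioms (A3), (A4) and the anti-automorphism force the leading coefficients
  \<open>\<gamma>\<^sub>X\<^sub>,\<^sub>Y\<^sub>,\<^sub>Z\<close> to be the structure constants of the sum over \<open>\<lambda>\<close> of the matrix rings over
  \<open>\<Gamma>(\<lambda>)\<close>, and a reduced partial order is the closure of the relation ``some multiple of an element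
  of the cell \<open>\<lambda>\<close> involves the cell \<open>\<mu>\<close>''. Both are intrinsic to \<open>(A, \<^bold>B)\<close>, so two parametrizations
  of \<open>\<^bold>B\<close> differ by a bijection of index sets that preserves these structure constants and the order.
  Conversely, precomposing a reduced datum with such a bijection preserves all axioms: (A3) says that
  left multiplication commutes, modulo lower cells, with the right action of the matrix ring, and the
  units and the involution are recovered from the structure constants. Finally, these bijections are
  exactly the restrictions to the bases of the isomorphisms of based posets.\<close>

text \<open>A bijection that preserves structure constants need not be a product of maps on rows,
  basis elements and columns. For a group ring Z[G] and elements h_i of G, sending e_ij times g to
  e_ij times h_i g h_j^-1 is an automorphism that permutes the matrix basis, yet it moves e_ij times
  1. So the coefficients r_a of (A3), which refer to rows and to the ring of the cell, cannot be
  carried over; only properties phrased by products survive, and each axiom has to be brought into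
  such a form before it is transported. The second obstacle is (A4): it says which leading
  coefficients are nonzero, but gives a value only if all three basis elements are 1. The other
  values come from (A3), from the constancy of the a-function on a cell, and from the
  anti-automorphism, which moves a basis element from the left factor to the right one. Finally,
  \<open>P_obj\<close> keeps of M only the cardinalities, so different table data may have the same
  based poset. Arrows are therefore matched relative to a pair of objects, and the quasi-inverse
  functor chooses preimages.\<close>

section \<open>A criterion for equivalence of categories\<close>

text \<open>A functor that is bijective on hom-sets and surjective on objects is an equivalence. Its
  arrow part is given as a relation \<open>R\<close>, so both directions of the bijection are
  treated alike, and the category laws of \<open>L\<close> need not be checked separately: they are
  inherited from \<open>K\<close> through \<open>R\<close>.\<close>

lemma equivalent_categoriesI:
  fixes K :: "('o, 'm) cat" and L :: "('p, 'n) cat"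
  assumes K: "category K"
    and obj: "Obj L = P ` Obj K"
    and R_hom: "\<And>X Y f g. X \<in> Obj K \<Longrightarrow> Y \<in> Obj K \<Longrightarrow> R X Y f g \<Longrightarrow>
      f \<in> Hom K X Y \<and> g \<in> Hom L (P X) (P Y)"
    and up_ex: "\<And>X Y f. X \<in> Obj K \<Longrightarrow> Y \<in> Obj K \<Longrightarrow> f \<in> Hom K X Y \<Longrightarrow> \<exists>!g. R X Y f g"
    and dn_ex: "\<And>X Y g. X \<in> Obj K \<Longrightarrow> Y \<in> Obj K \<Longrightarrow> g \<in> Hom L (P X) (P Y) \<Longrightarrow> \<exists>!f. R X Y f g"
    and R_id: "\<And>X. X \<in> Obj K \<Longrightarrow> R X X (Ident K X) (Ident L (P X))"
    and R_comp: "\<And>X Y Z f g u v. X \<in> Obj K \<Longrightarrow> Y \<in> Obj K \<Longrightarrow> Z \<in> Obj K \<Longrightarrow>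
      R X Y f u \<Longrightarrow> R Y Z g v \<Longrightarrow> R X Z (Comp K X Y Z g f) (Comp L (P X) (P Y) (P Z) v u)"
  shows "equivalent_categories K L"
proof -
  define up where "up X Y f = (THE g. R X Y f g)" for X Y f
  define dn where "dn X Y g = (THE f. R X Y f g)" for X Y g
  \<comment> \<open>\<open>P\<close> may identify objects, so \<open>G (P X)\<close> can differ from
    \<open>X\<close>; only \<open>P (G Y) = Y\<close> holds.\<close>
  define G where "G = inv_into (Obj K) P"
  have R_up: "R X Y f (up X Y f)" if "X \<in> Obj K" "Y \<in> Obj K" "f \<in> Hom K X Y" for X Y f
    unfolding up_def by (rule theI'[OF up_ex[OF that]])
  have R_dn: "R X Y (dn X Y g) g" if "X \<in> Obj K" "Y \<in> Obj K" "g \<in> Hom L (P X) (P Y)" for X Y g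
    unfolding dn_def by (rule theI'[OF dn_ex[OF that]])
  have R_fun: "g = g'" if "X \<in> Obj K" "Y \<in> Obj K" "R X Y f g" "R X Y f g'" for X Y f g g'
    using up_ex[OF that(1,2)] R_hom[OF that(1-3)] that(3,4) by blast
  have R_inj: "f = f'" if "X \<in> Obj K" "Y \<in> Obj K" "R X Y f g" "R X Y f' g" for X Y f f' g
    using dn_ex[OF that(1,2)] R_hom[OF that(1-3)] that(3,4) by blast
  have G: "G Y \<in> Obj K" "P (G Y) = Y" if "Y \<in> Obj L" for Y
    using that unfolding obj G_def by (auto intro: inv_into_into f_inv_into_f)
  have PL: "P X \<in> Obj L" if "X \<in> Obj K" for X using that obj by blast
  have K_comp: "Comp K X Y Z g f \<in> Hom K X Z"
    if "X \<in> Obj K" "Y \<in> Obj K" "Z \<in> Obj K" "f \<in> Hom K X Y" "g \<in> Hom K Y Z" for X Y Z f g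
    using K that unfolding category_def by blast
  have K_id: "Comp K X X Y f (Ident K X) = f" "Comp K X Y Y (Ident K Y) f = f"
    if "X \<in> Obj K" "Y \<in> Obj K" "f \<in> Hom K X Y" for X Y f
    using K that unfolding category_def by blast+
  have K_assoc: "Comp K W X Z (Comp K X Y Z h g) f = Comp K W Y Z h (Comp K W X Y g f)"
    if "W \<in> Obj K" "X \<in> Obj K" "Y \<in> Obj K" "Z \<in> Obj K" "f \<in> Hom K W X" "g \<in> Hom K X Y" "h \<in> Hom K Y Z"
    for W X Y Z f g h
    using K that unfolding category_def by blast
  \<comment> \<open>Each law of \<open>L\<close> is obtained by lifting the arrows along
    \<open>dn\<close>, using the law in \<open>K\<close>, and comparing the two images by
    \<open>R_fun\<close>.\<close>
  have L_id0: "Comp L (P X) (P X) (P Y) u (Ident L (P X)) = u"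
              "Comp L (P X) (P Y) (P Y) (Ident L (P Y)) u = u"
    if "X \<in> Obj K" "Y \<in> Obj K" "u \<in> Hom L (P X) (P Y)" for X Y u
  proof -
    note r = R_dn[OF that]
    note h = conjunct1[OF R_hom[OF that(1,2) r]]
    show "Comp L (P X) (P X) (P Y) u (Ident L (P X)) = u"
      using R_comp[OF that(1) that(1,2) R_id[OF that(1)] r] K_id(1)[OF that(1,2) h] r R_fun that(1,2)
      by metis
    show "Comp L (P X) (P Y) (P Y) (Ident L (P Y)) u = u"
      using R_comp[OF that(1) that(2) that(2) r R_id[OF that(2)]] K_id(2)[OF that(1,2) h] r R_fun that(1,2)
      by metis
  qed
  have L_comp0: "Comp L (P X) (P Y) (P Z) v u \<in> Hom L (P X) (P Z)"
    if "X \<in> Obj K" "Y \<in> Obj K" "Z \<in> Obj K" "u \<in> Hom L (P X) (P Y)" "v \<in> Hom L (P Y) (P Z)" for X Y Z u v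
    using R_hom[OF that(1,3) R_comp[OF that(1-3) R_dn[OF that(1,2,4)] R_dn[OF that(2,3,5)]]] by blast
  have L_assoc0: "Comp L (P W) (P X) (P Z) (Comp L (P X) (P Y) (P Z) h g) f =
      Comp L (P W) (P Y) (P Z) h (Comp L (P W) (P X) (P Y) g f)"
    if o: "W \<in> Obj K" "X \<in> Obj K" "Y \<in> Obj K" "Z \<in> Obj K"
      and h: "f \<in> Hom L (P W) (P X)" "g \<in> Hom L (P X) (P Y)" "h \<in> Hom L (P Y) (P Z)" for W X Y Z f g h
  proof -
    note rf = R_dn[OF o(1,2) h(1)] and rg = R_dn[OF o(2,3) h(2)] and rh = R_dn[OF o(3,4) h(3)]
    note a = R_comp[OF o(1,2,4) rf R_comp[OF o(2,3,4) rg rh]]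
    note b = R_comp[OF o(1,3,4) R_comp[OF o(1,2,3) rf rg] rh]
    show ?thesis
      using K_assoc[OF o conjunct1[OF R_hom[OF o(1,2) rf]] conjunct1[OF R_hom[OF o(2,3) rg]]
          conjunct1[OF R_hom[OF o(3,4) rh]]] R_fun[OF o(1,4) a] b by metis
  qed
  have L: "category L"
    unfolding category_def obj
    by (simp add: L_id0 L_comp0 L_assoc0 R_hom[OF _ _ R_id])
  define F where "F = (P, up)"
  define H where "H = (G, \<lambda>Y Y' g. dn (G Y) (G Y') g)"
  have F: "is_functor K L F"
    unfolding is_functor_def F_def fst_conv snd_conv
  proof (intro conjI ballI)
    fix X Y f assume "X \<in> Obj K" "Y \<in> Obj K" "f \<in> Hom K X Y"
    then show "up X Y f \<in> Hom L (P X) (P Y)" using R_up R_hom by blast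
  next
    fix X assume X: "X \<in> Obj K"
    show "up X X (Ident K X) = Ident L (P X)"
      using R_fun[OF X X R_up[OF X X] R_id[OF X]] R_hom[OF X X R_id[OF X]] by blast
  next
    fix X Y Z f g assume a: "X \<in> Obj K" "Y \<in> Obj K" "Z \<in> Obj K" "f \<in> Hom K X Y" "g \<in> Hom K Y Z"
    show "up X Z (Comp K X Y Z g f) = Comp L (P X) (P Y) (P Z) (up Y Z g) (up X Y f)"
      using R_fun[OF a(1,3) R_up[OF a(1,3) K_comp[OF a]] R_comp[OF a(1-3) R_up[OF a(1,2,4)] R_up[OF a(2,3,5)]]] .
  qed (use PL in auto)
  have H: "is_functor L K H"
    unfolding is_functor_def H_def fst_conv snd_conv
  proof (intro conjI ballI)
    fix X Y f assume a: "X \<in> Obj L" "Y \<in> Obj L" "f \<in> Hom L X Y"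
    then show "dn (G X) (G Y) f \<in> Hom K (G X) (G Y)"
      using R_hom[OF G(1)[OF a(1)] G(1)[OF a(2)] R_dn] G by fastforce
  next
    fix X assume X: "X \<in> Obj L"
    note g = G[OF X]
    show "dn (G X) (G X) (Ident L X) = Ident K (G X)"
      using R_inj[OF g(1) g(1) R_dn[OF g(1) g(1)] R_id[OF g(1)]] R_hom[OF g(1) g(1) R_id[OF g(1)]] g(2)
      by simp
  next
    fix X Y Z f g assume a: "X \<in> Obj L" "Y \<in> Obj L" "Z \<in> Obj L" "f \<in> Hom L X Y" "g \<in> Hom L Y Z"
    note x = G[OF a(1)] and y = G[OF a(2)] and z = G[OF a(3)]
    have f: "f \<in> Hom L (P (G X)) (P (G Y))" and g: "g \<in> Hom L (P (G Y)) (P (G Z))"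
      using a x y z by auto
    show "dn (G X) (G Z) (Comp L X Y Z g f) = Comp K (G X) (G Y) (G Z) (dn (G Y) (G Z) g) (dn (G X) (G Y) f)"
      using R_inj[OF x(1) z(1) R_dn[OF x(1) z(1) L_comp0[OF x(1) y(1) z(1) f g]]
        R_comp[OF x(1) y(1) z(1) R_dn[OF x(1) y(1) f] R_dn[OF y(1) z(1) g]]] x y z by simp
  qed (use G in auto)
  \<comment> \<open>Since \<open>P (G (P X)) = P X\<close>, the identity of \<open>P X\<close> is
    also the image of an arrow from \<open>X\<close> to \<open>G (P X)\<close>. Lifted the other way
    round it gives the inverse.\<close>
  define \<eta> where "\<eta> X = dn X (G (P X)) (Ident L (P X))" for X
  have GP: "G (P X) \<in> Obj K" "P (G (P X)) = P X" if "X \<in> Obj K" for X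
    using G PL that by auto
  have id_hom: "Ident L (P X) \<in> Hom L (P X) (P X)" if "X \<in> Obj K" for X
    using R_hom[OF that that R_id[OF that]] by blast
  have R_\<eta>: "R X (G (P X)) (\<eta> X) (Ident L (P X))" if "X \<in> Obj K" for X
    unfolding \<eta>_def using R_dn[OF that GP(1)[OF that]] GP(2)[OF that] id_hom[OF that] by simp
  have \<eta>: "natural_iso K K id_functor (comp_functor H F) \<eta>"
    unfolding natural_iso_def id_functor_def comp_functor_def F_def H_def fst_conv snd_conv
  proof (intro conjI ballI)
    fix X assume X: "X \<in> Obj K"
    note g = GP[OF X]
    define \<theta> where "\<theta> = dn (G (P X)) X (Ident L (P X))"
    have \<theta>: "R (G (P X)) X \<theta> (Ident L (P X))"
      unfolding \<theta>_def using R_dn[OF g(1) X] g(2) id_hom[OF X] by simp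
    have "Comp K X (G (P X)) X \<theta> (\<eta> X) = Ident K X"
      using R_inj[OF X X R_comp[OF X g(1) X R_\<eta>[OF X] \<theta>]] R_id[OF X] L_id0(1)[OF X X id_hom[OF X]] g(2)
      by simp
    moreover have "Comp K (G (P X)) X (G (P X)) (\<eta> X) \<theta> = Ident K (G (P X))"
      using R_inj[OF g(1) g(1) R_comp[OF g(1) X g(1) \<theta> R_\<eta>[OF X]]] R_id[OF g(1)]
        L_id0(1)[OF X X id_hom[OF X]] g(2) by simp
    ultimately show "is_iso K X (G (P X)) (\<eta> X)"
      unfolding is_iso_def using R_hom[OF X g(1) R_\<eta>[OF X]] R_hom[OF g(1) X \<theta>] by blast
  next
    fix X Y f assume a: "X \<in> Obj K" "Y \<in> Obj K" "f \<in> Hom K X Y"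
    note x = GP[OF a(1)] and y = GP[OF a(2)] and r = R_up[OF a]
    have u: "up X Y f \<in> Hom L (P X) (P Y)" using R_hom[OF a(1,2) r] by blast
    have d: "R (G (P X)) (G (P Y)) (dn (G (P X)) (G (P Y)) (up X Y f)) (up X Y f)"
      using R_dn[OF x(1) y(1)] u x(2) y(2) by simp
    show "Comp K X Y (G (P Y)) (\<eta> Y) f =
        Comp K X (G (P X)) (G (P Y)) (dn (G (P X)) (G (P Y)) (up X Y f)) (\<eta> X)"
      using R_inj[OF a(1) y(1) R_comp[OF a(1,2) y(1) r R_\<eta>[OF a(2)]]]
        R_comp[OF a(1) x(1) y(1) R_\<eta>[OF a(1)] d] L_id0[OF a(1,2) u] x(2) y(2) by simp
  qed
  \<comment> \<open>On this side the composite fixes every object and every arrow, so identities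
    suffice.\<close>
  have \<epsilon>: "natural_iso L L (comp_functor F H) id_functor (Ident L)"
    unfolding natural_iso_def id_functor_def comp_functor_def F_def H_def fst_conv snd_conv
  proof (intro conjI ballI)
    fix Y assume "Y \<in> Obj L"
    then obtain X where X: "X \<in> Obj K" "Y = P X" using obj by blast
    then show "is_iso L (P (G Y)) Y (Ident L Y)"
      unfolding is_iso_def using id_hom[OF X(1)] L_id0(1)[OF X(1) X(1) id_hom[OF X(1)]] GP(2)[OF X(1)]
      by auto
  next
    fix X Y f assume a: "X \<in> Obj L" "Y \<in> Obj L" "f \<in> Hom L X Y"
    note x = G[OF a(1)] and y = G[OF a(2)]
    have f: "f \<in> Hom L (P (G X)) (P (G Y))" using a(3) x y by simp
    note d = R_dn[OF x(1) y(1) f]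
    have "up (G X) (G Y) (dn (G X) (G Y) f) = f"
      using R_fun[OF x(1) y(1) R_up[OF x(1) y(1)] d] R_hom[OF x(1) y(1) d] by blast
    then show "Comp L (P (G X)) (P (G Y)) Y (Ident L Y) (up (G X) (G Y) (dn (G X) (G Y) f)) =
        Comp L (P (G X)) X Y f (Ident L X)"
      using L_id0[OF x(1) y(1) f] x y by simp
  qed
  show ?thesis
    unfolding equivalent_categories_def using K L F H \<eta> \<epsilon> by blast
qed

section \<open>Rings with a distinguished integral basis\<close>

lemma zcoords_unique:
  assumes "zbasis R B" "x \<in> carrier R" "zcoords R B x c" "zcoords R B x d"
  shows "c = d"
  using assms unfolding zbasis_def by blast

lemma zcoords_kappa:
  assumes "zbasis R B" "x \<in> carrier R"
  shows "zcoords R B x (\<lambda>b. kappa R B b x)"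
  using theI'[of "zcoords R B x"] assms unfolding zbasis_def kappa_def by fastforce

lemma kappa_eq:
  assumes "zbasis R B" "x \<in> carrier R" "zcoords R B x c"
  shows "kappa R B b x = c b"
  using zcoords_unique[OF assms(1,2) zcoords_kappa[OF assms(1,2)] assms(3)] by metis

lemma finite_kappa:
  assumes "zbasis R B" "x \<in> carrier R"
  shows "finite {b. kappa R B b x \<noteq> 0}"
  using zcoords_kappa[OF assms] unfolding zcoords_def by blast

lemma kappa_nonzero_in:
  assumes "zbasis R B" "x \<in> carrier R" "kappa R B b x \<noteq> 0"
  shows "b \<in> B"
  using zcoords_kappa[OF assms(1,2)] assms(3) unfolding zcoords_def by blast

lemma kappa_eqI:
  assumes "zbasis R B" "x \<in> carrier R" "y \<in> carrier R"
    and "\<And>b. b \<in> B \<Longrightarrow> kappa R B b x = kappa R B b y"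
  shows "x = y"
proof -
  have "kappa R B b x = kappa R B b y" for b
    using assms kappa_nonzero_in[OF assms(1)] by metis
  then show ?thesis
    using zcoords_kappa[OF assms(1,2)] zcoords_kappa[OF assms(1,3)] unfolding zcoords_def by simp
qed

context ring
begin

lemma zcomb_superset:
  assumes "finite F" "{b. c b \<noteq> 0} \<subseteq> F" "F \<subseteq> carrier R"
  shows "zcomb R c = finsum R (\<lambda>b. add_pow R (c b) b) F"
  unfolding zcomb_def
  by (rule add.finprod_mono_neutral_cong_left) (use assms in \<open>auto simp: add_pow_int_ge\<close>)

lemma zcomb_closed:
  assumes "{b. c b \<noteq> 0} \<subseteq> carrier R"
  shows "zcomb R c \<in> carrier R"
  unfolding zcomb_def using assms by (intro finsum_closed) auto

lemma zcoords_add: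
  assumes "B \<subseteq> carrier R" "zcoords R B x c" "zcoords R B y d"
  shows "zcoords R B (x \<oplus> y) (\<lambda>b. c b + d b)"
proof -
  define F where "F = {b. c b \<noteq> 0} \<union> {b. d b \<noteq> 0}"
  have F: "finite F" "F \<subseteq> B" "{b. c b \<noteq> 0} \<subseteq> F" "{b. d b \<noteq> 0} \<subseteq> F" "{b. c b + d b \<noteq> 0} \<subseteq> F"
    using assms unfolding F_def zcoords_def by auto
  then have FR: "F \<subseteq> carrier R" using assms(1) by blast
  have "finsum R (\<lambda>b. add_pow R (c b + d b) b) F = finsum R (\<lambda>b. add_pow R (c b) b \<oplus> add_pow R (d b) b) F"
    by (rule finsum_cong) (use FR in \<open>auto simp: simp_implies_def add.int_pow_mult\<close>)
  also have "\<dots> = finsum R (\<lambda>b. add_pow R (c b) b) F \<oplus> finsum R (\<lambda>b. add_pow R (d b) b) F"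
    by (rule finsum_addf) (use FR in auto)
  finally show ?thesis
    using assms(2,3) F FR finite_subset[OF F(5,1)]
    unfolding zcoords_def by (auto simp: zcomb_superset[OF F(1)])
qed

lemma zcoords_basis:
  assumes "b \<in> B" "b \<in> carrier R"
  shows "zcoords R B b (\<lambda>c. if c = b then 1 else 0)"
proof -
  have "zcomb R (\<lambda>c. if c = b then 1 else 0) = b"
    using assms by (subst zcomb_superset[of "{b}"]) (auto)
  then show ?thesis using assms unfolding zcoords_def by simp
qed

lemma kappa_add:
  assumes "zbasis R B" "x \<in> carrier R" "y \<in> carrier R"
  shows "kappa R B b (x \<oplus> y) = kappa R B b x + kappa R B b y"
  using kappa_eq[OF assms(1) _ zcoords_add[OF _ zcoords_kappa zcoords_kappa]] assms
  unfolding zbasis_def by auto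

lemma kappa_basis:
  assumes "zbasis R B" "b \<in> B"
  shows "kappa R B c b = (if c = b then 1 else 0)"
  using kappa_eq[OF assms(1) _ zcoords_basis[OF assms(2)]] assms unfolding zbasis_def by auto

lemma kappa_zero:
  assumes "zbasis R B"
  shows "kappa R B b \<zero> = 0"
  using kappa_add[OF assms, of \<zero> \<zero>] by simp

lemma additive_zcomb:
  fixes h :: "'a \<Rightarrow> 'z::ring_1"
  assumes h: "\<And>x y. x \<in> carrier R \<Longrightarrow> y \<in> carrier R \<Longrightarrow> h (x \<oplus> y) = h x + h y"
    and "finite S" "S \<subseteq> carrier R"
  shows "h (finsum R (\<lambda>b. add_pow R (c b) b) S) = (\<Sum>b\<in>S. of_int (c b) * h b)"
proof -
  have h0: "h \<zero> = 0" using h[of \<zero> \<zero>] by simp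
  have hneg: "h (\<ominus> x) = - h x" if "x \<in> carrier R" for x
    using h[of x "\<ominus> x"] that h0 by (simp add: r_neg eq_neg_iff_add_eq_0 add.commute)
  have hnat: "h (add_pow R (n::nat) x) = of_nat n * h x" if "x \<in> carrier R" for n x
    using that by (induction n) (auto simp: h h0 algebra_simps)
  have hint: "h (add_pow R (k::int) x) = of_int k * h x" if x: "x \<in> carrier R" for k x
  proof (cases "k \<ge> 0")
    case True
    then obtain n where "k = int n" using nonneg_int_cases by blast
    then show ?thesis using hnat[OF x, of n] by (simp add: add_pow_int_ge)
  next
    case False
    then obtain n where n: "k = - int n" by (metis int_cases2 linorder_le_cases of_nat_0_le_iff)
    then have "add_pow R k x = \<ominus> (add_pow R n x)" 
      using add.int_pow_neg_int[OF x, of n] by simp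
    then show ?thesis using hneg hnat[OF x, of n] n x by simp
  qed
  from assms(2,3) show ?thesis
  proof (induction S)
    case (insert b S)
    have "(\<lambda>b. add_pow R (c b) b) \<in> S \<rightarrow> carrier R" using insert.prems by auto
    then show ?case using insert by (simp add: h hint finsum_closed)
  qed (simp add: h0)
qed

text \<open>Reduces identities for additive functions, in particular for coordinates of products in
  either factor, to basis elements.\<close>

lemma additive_expand:
  fixes h :: "'a \<Rightarrow> 'z::ring_1"
  assumes "zbasis R B" "x \<in> carrier R"
    and h: "\<And>x y. x \<in> carrier R \<Longrightarrow> y \<in> carrier R \<Longrightarrow> h (x \<oplus> y) = h x + h y"
  shows "h x = (\<Sum>b | kappa R B b x \<noteq> 0. of_int (kappa R B b x) * h b)"
proof -
  have z: "zcoords R B x (\<lambda>b. kappa R B b x)" by (rule zcoords_kappa[OF assms(1,2)])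
  have x: "x = finsum R (\<lambda>b. add_pow R (kappa R B b x) b) {b. kappa R B b x \<noteq> 0}"
    using z unfolding zcoords_def zcomb_def by blast
  have "{b. kappa R B b x \<noteq> 0} \<subseteq> carrier R"
    using z assms(1) unfolding zcoords_def zbasis_def by blast
  then show ?thesis
    using additive_zcomb[where h=h, OF h finite_kappa[OF assms(1,2)], of "\<lambda>b. kappa R B b x"]
    unfolding x[symmetric] by blast
qed

text \<open>The equalizer \<open>E\<close> of the two maps is a subgroup containing
  \<open>B\<close>, and every element is a finite integer combination of \<open>B\<close>.\<close>

lemma additive_eq_on_zbasis:
  assumes B: "zbasis R B" and S: "abelian_group S"
    and f: "f \<in> carrier R \<rightarrow> carrier S" "\<And>x y. x \<in> carrier R \<Longrightarrow> y \<in> carrier R \<Longrightarrow> f (x \<oplus> y) = f x \<oplus>\<^bsub>S\<^esub> f y"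
    and g: "g \<in> carrier R \<rightarrow> carrier S" "\<And>x y. x \<in> carrier R \<Longrightarrow> y \<in> carrier R \<Longrightarrow> g (x \<oplus> y) = g x \<oplus>\<^bsub>S\<^esub> g y"
    and eq: "\<And>b. b \<in> B \<Longrightarrow> f b = g b"
    and x: "x \<in> carrier R"
  shows "f x = g x"
proof -
  interpret S: abelian_group S by (rule S)
  define E where "E = {x \<in> carrier R. f x = g x}"
  have E0: "\<zero> \<in> E"
    using f(2)[of \<zero> \<zero>] g(2)[of \<zero> \<zero>] f(1) g(1) unfolding E_def by (auto simp: Pi_iff)
  have Eadd: "x \<oplus> y \<in> E" if "x \<in> E" "y \<in> E" for x y
    using that f(2) g(2) unfolding E_def by auto
  have Eneg: "\<ominus> x \<in> E" if "x \<in> E" for x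
  proof -
    have x: "x \<in> carrier R" "f x = g x" using that unfolding E_def by auto
    have "f x \<oplus>\<^bsub>S\<^esub> f (\<ominus> x) = f x \<oplus>\<^bsub>S\<^esub> g (\<ominus> x)"
      using f(2)[of x "\<ominus> x"] g(2)[of x "\<ominus> x"] x E0 unfolding E_def by (simp add: r_neg)
    then show ?thesis using x f(1) g(1) unfolding E_def by (auto simp: Pi_iff)
  qed
  have Enat: "add_pow R (n::nat) x \<in> E" if "x \<in> E" for n x
    using that by (induction n) (auto simp: E0 Eadd)
  have Eint: "add_pow R (k::int) x \<in> E" if "x \<in> E" for k x
  proof -
    have x: "x \<in> carrier R" using that unfolding E_def by auto
    show ?thesis
    proof (cases k rule: int_cases2)
      case (nonneg n)
      then show ?thesis using Enat[OF that, of n] by (simp add: add_pow_int_ge)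
    next
      case (nonpos n)
      then show ?thesis using Eneg[OF Enat[OF that, of n]] add.int_pow_neg_int[OF x, of n] by simp
    qed
  qed
  have "finsum R (\<lambda>b. add_pow R (c b) b) F \<in> E" if "finite F" "F \<subseteq> B" for c :: "_ \<Rightarrow> int" and F
    using that
  proof (induction F)
    case (insert b F)
    have "B \<subseteq> E" using B eq unfolding E_def zbasis_def by auto
    then have b: "b \<in> E" and F: "b \<in> carrier R" "(\<lambda>b. add_pow R (c b) b) \<in> F \<rightarrow> carrier R"
      using insert.prems unfolding E_def by auto
    have "finsum R (\<lambda>b. add_pow R (c b) b) (insert b F) = add_pow R (c b) b \<oplus> finsum R (\<lambda>b. add_pow R (c b) b) F"
      using insert.hyps F by (intro finsum_insert) auto
    then show ?case using insert.IH insert.prems Eadd[OF Eint[OF b]] by simp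
  qed (simp add: E0)
  moreover have "x = finsum R (\<lambda>b. add_pow R (kappa R B b x) b) {b. kappa R B b x \<noteq> 0}"
    "finite {b. kappa R B b x \<noteq> 0}" "{b. kappa R B b x \<noteq> 0} \<subseteq> B"
    using zcoords_kappa[OF B x] unfolding zcoords_def zcomb_def by blast+
  ultimately have "x \<in> E" by metis
  then show ?thesis unfolding E_def by blast
qed

end

lemma kappa_mult_right:
  assumes "ring R" "zbasis R B" "x \<in> carrier R" "y \<in> carrier R"
  shows "kappa R B c (x \<otimes>\<^bsub>R\<^esub> y) = (\<Sum>b | kappa R B b y \<noteq> 0. kappa R B b y * kappa R B c (x \<otimes>\<^bsub>R\<^esub> b))"
proof -
  interpret R: ring R by fact
  show ?thesis
    by (rule R.additive_expand[where h="\<lambda>y. kappa R B c (x \<otimes>\<^bsub>R\<^esub> y)", OF assms(2,4), unfolded of_int_eq_id id_apply])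
      (simp add: assms R.r_distr R.kappa_add)
qed

lemma kappa_mult_left:
  assumes "ring R" "zbasis R B" "x \<in> carrier R" "y \<in> carrier R"
  shows "kappa R B c (x \<otimes>\<^bsub>R\<^esub> y) = (\<Sum>b | kappa R B b x \<noteq> 0. kappa R B b x * kappa R B c (b \<otimes>\<^bsub>R\<^esub> y))"
proof -
  interpret R: ring R by fact
  show ?thesis
    by (rule R.additive_expand[where h="\<lambda>x. kappa R B c (x \<otimes>\<^bsub>R\<^esub> y)", OF assms(2,3), unfolded of_int_eq_id id_apply])
      (simp add: assms R.l_distr R.kappa_add)
qed

text \<open>Relabelling coordinates along \<open>f\<close> is additive and bijective; by bilinearity
  it is multiplicative as soon as it is so on the basis. Hence an isomorphism of based rings is the
  same thing as a bijection of bases that preserves structure constants.\<close>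

lemma based_ring_iso_extend:
  assumes R: "ring R" "zbasis R B" and S: "ring S" "zbasis S B'"
    and f: "bij_betw f B B'"
    and fk: "\<And>a b c. a \<in> B \<Longrightarrow> b \<in> B \<Longrightarrow> c \<in> B \<Longrightarrow>
      kappa S B' (f c) (f a \<otimes>\<^bsub>S\<^esub> f b) = kappa R B c (a \<otimes>\<^bsub>R\<^esub> b)"
  shows "\<exists>\<phi> \<in> based_ring_iso (R, B) (S, B'). \<forall>b\<in>B. \<phi> b = f b"
proof -
  interpret R: ring R by fact
  interpret S: ring S by fact
  have BR: "B \<subseteq> carrier R" and BS: "B' \<subseteq> carrier S" using R(2) S(2) unfolding zbasis_def by auto
  define g where "g = inv_into B f"
  have fB: "f b \<in> B'" "g (f b) = b" if "b \<in> B" for b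
    using f that unfolding g_def bij_betw_def by (auto intro: inv_into_f_f)
  have gB: "g b \<in> B" "f (g b) = b" if "b \<in> B'" for b
    using f that unfolding g_def bij_betw_def by (auto intro: inv_into_into f_inv_into_f)
  define co where "co x b = (if b \<in> B' then kappa R B (g b) x else 0)" for x b
  define \<phi> where "\<phi> = (\<lambda>x\<in>carrier R. zcomb S (co x))"
  have supp: "{b. co x b \<noteq> 0} = f ` {b. kappa R B b x \<noteq> 0}" if "x \<in> carrier R" for x
  proof (intro equalityI subsetI)
    fix b assume "b \<in> {b. co x b \<noteq> 0}"
    then have "b \<in> B'" "kappa R B (g b) x \<noteq> 0" unfolding co_def by (auto split: if_splits)
    then show "b \<in> f ` {b. kappa R B b x \<noteq> 0}" using gB(2) by (intro image_eqI[of _ _ "g b"]) auto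
  next
    fix b assume "b \<in> f ` {b. kappa R B b x \<noteq> 0}"
    then show "b \<in> {b. co x b \<noteq> 0}" using kappa_nonzero_in[OF R(2) that] fB unfolding co_def by auto
  qed
  have \<phi>c: "zcoords S B' (\<phi> x) (co x)" if "x \<in> carrier R" for x
    unfolding zcoords_def supp[OF that]
    using finite_kappa[OF R(2) that] kappa_nonzero_in[OF R(2) that] fB that
    by (auto simp: \<phi>_def)
  have \<phi>C: "\<phi> x \<in> carrier S" if "x \<in> carrier R" for x
  proof -
    have "{b. co x b \<noteq> 0} \<subseteq> carrier S" using BS unfolding co_def by auto
    then show ?thesis using that S.zcomb_closed unfolding \<phi>_def by simp
  qed
  have k\<phi>: "kappa S B' (f b) (\<phi> x) = kappa R B b x" if "x \<in> carrier R" "b \<in> B" for x b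
    using kappa_eq[OF S(2) \<phi>C[OF that(1)] \<phi>c[OF that(1)]] fB[OF that(2)] by (simp add: co_def)
  have eqI: "y = z" if "y \<in> carrier S" "z \<in> carrier S"
    "\<And>b. b \<in> B \<Longrightarrow> kappa S B' (f b) y = kappa S B' (f b) z" for y z
    by (rule kappa_eqI[OF S(2) that(1,2)]) (use that(3) gB in metis)
  have \<phi>f: "\<phi> b = f b" if "b \<in> B" for b
  proof (rule eqI)
    fix c assume "c \<in> B"
    then show "kappa S B' (f c) (\<phi> b) = kappa S B' (f c) (f b)"
      using k\<phi> BR that R.kappa_basis[OF R(2) that] S.kappa_basis[OF S(2) fB(1)[OF that]] fB(2)
      by (auto simp: subset_iff) metis
  qed (use \<phi>C BR BS fB that in auto)
  \<comment> \<open>Reindexing along \<open>f\<close> turns an expansion over \<open>B'\<close> into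
    one over \<open>B\<close>; it is used once for each factor of a product.\<close>
  have sumf: "(\<Sum>b | kappa S B' b (\<phi> x) \<noteq> 0. kappa S B' b (\<phi> x) * h b) =
      (\<Sum>b | kappa R B b x \<noteq> 0. kappa R B b x * h (f b))" if x: "x \<in> carrier R" for x h
  proof -
    have "{b. kappa S B' b (\<phi> x) \<noteq> 0} = f ` {b. kappa R B b x \<noteq> 0}"
      using supp[OF x] kappa_eq[OF S(2) \<phi>C[OF x] \<phi>c[OF x]] by simp
    moreover have "inj_on f {b. kappa R B b x \<noteq> 0}"
      using f kappa_nonzero_in[OF R(2) x] unfolding bij_betw_def by (auto intro: inj_on_subset)
    ultimately show ?thesis
      using k\<phi>[OF x] kappa_nonzero_in[OF R(2) x] by (simp add: sum.reindex)
  qed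
  have \<phi>add: "\<phi> (x \<oplus>\<^bsub>R\<^esub> y) = \<phi> x \<oplus>\<^bsub>S\<^esub> \<phi> y" if "x \<in> carrier R" "y \<in> carrier R" for x y
    by (rule eqI) (use that in \<open>auto simp: \<phi>C k\<phi> R.kappa_add[OF R(2)] S.kappa_add[OF S(2)]\<close>)
  have \<phi>mult: "\<phi> (x \<otimes>\<^bsub>R\<^esub> y) = \<phi> x \<otimes>\<^bsub>S\<^esub> \<phi> y" if x: "x \<in> carrier R" and y: "y \<in> carrier R" for x y
  proof (rule eqI)
    fix c assume c: "c \<in> B"
    have xB: "b \<in> B" if "kappa R B b x \<noteq> 0" for b using kappa_nonzero_in[OF R(2) x that] .
    have yB: "b \<in> B" if "kappa R B b y \<noteq> 0" for b using kappa_nonzero_in[OF R(2) y that] .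
    have "kappa S B' (f c) (\<phi> x \<otimes>\<^bsub>S\<^esub> \<phi> y) =
        (\<Sum>a | kappa R B a x \<noteq> 0. kappa R B a x * kappa S B' (f c) (f a \<otimes>\<^bsub>S\<^esub> \<phi> y))"
      unfolding kappa_mult_left[OF S \<phi>C[OF x] \<phi>C[OF y]] by (rule sumf[OF x])
    also have "\<dots> = (\<Sum>a | kappa R B a x \<noteq> 0. kappa R B a x * kappa R B c (a \<otimes>\<^bsub>R\<^esub> y))"
    proof (rule sum.cong[OF refl])
      fix a assume "a \<in> {a. kappa R B a x \<noteq> 0}"
      then have a: "a \<in> B" using xB by blast
      have "kappa S B' (f c) (f a \<otimes>\<^bsub>S\<^esub> \<phi> y) =
          (\<Sum>b | kappa R B b y \<noteq> 0. kappa R B b y * kappa S B' (f c) (f a \<otimes>\<^bsub>S\<^esub> f b))"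
        using kappa_mult_right[OF S _ \<phi>C[OF y], of "f a"] sumf[OF y] fB(1)[OF a] BS by auto
      also have "\<dots> = (\<Sum>b | kappa R B b y \<noteq> 0. kappa R B b y * kappa R B c (a \<otimes>\<^bsub>R\<^esub> b))"
        using fk[OF a _ c] yB by (intro sum.cong) auto
      also have "\<dots> = kappa R B c (a \<otimes>\<^bsub>R\<^esub> y)"
        using kappa_mult_right[OF R _ y, of a] a BR by auto
      finally show "kappa R B a x * kappa S B' (f c) (f a \<otimes>\<^bsub>S\<^esub> \<phi> y) = kappa R B a x * kappa R B c (a \<otimes>\<^bsub>R\<^esub> y)"
        by simp
    qed
    also have "\<dots> = kappa R B c (x \<otimes>\<^bsub>R\<^esub> y)"
      using kappa_mult_left[OF R x y] by simp
    finally show "kappa S B' (f c) (\<phi> (x \<otimes>\<^bsub>R\<^esub> y)) = kappa S B' (f c) (\<phi> x \<otimes>\<^bsub>S\<^esub> \<phi> y)"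
      using k\<phi>[OF _ c, of "x \<otimes>\<^bsub>R\<^esub> y"] x y by simp
  qed (use x y \<phi>C in auto)
  have inj: "inj_on \<phi> (carrier R)"
    by (rule inj_onI) (rule kappa_eqI[OF R(2)], auto, metis k\<phi>)
  have surj: "\<exists>x\<in>carrier R. \<phi> x = y" if y: "y \<in> carrier S" for y
  proof -
    define d where "d b = (if b \<in> B then kappa S B' (f b) y else 0)" for b
    have s: "{b. d b \<noteq> 0} \<subseteq> B" by (auto simp: d_def)
    have "f ` {b. d b \<noteq> 0} \<subseteq> {b. kappa S B' b y \<noteq> 0}" by (auto simp: d_def split: if_splits)
    moreover have "inj_on f {b. d b \<noteq> 0}" using f s unfolding bij_betw_def by (auto intro: inj_on_subset)
    ultimately have fin: "finite {b. d b \<noteq> 0}"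
      using finite_kappa[OF S(2) y] by (meson finite_imageD finite_subset)
    have x: "zcomb R d \<in> carrier R" using R.zcomb_closed[of d] s BR by blast
    have "zcoords R B (zcomb R d) d" unfolding zcoords_def using fin s by blast
    then have kx: "kappa R B b (zcomb R d) = d b" for b using kappa_eq[OF R(2) x] by blast
    have "\<phi> (zcomb R d) = y"
      by (rule eqI) (use x y \<phi>C k\<phi> kx in \<open>auto simp: d_def\<close>)
    then show ?thesis using x by blast
  qed
  have bij: "bij_betw \<phi> (carrier R) (carrier S)"
    unfolding bij_betw_def using inj surj \<phi>C by (auto simp: image_iff)
  \<comment> \<open>The unit need not lie in the basis (a matrix ring of size above 1 is an
    example), so it is caught by surjectivity: the image of 1 acts as a right unit on a preimage of
    1.\<close>
  have \<phi>1: "\<phi> \<one>\<^bsub>R\<^esub> = \<one>\<^bsub>S\<^esub>"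
  proof -
    obtain x where x: "x \<in> carrier R" "\<phi> x = \<one>\<^bsub>S\<^esub>" using surj[of "\<one>\<^bsub>S\<^esub>"] by auto
    then show ?thesis using \<phi>mult[of x "\<one>\<^bsub>R\<^esub>"] \<phi>C[of "\<one>\<^bsub>R\<^esub>"] by simp
  qed
  have "\<phi> \<in> ring_iso R S"
    using \<phi>C \<phi>add \<phi>mult \<phi>1 bij unfolding ring_iso_def ring_hom_def by auto
  moreover have "bij_betw \<phi> B B'" using f \<phi>f by (simp cong: bij_betw_cong)
  moreover have "\<phi> \<in> extensional (carrier R)" unfolding \<phi>_def by simp
  ultimately show ?thesis unfolding based_ring_iso_def using \<phi>f by auto
qed

lemma based_ring_iso_eqI:
  assumes "ring R" "zbasis R B" "ring S"
    and "\<phi> \<in> based_ring_iso (R, B) (S, B')" "\<psi> \<in> based_ring_iso (R, B) (S, B')"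
    and "\<And>b. b \<in> B \<Longrightarrow> \<phi> b = \<psi> b"
  shows "\<phi> = \<psi>"
proof (rule extensionalityI)
  fix x assume x: "x \<in> carrier R"
  have hom: "f \<in> carrier R \<rightarrow> carrier S"
    "\<And>x y. x \<in> carrier R \<Longrightarrow> y \<in> carrier R \<Longrightarrow> f (x \<oplus>\<^bsub>R\<^esub> y) = f x \<oplus>\<^bsub>S\<^esub> f y"
    if "f \<in> based_ring_iso (R, B) (S, B')" for f
    using that unfolding based_ring_iso_def ring_iso_def ring_hom_def by auto
  show "\<phi> x = \<psi> x"
    by (rule ring.additive_eq_on_zbasis[OF assms(1,2) ring.is_abelian_group[OF assms(3)]
          hom[OF assms(4)] hom[OF assms(5)] assms(6) x])
qed (use assms in \<open>auto simp: based_ring_iso_def\<close>)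

lemma based_ring_iso_kappa:
  assumes R: "ring R" "zbasis R B" and S: "ring S" "zbasis S B'"
    and \<phi>: "\<phi> \<in> based_ring_iso (R, B) (S, B')"
    and x: "x \<in> carrier R" and b: "b \<in> B"
  shows "kappa S B' (\<phi> b) (\<phi> x) = kappa R B b x"
proof -
  interpret R: ring R by fact
  interpret S: ring S by fact
  have h: "\<phi> x \<in> carrier S" "\<phi> (x \<oplus>\<^bsub>R\<^esub> y) = \<phi> x \<oplus>\<^bsub>S\<^esub> \<phi> y" if "x \<in> carrier R" "y \<in> carrier R" for x y
    using \<phi> that unfolding based_ring_iso_def ring_iso_def ring_hom_def by auto
  have bij: "bij_betw \<phi> B B'" using \<phi> unfolding based_ring_iso_def by auto
  have "kappa S B' (\<phi> b) (\<phi> x) =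
      (\<Sum>c | kappa R B c x \<noteq> 0. of_int (kappa R B c x) * kappa S B' (\<phi> b) (\<phi> c))"
    by (rule R.additive_expand[OF R(2) x]) (use h S.kappa_add[OF S(2)] in auto)
  also have "\<dots> = (\<Sum>c | kappa R B c x \<noteq> 0. of_int (kappa R B c x) * kappa R B b c)"
  proof (rule sum.cong[OF refl])
    fix c assume "c \<in> {c. kappa R B c x \<noteq> 0}"
    then have c: "c \<in> B" using kappa_nonzero_in[OF R(2) x] by blast
    then have "\<phi> c \<in> B'" "\<phi> b = \<phi> c \<longleftrightarrow> b = c" using bij b unfolding bij_betw_def inj_on_def by auto
    then show "of_int (kappa R B c x) * kappa S B' (\<phi> b) (\<phi> c) = of_int (kappa R B c x) * kappa R B b c"
      using R.kappa_basis[OF R(2) c] S.kappa_basis[OF S(2)] by simp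
  qed
  also have "\<dots> = kappa R B b x"
    by (rule R.additive_expand[OF R(2) x, symmetric]) (use R.kappa_add[OF R(2)] in auto)
  finally show ?thesis .
qed

section \<open>Matrix rings\<close>

text \<open>The interchange of sums behind the associativity of the matrix product.\<close>

lemma (in abelian_monoid) finsum_swap:
  assumes "finite A" "finite B" "\<And>i j. i \<in> A \<Longrightarrow> j \<in> B \<Longrightarrow> f i j \<in> carrier G"
  shows "finsum G (\<lambda>i. finsum G (\<lambda>j. f i j) B) A = finsum G (\<lambda>j. finsum G (\<lambda>i. f i j) A) B"
  using assms(1,3)
proof (induction A)
  case (insert a A)
  have c: "(\<lambda>j. f a j) \<in> B \<rightarrow> carrier G" "\<And>i. i \<in> A \<Longrightarrow> (\<lambda>j. f i j) \<in> B \<rightarrow> carrier G"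
      "\<And>j. j \<in> B \<Longrightarrow> (\<lambda>i. f i j) \<in> A \<rightarrow> carrier G" "\<And>j. j \<in> B \<Longrightarrow> f a j \<in> carrier G"
    using insert.prems by auto
  have "finsum G (\<lambda>i. finsum G (\<lambda>j. f i j) B) (insert a A) =
      finsum G (\<lambda>j. f a j) B \<oplus> finsum G (\<lambda>j. finsum G (\<lambda>i. f i j) A) B"
    using insert.hyps insert.IH insert.prems c by (subst finsum_insert) (auto intro!: finsum_closed)
  also have "\<dots> = finsum G (\<lambda>j. f a j \<oplus> finsum G (\<lambda>i. f i j) A) B"
    using c by (subst finsum_addf) (auto intro!: finsum_closed)
  also have "\<dots> = finsum G (\<lambda>j. finsum G (\<lambda>i. f i j) (insert a A)) B"
    by (rule finsum_cong') (use insert.hyps c in \<open>auto intro!: finsum_closed\<close>)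
  finally show ?case .
qed simp

lemma matrix_ring_simps:
  "carrier (matrix_ring n R) = ({..<n} \<times> {..<n}) \<rightarrow>\<^sub>E carrier R"
  "i < n \<Longrightarrow> j < n \<Longrightarrow> (P \<oplus>\<^bsub>matrix_ring n R\<^esub> Q) (i, j) = P (i, j) \<oplus>\<^bsub>R\<^esub> Q (i, j)"
  "i < n \<Longrightarrow> j < n \<Longrightarrow> (P \<otimes>\<^bsub>matrix_ring n R\<^esub> Q) (i, j) = finsum R (\<lambda>k. P (i, k) \<otimes>\<^bsub>R\<^esub> Q (k, j)) {..<n}"
  "i < n \<Longrightarrow> j < n \<Longrightarrow> \<zero>\<^bsub>matrix_ring n R\<^esub> (i, j) = \<zero>\<^bsub>R\<^esub>"
  "i < n \<Longrightarrow> j < n \<Longrightarrow> \<one>\<^bsub>matrix_ring n R\<^esub> (i, j) = (if i = j then \<one>\<^bsub>R\<^esub> else \<zero>\<^bsub>R\<^esub>)"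
  by (auto simp: matrix_ring_def)

lemma matrix_eqI:
  assumes "P \<in> carrier (matrix_ring n R)" "Q \<in> carrier (matrix_ring n R)"
    and "\<And>i j. i < n \<Longrightarrow> j < n \<Longrightarrow> P (i, j) = Q (i, j)"
  shows "P = Q"
  using assms by (intro PiE_ext[of P "{..<n} \<times> {..<n}" "\<lambda>_. carrier R" Q]) (auto simp: matrix_ring_simps(1))

lemma matrix_entry:
  assumes "P \<in> carrier (matrix_ring n R)" "i < n" "j < n"
  shows "P (i, j) \<in> carrier R"
  using assms by (auto simp: matrix_ring_simps(1))

context ring
begin

lemma matrix_closed:
  shows "P \<in> carrier (matrix_ring n R) \<Longrightarrow> Q \<in> carrier (matrix_ring n R) \<Longrightarrow>
      P \<oplus>\<^bsub>matrix_ring n R\<^esub> Q \<in> carrier (matrix_ring n R)"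
    and "P \<in> carrier (matrix_ring n R) \<Longrightarrow> Q \<in> carrier (matrix_ring n R) \<Longrightarrow>
      P \<otimes>\<^bsub>matrix_ring n R\<^esub> Q \<in> carrier (matrix_ring n R)"
    and "\<zero>\<^bsub>matrix_ring n R\<^esub> \<in> carrier (matrix_ring n R)"
    and "\<one>\<^bsub>matrix_ring n R\<^esub> \<in> carrier (matrix_ring n R)"
  by (auto simp: matrix_ring_def PiE_iff intro!: finsum_closed)

lemma ring_matrix_ring: "ring (matrix_ring n R)"
proof (intro ringI abelian_groupI monoidI)
  let ?M = "matrix_ring n R"
  note [simp] = matrix_closed matrix_entry matrix_ring_simps(2-5)
  show "\<exists>Q\<in>carrier ?M. Q \<oplus>\<^bsub>?M\<^esub> P = \<zero>\<^bsub>?M\<^esub>" if "P \<in> carrier ?M" for P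
  proof
    show Q: "(\<lambda>p\<in>{..<n} \<times> {..<n}. \<ominus> P p) \<in> carrier ?M"
      using that by (auto simp: matrix_ring_simps(1) PiE_iff)
    show "(\<lambda>p\<in>{..<n} \<times> {..<n}. \<ominus> P p) \<oplus>\<^bsub>?M\<^esub> P = \<zero>\<^bsub>?M\<^esub>"
      by (rule matrix_eqI[where R=R and n=n]) (use that Q in \<open>auto simp: l_neg\<close>)
  qed
  fix P Q T assume PQT: "P \<in> carrier ?M" "Q \<in> carrier ?M" "T \<in> carrier ?M"
  show "P \<oplus>\<^bsub>?M\<^esub> Q \<oplus>\<^bsub>?M\<^esub> T = P \<oplus>\<^bsub>?M\<^esub> (Q \<oplus>\<^bsub>?M\<^esub> T)"
    by (rule matrix_eqI[where R=R and n=n]) (use PQT in \<open>auto simp: a_assoc\<close>)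
  have distl: "finsum R (\<lambda>k. (P (i, k) \<oplus> Q (i, k)) \<otimes> T (k, j)) {..<n} =
      finsum R (\<lambda>k. P (i, k) \<otimes> T (k, j)) {..<n} \<oplus> finsum R (\<lambda>k. Q (i, k) \<otimes> T (k, j)) {..<n}"
    if "i < n" "j < n" for i j
    using PQT that by (intro trans[OF finsum_cong' finsum_addf]) (auto simp: l_distr)
  have distr: "finsum R (\<lambda>k. T (i, k) \<otimes> (P (k, j) \<oplus> Q (k, j))) {..<n} =
      finsum R (\<lambda>k. T (i, k) \<otimes> P (k, j)) {..<n} \<oplus> finsum R (\<lambda>k. T (i, k) \<otimes> Q (k, j)) {..<n}"
    if "i < n" "j < n" for i j
    using PQT that by (intro trans[OF finsum_cong' finsum_addf]) (auto simp: r_distr)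
  show "(P \<oplus>\<^bsub>?M\<^esub> Q) \<otimes>\<^bsub>?M\<^esub> T = P \<otimes>\<^bsub>?M\<^esub> T \<oplus>\<^bsub>?M\<^esub> Q \<otimes>\<^bsub>?M\<^esub> T"
  proof (rule matrix_eqI[where R=R and n=n])
    fix i j assume ij: "i < n" "j < n"
    have "((P \<oplus>\<^bsub>?M\<^esub> Q) \<otimes>\<^bsub>?M\<^esub> T) (i, j) = finsum R (\<lambda>k. (P (i, k) \<oplus> Q (i, k)) \<otimes> T (k, j)) {..<n}"
      using PQT ij by (auto intro!: finsum_cong')
    then show "((P \<oplus>\<^bsub>?M\<^esub> Q) \<otimes>\<^bsub>?M\<^esub> T) (i, j) = (P \<otimes>\<^bsub>?M\<^esub> T \<oplus>\<^bsub>?M\<^esub> Q \<otimes>\<^bsub>?M\<^esub> T) (i, j)"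
      using PQT ij distl by simp
  qed (use PQT in auto)
  show "T \<otimes>\<^bsub>?M\<^esub> (P \<oplus>\<^bsub>?M\<^esub> Q) = T \<otimes>\<^bsub>?M\<^esub> P \<oplus>\<^bsub>?M\<^esub> T \<otimes>\<^bsub>?M\<^esub> Q"
  proof (rule matrix_eqI[where R=R and n=n])
    fix i j assume ij: "i < n" "j < n"
    have "(T \<otimes>\<^bsub>?M\<^esub> (P \<oplus>\<^bsub>?M\<^esub> Q)) (i, j) = finsum R (\<lambda>k. T (i, k) \<otimes> (P (k, j) \<oplus> Q (k, j))) {..<n}"
      using PQT ij by (auto intro!: finsum_cong')
    then show "(T \<otimes>\<^bsub>?M\<^esub> (P \<oplus>\<^bsub>?M\<^esub> Q)) (i, j) = (T \<otimes>\<^bsub>?M\<^esub> P \<oplus>\<^bsub>?M\<^esub> T \<otimes>\<^bsub>?M\<^esub> Q) (i, j)"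
      using PQT ij distr by simp
  qed (use PQT in auto)
  show "(P \<otimes>\<^bsub>?M\<^esub> Q) \<otimes>\<^bsub>?M\<^esub> T = P \<otimes>\<^bsub>?M\<^esub> (Q \<otimes>\<^bsub>?M\<^esub> T)"
  proof (rule matrix_eqI[where R=R and n=n])
    fix i j assume ij: "i < n" "j < n"
    have "((P \<otimes>\<^bsub>?M\<^esub> Q) \<otimes>\<^bsub>?M\<^esub> T) (i, j) =
        finsum R (\<lambda>k. finsum R (\<lambda>l. P (i, l) \<otimes> Q (l, k)) {..<n} \<otimes> T (k, j)) {..<n}"
      using PQT ij by (auto intro!: finsum_cong' finsum_closed)
    also have "\<dots> = finsum R (\<lambda>k. finsum R (\<lambda>l. P (i, l) \<otimes> Q (l, k) \<otimes> T (k, j)) {..<n}) {..<n}"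
      using PQT ij by (intro finsum_cong') (auto intro!: finsum_ldistr finsum_closed)
    also have "\<dots> = finsum R (\<lambda>l. finsum R (\<lambda>k. P (i, l) \<otimes> Q (l, k) \<otimes> T (k, j)) {..<n}) {..<n}"
      using PQT ij by (intro finsum_swap) auto
    also have "\<dots> = finsum R (\<lambda>l. P (i, l) \<otimes> finsum R (\<lambda>k. Q (l, k) \<otimes> T (k, j)) {..<n}) {..<n}"
      using PQT ij by (intro finsum_cong') (auto simp: finsum_rdistr m_assoc intro!: finsum_closed finsum_cong')
    also have "\<dots> = (P \<otimes>\<^bsub>?M\<^esub> (Q \<otimes>\<^bsub>?M\<^esub> T)) (i, j)"
      using PQT ij by (auto intro!: finsum_cong' finsum_closed)
    finally show "((P \<otimes>\<^bsub>?M\<^esub> Q) \<otimes>\<^bsub>?M\<^esub> T) (i, j) = (P \<otimes>\<^bsub>?M\<^esub> (Q \<otimes>\<^bsub>?M\<^esub> T)) (i, j)" .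
  qed (use PQT in auto)
next
  let ?M = "matrix_ring n R"
  note [simp] = matrix_closed matrix_entry matrix_ring_simps(2-5)
  fix P Q assume PQ: "P \<in> carrier ?M" "Q \<in> carrier ?M"
  show "P \<oplus>\<^bsub>?M\<^esub> Q = Q \<oplus>\<^bsub>?M\<^esub> P"
    by (rule matrix_eqI[where R=R and n=n]) (use PQ in \<open>auto simp: a_comm\<close>)
next
  let ?M = "matrix_ring n R"
  note [simp] = matrix_closed matrix_entry matrix_ring_simps(2-5)
  fix P assume P: "P \<in> carrier ?M"
  show "\<zero>\<^bsub>?M\<^esub> \<oplus>\<^bsub>?M\<^esub> P = P"
    by (rule matrix_eqI[where R=R and n=n]) (use P in auto)
  show "\<one>\<^bsub>?M\<^esub> \<otimes>\<^bsub>?M\<^esub> P = P"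
  proof (rule matrix_eqI[where R=R and n=n])
    fix i j assume ij: "i < n" "j < n"
    have "(\<one>\<^bsub>?M\<^esub> \<otimes>\<^bsub>?M\<^esub> P) (i, j) = finsum R (\<lambda>k. if i = k then P (k, j) else \<zero>) {..<n}"
      using P ij by (auto intro!: finsum_cong')
    also have "\<dots> = P (i, j)"
      using P ij by (intro finsum_singleton) auto
    finally show "(\<one>\<^bsub>?M\<^esub> \<otimes>\<^bsub>?M\<^esub> P) (i, j) = P (i, j)" .
  qed (use P in auto)
  show "P \<otimes>\<^bsub>?M\<^esub> \<one>\<^bsub>?M\<^esub> = P"
  proof (rule matrix_eqI[where R=R and n=n])
    fix i j assume ij: "i < n" "j < n"
    have "(P \<otimes>\<^bsub>?M\<^esub> \<one>\<^bsub>?M\<^esub>) (i, j) = finsum R (\<lambda>k. if j = k then P (i, k) else \<zero>) {..<n}"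
      using P ij by (auto intro!: finsum_cong')
    also have "\<dots> = P (i, j)"
      using P ij by (intro finsum_singleton) auto
    finally show "(P \<otimes>\<^bsub>?M\<^esub> \<one>\<^bsub>?M\<^esub>) (i, j) = P (i, j)" .
  qed (use P in auto)
qed (simp_all add: matrix_closed)

lemma elem_matrix_closed:
  assumes "b \<in> carrier R"
  shows "elem_matrix n R i j b \<in> carrier (matrix_ring n R)"
  using assms by (auto simp: elem_matrix_def matrix_ring_simps(1))

lemma elem_matrix_apply:
  "i' < n \<Longrightarrow> j' < n \<Longrightarrow> elem_matrix n R i j b (i', j') = (if i = i' \<and> j = j' then b else \<zero>)"
  by (auto simp: elem_matrix_def)

lemma elem_matrix_mult:
  assumes "i < n" "j < n" "k < n" "l < n" "b \<in> carrier R" "c \<in> carrier R"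
  shows "elem_matrix n R i j b \<otimes>\<^bsub>matrix_ring n R\<^esub> elem_matrix n R k l c =
    (if j = k then elem_matrix n R i l (b \<otimes> c) else \<zero>\<^bsub>matrix_ring n R\<^esub>)"
proof (rule matrix_eqI[where R=R and n=n])
  fix i' j' assume ij: "i' < n" "j' < n"
  have "(elem_matrix n R i j b \<otimes>\<^bsub>matrix_ring n R\<^esub> elem_matrix n R k l c) (i', j') =
      finsum R (\<lambda>m. if j = m then (if i = i' \<and> k = j \<and> l = j' then b \<otimes> c else \<zero>) else \<zero>) {..<n}"
    unfolding matrix_ring_simps(3)[OF ij]
    by (rule finsum_cong') (use ij assms in \<open>auto simp: elem_matrix_apply\<close>)
  also have "\<dots> = (if i = i' \<and> k = j \<and> l = j' then b \<otimes> c else \<zero>)"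
    using assms by (intro finsum_singleton) auto
  finally show "(elem_matrix n R i j b \<otimes>\<^bsub>matrix_ring n R\<^esub> elem_matrix n R k l c) (i', j') =
      (if j = k then elem_matrix n R i l (b \<otimes> c) else \<zero>\<^bsub>matrix_ring n R\<^esub>) (i', j')"
    using ij by (auto simp: elem_matrix_apply matrix_ring_simps)
qed (use assms in \<open>auto simp: elem_matrix_closed matrix_closed\<close>)

text \<open>Zero would have coordinate 1 at itself as a basis element and 0 by additivity. This
  matters because the elementary matrices with entry zero all coincide, whereas a nonzero entry
  reveals its position.\<close>

lemma zbasis_zero_notin:
  assumes "zbasis R B"
  shows "\<zero> \<notin> B"
  using kappa_basis[OF assms, of \<zero> \<zero>] kappa_zero[OF assms, of \<zero>] by auto

lemma elem_matrix_inj: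
  assumes "elem_matrix n R i j b = elem_matrix n R k l c" "i < n" "j < n" "b \<noteq> \<zero>"
  shows "i = k \<and> j = l \<and> b = c"
  using fun_cong[OF assms(1), of "(i, j)"] assms(2-4) by (auto simp: elem_matrix_apply split: if_splits)

text \<open>Taking the coordinate \<open>b\<close> of the entry at \<open>(i, j)\<close> is an
  additive functional that is 1 on the basis matrix with these labels and 0 on the others.
  Uniqueness of coordinates in the matrix ring follows, and existence can be checked entry by
  entry.\<close>

lemma zcoords_matrix_entry:
  assumes B: "zbasis R B"
    and c: "zcoords (matrix_ring n R) (snd (matrix_based_ring n R B)) P c"
    and ij: "i < n" "j < n" and b: "b \<in> B"
  shows "kappa R B b (P (i, j)) = c (elem_matrix n R i j b)"
proof -
  interpret M: ring "matrix_ring n R" by (rule ring_matrix_ring)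
  have BR: "B \<subseteq> carrier R" using B unfolding zbasis_def by blast
  let ?S = "{X. c X \<noteq> 0}"
  have S: "finite ?S" "?S \<subseteq> {elem_matrix n R i j b | i j b. i < n \<and> j < n \<and> b \<in> B}"
    using c unfolding zcoords_def matrix_based_ring_def by auto
  then have SM: "?S \<subseteq> carrier (matrix_ring n R)" using BR elem_matrix_closed by blast
  have "kappa R B b (P (i, j)) = (\<Sum>X\<in>?S. of_int (c X) * kappa R B b (X (i, j)))"
    using M.additive_zcomb[where h="\<lambda>P. kappa R B b (P (i, j))", OF _ S(1) SM, of c] c ij
    unfolding zcoords_def zcomb_def by (simp add: matrix_ring_simps kappa_add[OF B] matrix_entry)
  also have "\<dots> = (\<Sum>X\<in>?S. if X = elem_matrix n R i j b then c X else 0)"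
  proof (rule sum.cong[OF refl])
    fix X assume X: "X \<in> ?S"
    then obtain k l d where kld: "X = elem_matrix n R k l d" "k < n" "l < n" "d \<in> B" using S(2) by blast
    have "d \<noteq> \<zero>" "b \<noteq> \<zero>" using kld b zbasis_zero_notin[OF B] by auto
    then have e: "X = elem_matrix n R i j b \<longleftrightarrow> k = i \<and> l = j \<and> d = b"
      using elem_matrix_inj[of n k l d i j b] kld by auto
    show "of_int (c X) * kappa R B b (X (i, j)) = (if X = elem_matrix n R i j b then c X else 0)"
      unfolding e using ij kld by (auto simp: elem_matrix_apply kappa_basis[OF B] kappa_zero[OF B])
  qed
  also have "\<dots> = c (elem_matrix n R i j b)"
    using S(1) by (auto simp: sum.delta)
  finally show ?thesis .
qed

lemma zbasis_matrix_ring: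
  assumes B: "zbasis R B"
  shows "zbasis (matrix_ring n R) (snd (matrix_based_ring n R B))"
proof -
  interpret M: ring "matrix_ring n R" by (rule ring_matrix_ring)
  have BR: "B \<subseteq> carrier R" using B unfolding zbasis_def by blast
  let ?B = "snd (matrix_based_ring n R B)"
  have BM: "?B \<subseteq> carrier (matrix_ring n R)"
    using BR elem_matrix_closed unfolding matrix_based_ring_def by auto
  have ex: "\<exists>c. zcoords (matrix_ring n R) ?B P c" if P: "P \<in> carrier (matrix_ring n R)" for P
  proof -
    define S where "S = (\<Union>i<n. \<Union>j<n. elem_matrix n R i j ` {b. kappa R B b (P (i, j)) \<noteq> 0})"
    \<comment> \<open>Coefficients are functions of the matrix, not of its labels
      \<open>(i, j, b)\<close>; the labels are recovered by a choice, which is unique because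
      \<open>b\<close> is nonzero.\<close>
    define c where "c X = (if X \<in> S then
      (let (i, j, b) = (SOME (i, j, b). X = elem_matrix n R i j b \<and> i < n \<and> j < n \<and> b \<in> B)
       in kappa R B b (P (i, j))) else 0)" for X
    have SB: "S \<subseteq> ?B"
      using kappa_nonzero_in[OF B matrix_entry[OF P]] unfolding S_def matrix_based_ring_def by fastforce
    have fin: "finite S"
      using finite_kappa[OF B matrix_entry[OF P]] unfolding S_def by auto
    have c_elem: "c (elem_matrix n R i j b) = kappa R B b (P (i, j))" if ij: "i < n" "j < n" "b \<in> B" for i j b
    proof (cases "elem_matrix n R i j b \<in> S")
      case True
      have "(SOME (i', j', b'). elem_matrix n R i j b = elem_matrix n R i' j' b' \<and> i' < n \<and> j' < n \<and> b' \<in> B) = (i, j, b)"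
      proof (rule some_equality)
        fix p assume "case p of (i', j', b') \<Rightarrow> elem_matrix n R i j b = elem_matrix n R i' j' b' \<and> i' < n \<and> j' < n \<and> b' \<in> B"
        then show "p = (i, j, b)"
          using elem_matrix_inj[of n i j b] ij zbasis_zero_notin[OF B] by (cases p) fastforce
      qed (use ij in auto)
      then show ?thesis using True unfolding c_def by simp
    next
      case False
      then have "kappa R B b (P (i, j)) = 0" using ij unfolding S_def by blast
      then show ?thesis using False unfolding c_def by simp
    qed
    have supp: "{X. c X \<noteq> 0} \<subseteq> S" unfolding c_def by auto
    define Q where "Q = zcomb (matrix_ring n R) c"
    have Q: "zcoords (matrix_ring n R) ?B Q c"
      using supp SB finite_subset[OF supp fin] unfolding zcoords_def Q_def by auto
    have QC: "Q \<in> carrier (matrix_ring n R)"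
      unfolding Q_def using supp SB BM by (intro M.zcomb_closed) auto
    \<comment> \<open>Instead of evaluating the combination \<open>Q\<close>, its entries are
      compared with those of \<open>P\<close> coordinate by coordinate.\<close>
    have "Q = P"
    proof (rule matrix_eqI[OF QC P])
      fix i j assume ij: "i < n" "j < n"
      show "Q (i, j) = P (i, j)"
        by (rule kappa_eqI[OF B matrix_entry[OF QC ij] matrix_entry[OF P ij]])
          (simp add: zcoords_matrix_entry[OF B Q ij] c_elem ij)
    qed
    then show ?thesis using Q by blast
  qed
  have uniq: "c = d" if c: "zcoords (matrix_ring n R) ?B P c" and d: "zcoords (matrix_ring n R) ?B P d" for P c d
  proof
    fix X
    show "c X = d X"
    proof (cases "X \<in> ?B")
      case True
      then obtain i j b where "X = elem_matrix n R i j b" "i < n" "j < n" "b \<in> B"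
        unfolding matrix_based_ring_def by auto
      then show ?thesis using zcoords_matrix_entry[OF B c] zcoords_matrix_entry[OF B d] by metis
    next
      case False
      then have "c X = 0" "d X = 0" using c d unfolding zcoords_def by auto
      then show ?thesis by simp
    qed
  qed
  show ?thesis unfolding zbasis_def using BM ex uniq by blast
qed

lemma kappa_matrix:
  assumes "zbasis R B" "P \<in> carrier (matrix_ring n R)" "i < n" "j < n" "b \<in> B"
  shows "kappa (matrix_ring n R) (snd (matrix_based_ring n R B)) (elem_matrix n R i j b) P =
    kappa R B b (P (i, j))"
  using zcoords_matrix_entry[OF assms(1) zcoords_kappa[OF zbasis_matrix_ring[OF assms(1)] assms(2)] assms(3-5)]
  by simp

text \<open>The concrete origin of the case distinction in \<open>cell_kappa\<close>.\<close>

lemma kappa_elem_matrix_mult: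
  assumes "zbasis R B" "i < n" "j < n" "k < n" "l < n" "i' < n" "j' < n" "b \<in> B" "c \<in> B" "d \<in> B"
  shows "kappa (matrix_ring n R) (snd (matrix_based_ring n R B)) (elem_matrix n R i' j' d)
      (elem_matrix n R i j b \<otimes>\<^bsub>matrix_ring n R\<^esub> elem_matrix n R k l c) =
    (if i' = i \<and> j = k \<and> j' = l then kappa R B d (b \<otimes> c) else 0)"
proof -
  have "b \<in> carrier R" "c \<in> carrier R" using assms unfolding zbasis_def by auto
  then show ?thesis
    using assms by (subst kappa_matrix)
      (auto simp: elem_matrix_mult elem_matrix_closed matrix_closed elem_matrix_apply matrix_ring_simps(2-5) kappa_zero)
qed

end

section \<open>The structure constants on the cell indices\<close>

lemma table_algebraD:
  assumes "table_algebra R B"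
  shows "ring R" "zbasis R B" "\<one>\<^bsub>R\<^esub> \<in> B" "B \<subseteq> carrier R" "table_involution R B (table_bar R B)"
proof -
  show "table_involution R B (table_bar R B)"
    using assms someI_ex[of "table_involution R B"] unfolding table_algebra_def table_bar_def by blast
qed (use assms in \<open>auto simp: table_algebra_def based_ring_def zbasis_def\<close>)

lemma table_bar:
  assumes "table_algebra R B" "b \<in> B"
  shows "table_bar R B b \<in> B" "table_bar R B (table_bar R B b) = b"
  using table_algebraD[OF assms(1)] assms(2) unfolding table_involution_def by blast+

text \<open>With u the involute of 1, the involution sends u 1 to u times the involute of u, which
  is u 1; on the other hand it sends u back to 1.\<close>

lemma table_bar_one:
  assumes "table_algebra R B"
  shows "table_bar R B \<one>\<^bsub>R\<^esub> = \<one>\<^bsub>R\<^esub>"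
proof -
  interpret R: ring R using table_algebraD[OF assms] by blast
  let ?u = "table_bar R B \<one>\<^bsub>R\<^esub>"
  have u: "?u \<in> carrier R" "table_bar R B ?u = \<one>\<^bsub>R\<^esub>"
    using table_bar[OF assms table_algebraD(3)[OF assms]] table_algebraD(4)[OF assms] by auto
  have "table_bar R B (?u \<otimes>\<^bsub>R\<^esub> \<one>\<^bsub>R\<^esub>) = ?u \<otimes>\<^bsub>R\<^esub> table_bar R B ?u"
    using table_algebraD(5)[OF assms] u(1) unfolding table_involution_def by blast
  then show ?thesis using u by simp
qed

text \<open>The third identity is (T3) at \<open>bm = 1\<close>. It allows the coefficient of 1 in a
  product to single out one basis element, which serves both to recover the involution and to
  compare degrees within a cell.\<close>

lemma kappa_table_algebra:
  assumes T: "table_algebra R B" and "b \<in> B"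
  shows "kappa R B c (\<one>\<^bsub>R\<^esub> \<otimes>\<^bsub>R\<^esub> b) = (if c = b then 1 else 0)"
    "kappa R B c (b \<otimes>\<^bsub>R\<^esub> \<one>\<^bsub>R\<^esub>) = (if c = b then 1 else 0)"
    "d \<in> B \<Longrightarrow> kappa R B \<one>\<^bsub>R\<^esub> (d \<otimes>\<^bsub>R\<^esub> b) = (if d = table_bar R B b then 1 else 0)"
proof -
  note t = table_algebraD[OF T]
  interpret R: ring R using t by blast
  show "kappa R B c (\<one>\<^bsub>R\<^esub> \<otimes>\<^bsub>R\<^esub> b) = (if c = b then 1 else 0)" 
    "kappa R B c (b \<otimes>\<^bsub>R\<^esub> \<one>\<^bsub>R\<^esub>) = (if c = b then 1 else 0)" 
    using assms(2) t R.kappa_basis[OF t(2)] by (auto simp: subset_iff)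
  assume d: "d \<in> B"
  have "kappa R B \<one>\<^bsub>R\<^esub> (d \<otimes>\<^bsub>R\<^esub> b) = kappa R B d (\<one>\<^bsub>R\<^esub> \<otimes>\<^bsub>R\<^esub> table_bar R B b)"
    using t(5,3) d assms(2) unfolding table_involution_def by blast
  then show "kappa R B \<one>\<^bsub>R\<^esub> (d \<otimes>\<^bsub>R\<^esub> b) = (if d = table_bar R B b then 1 else 0)"
    using table_bar(1)[OF assms] t R.kappa_basis[OF t(2)] by (auto simp: subset_iff)
qed

text \<open>The part of (A1) that involves neither the order nor \<open>C\<close>; it is all that
  the combinatorics of \<open>cell_kappa\<close> requires.\<close>

definition table_family :: "('l, 'g, 'm, 'a) table_tuple \<Rightarrow> bool" where
  "table_family D \<longleftrightarrow> (\<forall>l\<in>Lam D. table_algebra (Gam D l) (Bas D l) \<and> finite (Idx D l) \<and> Idx D l \<noteq> {})"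

text \<open>The coefficient of \<open>e\<^sub>X\<^sub>Y \<otimes> b''\<close> in \<open>(e\<^sub>S\<^sub>T \<otimes> b)(e\<^sub>U\<^sub>V \<otimes> b')\<close>.\<close>

definition cell_kappa :: "('l, 'g, 'm, 'a) table_tuple \<Rightarrow> ('l, 'g, 'm) cell_index \<Rightarrow>
    ('l, 'g, 'm) cell_index \<Rightarrow> ('l, 'g, 'm) cell_index \<Rightarrow> int" where
  "cell_kappa D = (\<lambda>(l, S, b, T) (l', U, b', V) (l'', X, b'', Y).
     if l = l' \<and> l' = l'' \<and> X = S \<and> T = U \<and> Y = V then kappa (Gam D l) (Bas D l) b'' (b \<otimes>\<^bsub>Gam D l\<^esub> b') else 0)"

definition cell_star :: "('l, 'g, 'm, 'a) table_tuple \<Rightarrow> ('l, 'g, 'm) cell_index \<Rightarrow> ('l, 'g, 'm) cell_index" where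
  "cell_star D = (\<lambda>(l, S, b, T). (l, T, table_bar (Gam D l) (Bas D l) b, S))"

lemma in_cells [simp]:
  "(l, S, b, T) \<in> cells D \<longleftrightarrow> l \<in> Lam D \<and> S \<in> Idx D l \<and> b \<in> Bas D l \<and> T \<in> Idx D l"
  by (simp add: cells_def)

lemma fst_cells: "p \<in> cells D \<Longrightarrow> fst p \<in> Lam D"
  by (cases p) auto

lemma cell_kappa_simp:
  "cell_kappa D (l, S, b, T) (l', U, b', V) (l'', X, b'', Y) =
    (if l = l' \<and> l' = l'' \<and> X = S \<and> T = U \<and> Y = V then kappa (Gam D l) (Bas D l) b'' (b \<otimes>\<^bsub>Gam D l\<^esub> b') else 0)"
  by (simp add: cell_kappa_def)

lemma cell_star_simp: "cell_star D (l, S, b, T) = (l, T, table_bar (Gam D l) (Bas D l) b, S)"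
  by (simp add: cell_star_def)

lemma table_familyD:
  assumes "table_family D" "l \<in> Lam D"
  shows "table_algebra (Gam D l) (Bas D l)" "finite (Idx D l)" "Idx D l \<noteq> {}"
    "ring (Gam D l)" "zbasis (Gam D l) (Bas D l)" "\<one>\<^bsub>Gam D l\<^esub> \<in> Bas D l" "Bas D l \<subseteq> carrier (Gam D l)"
  using assms table_algebraD[of "Gam D l" "Bas D l"] unfolding table_family_def by auto

lemma cell_star_in:
  assumes "table_family D" "p \<in> cells D"
  shows "cell_star D p \<in> cells D" "cell_star D (cell_star D p) = p"
  using assms(2) table_bar[OF table_familyD(1)[OF assms(1)]] by (cases p; auto simp: cell_star_simp)+

text \<open>These are the diagonal idempotents e_SS times 1, described by products only: left
  multiplication sends every basis element to a multiple of itself. In this form they are visibly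
  preserved by maps that respect structure constants.\<close>

definition cell_unit :: "('l, 'g, 'm, 'a) table_tuple \<Rightarrow> ('l, 'g, 'm) cell_index \<Rightarrow> bool" where
  "cell_unit D u \<longleftrightarrow> u \<in> cells D \<and> (\<forall>q\<in>cells D. \<forall>r\<in>cells D. cell_kappa D u q r \<noteq> 0 \<longrightarrow> q = r)"

text \<open>Testing on e_TT times 1, which fixes the given element from the right, forces that
  element to equal e_TT times 1.\<close>

lemma cell_unit_iff:
  assumes D: "table_family D" and p: "(l, S, b, T) \<in> cells D"
  shows "cell_unit D (l, S, b, T) \<longleftrightarrow> S = T \<and> b = \<one>\<^bsub>Gam D l\<^esub>"
proof
  have l: "l \<in> Lam D" using p by simp
  note t = table_familyD[OF D l]
  assume u: "cell_unit D (l, S, b, T)"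
  have "(l, T, \<one>\<^bsub>Gam D l\<^esub>, T) \<in> cells D" using p t by simp
  moreover have "cell_kappa D (l, S, b, T) (l, T, \<one>\<^bsub>Gam D l\<^esub>, T) (l, S, b, T) \<noteq> 0"
    using p kappa_table_algebra(2)[OF t(1)] by (simp add: cell_kappa_simp)
  ultimately show "S = T \<and> b = \<one>\<^bsub>Gam D l\<^esub>" using u p unfolding cell_unit_def by fastforce
next
  have l: "l \<in> Lam D" using p by simp
  note t = table_familyD[OF D l]
  assume "S = T \<and> b = \<one>\<^bsub>Gam D l\<^esub>"
  then show "cell_unit D (l, S, b, T)"
    using p kappa_table_algebra(1)[OF t(1)] unfolding cell_unit_def cells_def
    by (auto simp: cell_kappa_simp split: if_splits)
qed

text \<open>The product of \<open>p\<close> and \<open>q\<close> contains a diagonal idempotent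
  exactly if the row and column indices are interchanged and 1 occurs in b c; by (T3) the latter
  means that c is the involute of b. So the involution is a function of the structure
  constants.\<close>

lemma cell_star_iff:
  assumes D: "table_family D" and p: "p \<in> cells D" and q: "q \<in> cells D"
  shows "q = cell_star D p \<longleftrightarrow> (\<exists>u. cell_unit D u \<and> cell_kappa D p q u \<noteq> 0)"
proof -
  obtain l S b T where p': "p = (l, S, b, T)" by (cases p)
  obtain k U c V where q': "q = (k, U, c, V)" by (cases q)
  have l: "l \<in> Lam D" using p p' by simp
  note t = table_familyD[OF D l]
  have bc: "b = table_bar (Gam D l) (Bas D l) c \<longleftrightarrow> c = table_bar (Gam D l) (Bas D l) b" if "c \<in> Bas D l"
    using table_bar[OF t(1)] p p' that by auto
  have kap: "kappa (Gam D l) (Bas D l) \<one>\<^bsub>Gam D l\<^esub> (b \<otimes>\<^bsub>Gam D l\<^esub> c) \<noteq> 0 \<longleftrightarrow> c = table_bar (Gam D l) (Bas D l) b"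
    if "c \<in> Bas D l"
    using kappa_table_algebra(3)[OF t(1) that] p p' bc[OF that] by simp
  show ?thesis
  proof
    assume "q = cell_star D p"
    then have q2: "k = l" "U = T" "c = table_bar (Gam D l) (Bas D l) b" "V = S"
      using p' q' by (auto simp: cell_star_simp)
    have "cell_unit D (l, S, \<one>\<^bsub>Gam D l\<^esub>, S)" 
      using cell_unit_iff[OF D] p p' t by auto
    moreover have "cell_kappa D p q (l, S, \<one>\<^bsub>Gam D l\<^esub>, S) \<noteq> 0"
      using kap q p' q' q2 by (simp add: cell_kappa_simp)
    ultimately show "\<exists>u. cell_unit D u \<and> cell_kappa D p q u \<noteq> 0" by blast
  next
    assume "\<exists>u. cell_unit D u \<and> cell_kappa D p q u \<noteq> 0"
    then obtain u where u: "cell_unit D u" "cell_kappa D p q u \<noteq> 0" by blast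
    obtain m X d Y where u': "u = (m, X, d, Y)" by (cases u)
    have "X = Y" "d = \<one>\<^bsub>Gam D m\<^esub>"
      using u(1) cell_unit_iff[OF D] unfolding u' cell_unit_def by auto
    then show "q = cell_star D p"
      using u(2) kap q unfolding u' p' q' by (auto simp: cell_kappa_simp cell_star_simp split: if_splits)
  qed
qed

text \<open>The product of two elements of one cell vanishes if the inner indices differ, so a
  connecting element is needed: e_TU times 1 has nonzero products with \<open>p\<close> on its left
  and with \<open>q\<close> on its right.\<close>

lemma same_block_iff:
  assumes D: "table_family D" and p: "p \<in> cells D" and q: "q \<in> cells D"
  shows "fst p = fst q \<longleftrightarrow> (\<exists>s\<in>cells D. \<exists>r\<in>cells D. \<exists>t\<in>cells D. cell_kappa D p s r \<noteq> 0 \<and> cell_kappa D s q t \<noteq> 0)"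
proof -
  obtain l S b T where p': "p = (l, S, b, T)" by (cases p)
  obtain k U c V where q': "q = (k, U, c, V)" by (cases q)
  have l: "l \<in> Lam D" using p p' by simp
  note t = table_familyD[OF D l]
  show ?thesis
  proof
    assume "fst p = fst q"
    then have kl: "k = l" using p' q' by simp
    have "(l, T, \<one>\<^bsub>Gam D l\<^esub>, U) \<in> cells D" "(l, S, b, U) \<in> cells D" "(l, T, c, V) \<in> cells D"
      using p q t unfolding p' q' kl by auto
    moreover have "cell_kappa D p (l, T, \<one>\<^bsub>Gam D l\<^esub>, U) (l, S, b, U) \<noteq> 0"
      "cell_kappa D (l, T, \<one>\<^bsub>Gam D l\<^esub>, U) q (l, T, c, V) \<noteq> 0"
      using p q kappa_table_algebra(1,2)[OF t(1)] unfolding p' q' kl by (auto simp: cell_kappa_simp)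
    ultimately show "\<exists>s\<in>cells D. \<exists>r\<in>cells D. \<exists>t\<in>cells D. cell_kappa D p s r \<noteq> 0 \<and> cell_kappa D s q t \<noteq> 0"
      by blast
  next
    assume "\<exists>s\<in>cells D. \<exists>r\<in>cells D. \<exists>t\<in>cells D. cell_kappa D p s r \<noteq> 0 \<and> cell_kappa D s q t \<noteq> 0"
    then show "fst p = fst q"
      unfolding p' q' cell_kappa_def by (auto split: if_splits)
  qed
qed

text \<open>Nothing is required about cells, units or the involution, since the structure constants
  determine them; the induced map on the poset is likewise derived, not given.\<close>

definition cell_iso :: "('l, 'g, 'm, 'a) table_tuple \<Rightarrow> ('l, 'g, 'm, 'a) table_tuple \<Rightarrow>
    (('l, 'g, 'm) cell_index \<Rightarrow> ('l, 'g, 'm) cell_index) \<Rightarrow> bool" where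
  "cell_iso D D' \<sigma> \<longleftrightarrow> \<sigma> \<in> extensional (cells D) \<and> bij_betw \<sigma> (cells D) (cells D') \<and>
     (\<forall>p\<in>cells D. \<forall>q\<in>cells D. \<forall>r\<in>cells D. cell_kappa D' (\<sigma> p) (\<sigma> q) (\<sigma> r) = cell_kappa D p q r) \<and>
     (\<forall>p\<in>cells D. \<forall>q\<in>cells D. (fst p, fst q) \<in> leq D \<longleftrightarrow> (fst (\<sigma> p), fst (\<sigma> q)) \<in> leq D')"

section \<open>Cells, units and involution under bijections that preserve structure
  constants\<close>

context
  fixes D D' :: "('l, 'g, 'm, 'a) table_tuple" and \<sigma>
  assumes D: "table_family D" and D': "table_family D'"
    and bij: "bij_betw \<sigma> (cells D) (cells D')"
    and kap: "\<And>p q r. p \<in> cells D \<Longrightarrow> q \<in> cells D \<Longrightarrow> r \<in> cells D \<Longrightarrow>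
      cell_kappa D' (\<sigma> p) (\<sigma> q) (\<sigma> r) = cell_kappa D p q r"
begin

lemma bij_cells_in: "p \<in> cells D \<Longrightarrow> \<sigma> p \<in> cells D'"
  using bij by (rule bij_betw_apply)

lemma bij_cells_eq: "p \<in> cells D \<Longrightarrow> q \<in> cells D \<Longrightarrow> \<sigma> p = \<sigma> q \<longleftrightarrow> p = q"
  using bij unfolding bij_betw_def inj_on_def by blast

lemma bij_cells_image: "cells D' = \<sigma> ` cells D"
  using bij unfolding bij_betw_def by blast

lemma cell_unit_transport: "p \<in> cells D \<Longrightarrow> cell_unit D' (\<sigma> p) \<longleftrightarrow> cell_unit D p"
  unfolding cell_unit_def bij_cells_image by (simp add: kap bij_cells_eq)

lemma cell_star_transport: "p \<in> cells D \<Longrightarrow> \<sigma> (cell_star D p) = cell_star D' (\<sigma> p)"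
proof -
  assume p: "p \<in> cells D"
  let ?q = "cell_star D p"
  have q: "?q \<in> cells D" using cell_star_in[OF D p] by blast
  obtain u where u: "cell_unit D u" "cell_kappa D p ?q u \<noteq> 0" using cell_star_iff[OF D p q] by blast
  then have "u \<in> cells D" unfolding cell_unit_def by blast
  then have "cell_unit D' (\<sigma> u)" "cell_kappa D' (\<sigma> p) (\<sigma> ?q) (\<sigma> u) \<noteq> 0"
    using u cell_unit_transport kap p q by auto
  then show ?thesis using cell_star_iff[OF D' bij_cells_in[OF p] bij_cells_in[OF q]] by blast
qed

lemma same_block_transport:
  "p \<in> cells D \<Longrightarrow> q \<in> cells D \<Longrightarrow> fst (\<sigma> p) = fst (\<sigma> q) \<longleftrightarrow> fst p = fst q"
  unfolding same_block_iff[OF D] same_block_iff[OF D' bij_cells_in bij_cells_in]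
  by (simp add: bij_cells_image kap)

end

section \<open>Coordinates with respect to the tabular basis\<close>

lemma ext_of_carrier:
  assumes "zbasis R B" "g \<in> carrier R"
  shows "ext_of R B g \<in> ext_carrier B"
  using finite_kappa[OF assms] kappa_nonzero_in[OF assms] unfolding ext_of_def ext_carrier_def
  by auto

lemma ext_mult_carrier:
  assumes "ring R" "zbasis R B" "r \<in> ext_carrier B" "g \<in> carrier R"
  shows "ext_mult R B r g \<in> ext_carrier B"
proof -
  interpret R: ring R by fact
  have r: "finite {c. r c \<noteq> 0}" "{c. r c \<noteq> 0} \<subseteq> carrier R"
    using assms unfolding ext_carrier_def zbasis_def by auto
  have e: "ext_of R B (c \<otimes>\<^bsub>R\<^esub> g) \<in> ext_carrier B" if "c \<in> {c. r c \<noteq> 0}" for c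
    by (rule ext_of_carrier[OF assms(2)]) (use that r assms(4) in auto)
  define U where "U c = {b. ext_of R B (c \<otimes>\<^bsub>R\<^esub> g) b \<noteq> 0}" for c
  have U: "finite (U c)" "U c \<subseteq> B" if "c \<in> {c. r c \<noteq> 0}" for c
    using e[OF that] unfolding ext_carrier_def U_def by blast+
  have 1: "finite (\<Union> (U ` {c. r c \<noteq> 0}))" by (rule finite_UN_I[OF r(1) U(1)])
  have 2: "\<Union> (U ` {c. r c \<noteq> 0}) \<subseteq> B" by (rule UN_least[OF U(2)])
  have 3: "{b. ext_mult R B r g b \<noteq> 0} \<subseteq> \<Union> (U ` {c. r c \<noteq> 0})"
  proof
    fix b assume "b \<in> {b. ext_mult R B r g b \<noteq> 0}"
    then have "(\<Sum>c | r c \<noteq> 0. r c * ext_of R B (c \<otimes>\<^bsub>R\<^esub> g) b) \<noteq> 0" by (simp add: ext_mult_def)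
    then obtain c where "c \<in> {c. r c \<noteq> 0}" "r c * ext_of R B (c \<otimes>\<^bsub>R\<^esub> g) b \<noteq> 0"
      by (rule sum.not_neutral_contains_not_neutral)
    then show "b \<in> \<Union> (U ` {c. r c \<noteq> 0})" unfolding U_def by auto
  qed
  show ?thesis
    unfolding ext_carrier_def using finite_subset[OF 3 1] order_trans[OF 3 2] by simp
qed

text \<open>The basis is fixed without a parametrization. Coordinates, leading coefficients and the
  a-function depend on it alone, which is what makes two table data comparable.\<close>

locale laurent_basis =
  fixes scale :: "laurent \<Rightarrow> 'a::ring \<Rightarrow> 'a" and BB :: "'a set"
  assumes laurent_alg: "laurent_algebra scale"
    and independent_BB: "\<not> module.dependent scale BB"
    and span_BB: "module.span scale BB = UNIV"
begin

sublocale module scale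
  using laurent_alg unfolding laurent_algebra_def by blast

abbreviation rep :: "'a \<Rightarrow> 'a \<Rightarrow> laurent" where
  "rep \<equiv> representation BB"

lemma mult_scale: "scale c x * y = scale c (x * y)" "x * scale c y = scale c (x * y)"
  using laurent_alg unfolding laurent_algebra_def by metis+

lemma rep_diff: "rep (x - y) Z = rep x Z - rep y Z"
  using representation_diff[OF independent_BB] span_BB by simp

lemma rep_scale: "rep (scale c x) Z = c * rep x Z"
  using representation_scale[OF independent_BB] span_BB by simp

lemma rep_sum: "rep (sum f I) Z = (\<Sum>i\<in>I. rep (f i) Z)"
  using representation_sum[OF independent_BB, of I f] span_BB by simp

lemma rep_basis: "X \<in> BB \<Longrightarrow> rep X Z = (if Z = X then 1 else 0)"
  using representation_basis[OF independent_BB] by simp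

lemma rep_expand: "(\<Sum>Z | rep x Z \<noteq> 0. scale (rep x Z) Z) = x"
  using sum_nonzero_representation_eq[OF independent_BB] span_BB by simp

lemma in_span_iff:
  assumes "S \<subseteq> BB"
  shows "x \<in> span S \<longleftrightarrow> (\<forall>Z. rep x Z \<noteq> 0 \<longrightarrow> Z \<in> S)"
proof
  assume "x \<in> span S"
  then have "rep x = representation S x"
    using representation_extend[OF independent_BB] assms by blast
  then show "\<forall>Z. rep x Z \<noteq> 0 \<longrightarrow> Z \<in> S" using representation_ne_zero by metis
next
  assume a: "\<forall>Z. rep x Z \<noteq> 0 \<longrightarrow> Z \<in> S"
  have "(\<Sum>Z | rep x Z \<noteq> 0. scale (rep x Z) Z) \<in> span S"
    by (intro span_sum span_scale span_base) (use a in auto)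
  then show "x \<in> span S" using rep_expand by simp
qed

definition indexing :: "('l, 'g, 'm, 'a) table_tuple \<Rightarrow> (('l, 'g, 'm) cell_index \<Rightarrow> 'a) \<Rightarrow> bool" where
  "indexing D C \<longleftrightarrow> table_family D \<and> bij_betw C (cells D) BB"

text \<open>The congruence of (A3) read off inside the cell \<open>l\<close>, with g restricted to
  basis elements. Independence of the column T is built in, as \<open>r\<close> takes only row
  indices.\<close>

definition left_coeffs :: "('l, 'g, 'm, 'a) table_tuple \<Rightarrow> (('l, 'g, 'm) cell_index \<Rightarrow> 'a) \<Rightarrow>
    'a \<Rightarrow> 'l \<Rightarrow> ('m \<Rightarrow> 'm \<Rightarrow> 'g \<Rightarrow> laurent) \<Rightarrow> bool" where
  "left_coeffs D C a l r \<longleftrightarrow>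
     (\<forall>X\<in>Idx D l. \<forall>S\<in>Idx D l. r X S \<in> ext_carrier (Bas D l)) \<and>
     (\<forall>S\<in>Idx D l. \<forall>T\<in>Idx D l. \<forall>X\<in>Idx D l. \<forall>Y\<in>Idx D l. \<forall>b\<in>Bas D l. \<forall>c\<in>Bas D l.
        rep (a * C (l, S, b, T)) (C (l, X, c, Y)) =
          (if Y = T then \<Sum>d | r X S d \<noteq> 0. r X S d * of_int (kappa (Gam D l) (Bas D l) c (d \<otimes>\<^bsub>Gam D l\<^esub> b)) else 0))"

text \<open>The part of (A3) that involves the order. The relation is a parameter so that smaller
  orders can be tested for the same \<open>D\<close> and \<open>C\<close>.\<close>

definition left_triangular :: "('l, 'g, 'm, 'a) table_tuple \<Rightarrow> (('l, 'g, 'm) cell_index \<Rightarrow> 'a) \<Rightarrow>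
    ('l \<times> 'l) set \<Rightarrow> bool" where
  "left_triangular D C r \<longleftrightarrow> (\<forall>a. \<forall>p\<in>cells D. \<forall>q\<in>cells D.
     rep (a * C q) (C p) \<noteq> 0 \<longrightarrow> fst p = fst q \<or> (fst p, fst q) \<in> r)"

context
  fixes D :: "('l, 'g, 'm, 'a) table_tuple" and C
  assumes DC: "indexing D C"
begin

lemma indexing_family: "table_family D"
  using DC unfolding indexing_def by blast

lemma indexing_in: "p \<in> cells D \<Longrightarrow> C p \<in> BB"
  using DC unfolding indexing_def by (meson bij_betw_apply)

lemma indexing_eq: "p \<in> cells D \<Longrightarrow> q \<in> cells D \<Longrightarrow> C p = C q \<longleftrightarrow> p = q"
  using DC unfolding indexing_def bij_betw_def inj_on_def by blast

lemma indexing_surj: "Z \<in> BB \<Longrightarrow> \<exists>p\<in>cells D. Z = C p"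
  using DC unfolding indexing_def bij_betw_def by blast

lemma rep_C_ext:
  assumes "l \<in> Lam D" "x \<in> ext_carrier (Bas D l)" "S \<in> Idx D l" "T \<in> Idx D l" "(l', X, c, Y) \<in> cells D"
  shows "rep (C_ext scale C l x S T) (C (l', X, c, Y)) = (if l' = l \<and> X = S \<and> Y = T then x c else 0)"
proof -
  have x: "finite {b. x b \<noteq> 0}" "\<And>b. x b \<noteq> 0 \<Longrightarrow> (l, S, b, T) \<in> cells D"
    using assms unfolding ext_carrier_def by auto
  have "rep (C_ext scale C l x S T) (C (l', X, c, Y)) =
      (\<Sum>b | x b \<noteq> 0. if b = c then (if l' = l \<and> X = S \<and> Y = T then x c else 0) else 0)"
    unfolding C_ext_def rep_sum rep_scale
    by (rule sum.cong) (use x indexing_in indexing_eq[OF assms(5)] in \<open>auto simp: rep_basis\<close>)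
  also have "\<dots> = (if l' = l \<and> X = S \<and> Y = T then x c else 0)"
    using x(1) by (auto simp: sum.delta)
  finally show ?thesis .
qed

lemma rep_mult_C_ext:
  "rep (a * C_ext scale C l x S T) Z = (\<Sum>b | x b \<noteq> 0. x b * rep (a * C (l, S, b, T)) Z)"
  by (simp add: C_ext_def sum_distrib_left mult_scale rep_sum rep_scale)

lemma in_lower_span_iff:
  "x \<in> lower_span scale D C l \<longleftrightarrow>
    (\<forall>p\<in>cells D. rep x (C p) \<noteq> 0 \<longrightarrow> (fst p, l) \<in> leq D \<and> fst p \<noteq> l)"
proof -
  have e: "{C (k, S, b, T) | k S b T. (k, S, b, T) \<in> cells D \<and> (k, l) \<in> leq D \<and> k \<noteq> l} =
      C ` {p \<in> cells D. (fst p, l) \<in> leq D \<and> fst p \<noteq> l}" (is "?A = _")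
    by (force simp: image_iff)
  have s: "?A \<subseteq> BB" unfolding e using indexing_in by blast
  have Z: "\<exists>p\<in>cells D. Z = C p" if "rep x Z \<noteq> 0" for Z
    using representation_ne_zero[OF that] indexing_surj by blast
  show ?thesis
    unfolding lower_span_def in_span_iff[OF s] unfolding e
  proof (intro iffI ballI allI impI)
    fix p assume "\<forall>Z. rep x Z \<noteq> 0 \<longrightarrow> Z \<in> C ` {p \<in> cells D. (fst p, l) \<in> leq D \<and> fst p \<noteq> l}"
      and p: "p \<in> cells D" "rep x (C p) \<noteq> 0"
    then obtain q where "q \<in> cells D" "(fst q, l) \<in> leq D \<and> fst q \<noteq> l" "C p = C q" by blast
    then show "(fst p, l) \<in> leq D \<and> fst p \<noteq> l" using indexing_eq[OF p(1)] by metis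
  next
    fix W assume "\<forall>p\<in>cells D. rep x (C p) \<noteq> 0 \<longrightarrow> (fst p, l) \<in> leq D \<and> fst p \<noteq> l" "rep x W \<noteq> 0"
    then show "W \<in> C ` {p \<in> cells D. (fst p, l) \<in> leq D \<and> fst p \<noteq> l}" using Z[of W] by blast
  qed
qed

lemma ext_of_basis:
  assumes "l \<in> Lam D" "b \<in> Bas D l"
  shows "ext_of (Gam D l) (Bas D l) b = (\<lambda>c. if c = b then 1 else 0)"
  using ring.kappa_basis[OF table_familyD(4,5)[OF indexing_family assms(1)] assms(2)]
  by (auto simp: ext_of_def)

lemma rep_A3_sum:
  assumes l: "l \<in> Lam D" and r: "\<forall>X\<in>Idx D l. \<forall>S\<in>Idx D l. r X S \<in> ext_carrier (Bas D l)"
    and g: "g \<in> carrier (Gam D l)" and ST: "S \<in> Idx D l" "T \<in> Idx D l" and p: "(l', X, c, Y) \<in> cells D"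
  shows "rep (\<Sum>S'\<in>Idx D l. C_ext scale C l (ext_mult (Gam D l) (Bas D l) (r S' S) g) S' T) (C (l', X, c, Y)) =
    (if l' = l \<and> Y = T then ext_mult (Gam D l) (Bas D l) (r X S) g c else 0)"
proof -
  note t = table_familyD[OF indexing_family l]
  have "rep (\<Sum>S'\<in>Idx D l. C_ext scale C l (ext_mult (Gam D l) (Bas D l) (r S' S) g) S' T) (C (l', X, c, Y)) =
      (\<Sum>S'\<in>Idx D l. if X = S' then (if l' = l \<and> Y = T then ext_mult (Gam D l) (Bas D l) (r X S) g c else 0) else 0)"
    unfolding rep_sum
    by (rule sum.cong) (use l r g ST p ext_mult_carrier[OF t(4,5)] in \<open>auto simp: rep_C_ext\<close>)
  also have "\<dots> = (if l' = l \<and> Y = T then ext_mult (Gam D l) (Bas D l) (r X S) g c else 0)"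
    using t(2) p by (auto simp: sum.delta)
  finally show ?thesis .
qed

text \<open>Elements of the lower span have no coordinates in the cell \<open>l\<close> itself. So
  the coordinates of the difference in (A3) that lie in this cell must vanish, and the remaining
  ones only have to lie in lower cells; the two conditions decouple.\<close>

lemma axiom_A3_iff:
  "axiom_A3 scale D C \<longleftrightarrow> left_triangular D C (leq D) \<and> (\<forall>l\<in>Lam D. \<forall>a. \<exists>r. left_coeffs D C a l r)"
proof
  assume A3: "axiom_A3 scale D C"
  have *: "\<exists>r. left_coeffs D C a l r \<and> (\<forall>p\<in>cells D. \<forall>q\<in>cells D. fst q = l \<longrightarrow> fst p \<noteq> l \<longrightarrow>
      rep (a * C q) (C p) \<noteq> 0 \<longrightarrow> (fst p, l) \<in> leq D)" if l: "l \<in> Lam D" for l a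
  proof -
    note t = table_familyD[OF indexing_family l]
    obtain r where r: "\<forall>X\<in>Idx D l. \<forall>S\<in>Idx D l. r X S \<in> ext_carrier (Bas D l)"
      and m: "\<forall>g\<in>carrier (Gam D l). \<forall>S\<in>Idx D l. \<forall>T\<in>Idx D l.
           a * C_ext scale C l (ext_of (Gam D l) (Bas D l) g) S T
           - (\<Sum>S'\<in>Idx D l. C_ext scale C l (ext_mult (Gam D l) (Bas D l) (r S' S) g) S' T)
           \<in> lower_span scale D C l"
      using bspec[OF A3[unfolded axiom_A3_def] l, THEN spec, of a] by blast
    have key: "rep (a * C (l, S, b, T)) (C (l', X, c, Y)) -
        (if l' = l \<and> Y = T then ext_mult (Gam D l) (Bas D l) (r X S) b c else 0) \<noteq> 0 \<Longrightarrow>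
        (l', l) \<in> leq D \<and> l' \<noteq> l"
      if c: "(l, S, b, T) \<in> cells D" "(l', X, c, Y) \<in> cells D" for S b T l' X c Y
    proof -
      have b: "b \<in> carrier (Gam D l)" "S \<in> Idx D l" "T \<in> Idx D l" "b \<in> Bas D l" using c t(7) by auto
      have C1: "C_ext scale C l (ext_of (Gam D l) (Bas D l) b) S T = C (l, S, b, T)"
        unfolding ext_of_basis[OF l b(4)] C_ext_def by simp
      show "rep (a * C (l, S, b, T)) (C (l', X, c, Y)) -
        (if l' = l \<and> Y = T then ext_mult (Gam D l) (Bas D l) (r X S) b c else 0) \<noteq> 0 \<Longrightarrow>
        (l', l) \<in> leq D \<and> l' \<noteq> l"
        using m[rule_format, OF b(1-3)] c(2) unfolding in_lower_span_iff rep_diff C1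
        using rep_A3_sum[OF l r b(1-3) c(2)] by fastforce
    qed
    have "left_coeffs D C a l r"
      unfolding left_coeffs_def
    proof (intro conjI ballI)
      fix S T X Y b c assume i: "S \<in> Idx D l" "T \<in> Idx D l" "X \<in> Idx D l" "Y \<in> Idx D l" "b \<in> Bas D l" "c \<in> Bas D l"
      show "rep (a * C (l, S, b, T)) (C (l, X, c, Y)) =
          (if Y = T then \<Sum>d | r X S d \<noteq> 0. r X S d * of_int (kappa (Gam D l) (Bas D l) c (d \<otimes>\<^bsub>Gam D l\<^esub> b)) else 0)"
      proof -
        have "rep (a * C (l, S, b, T)) (C (l, X, c, Y)) -
            (if l = l \<and> Y = T then ext_mult (Gam D l) (Bas D l) (r X S) b c else 0) = 0"
          by (rule ccontr) (use key[of S b T l X c Y] i l in simp)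
        then show ?thesis unfolding ext_mult_def ext_of_def by simp
      qed
    qed (use r in auto)
    moreover have "(fst p, l) \<in> leq D" if pq: "p \<in> cells D" "q \<in> cells D" "fst q = l" "fst p \<noteq> l" "rep (a * C q) (C p) \<noteq> 0" for p q
    proof -
      obtain S b T where "q = (l, S, b, T)" using pq(3) by (cases q) auto
      then show ?thesis using key[of S b T "fst p" "fst (snd p)" "fst (snd (snd p))" "snd (snd (snd p))"] pq by simp
    qed
    ultimately show ?thesis by blast
  qed
  show "left_triangular D C (leq D) \<and> (\<forall>l\<in>Lam D. \<forall>a. \<exists>r. left_coeffs D C a l r)"
    unfolding left_triangular_def using * fst_cells by blast
next
  assume a: "left_triangular D C (leq D) \<and> (\<forall>l\<in>Lam D. \<forall>a. \<exists>r. left_coeffs D C a l r)"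
  show "axiom_A3 scale D C"
    unfolding axiom_A3_def
  proof (intro ballI allI)
    fix l a assume l: "l \<in> Lam D"
    note t = table_familyD[OF indexing_family l]
    interpret R: ring "Gam D l" by (rule t(4))
    obtain r where r: "left_coeffs D C a l r" using a l by blast
    have rc: "\<forall>X\<in>Idx D l. \<forall>S\<in>Idx D l. r X S \<in> ext_carrier (Bas D l)" using r unfolding left_coeffs_def by blast
    show "\<exists>r. (\<forall>S'\<in>Idx D l. \<forall>S\<in>Idx D l. r S' S \<in> ext_carrier (Bas D l)) \<and>
        (\<forall>g\<in>carrier (Gam D l). \<forall>S\<in>Idx D l. \<forall>T\<in>Idx D l.
           a * C_ext scale C l (ext_of (Gam D l) (Bas D l) g) S T
           - (\<Sum>S'\<in>Idx D l. C_ext scale C l (ext_mult (Gam D l) (Bas D l) (r S' S) g) S' T)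
           \<in> lower_span scale D C l)"
    proof (intro exI[of _ r] conjI ballI)
      fix g S T assume g: "g \<in> carrier (Gam D l)" and ST: "S \<in> Idx D l" "T \<in> Idx D l"
      \<comment> \<open>From basis elements to arbitrary g: both sides are expanded with the
        coordinates of g, and bilinearity reassembles the products of the \<open>d\<close> with
        g.\<close>
      define k where "k b = kappa (Gam D l) (Bas D l) b g" for b
      have kB: "b \<in> Bas D l" if "k b \<noteq> 0" for b
        using kappa_nonzero_in[OF t(5) g] that unfolding k_def by blast
      have e: "rep (a * C_ext scale C l (ext_of (Gam D l) (Bas D l) g) S T) Z =
          (\<Sum>b | k b \<noteq> 0. of_int (k b) * rep (a * C (l, S, b, T)) Z)" for Z
        unfolding rep_mult_C_ext unfolding ext_of_def k_def by simp
      show "a * C_ext scale C l (ext_of (Gam D l) (Bas D l) g) S T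
           - (\<Sum>S'\<in>Idx D l. C_ext scale C l (ext_mult (Gam D l) (Bas D l) (r S' S) g) S' T)
           \<in> lower_span scale D C l"
        unfolding in_lower_span_iff
      proof (intro ballI impI)
        fix p assume p: "p \<in> cells D"
          and nz: "rep (a * C_ext scale C l (ext_of (Gam D l) (Bas D l) g) S T
           - (\<Sum>S'\<in>Idx D l. C_ext scale C l (ext_mult (Gam D l) (Bas D l) (r S' S) g) S' T)) (C p) \<noteq> 0"
        obtain l' X c Y where p': "p = (l', X, c, Y)" by (cases p)
        have nz': "(\<Sum>b | k b \<noteq> 0. of_int (k b) * rep (a * C (l, S, b, T)) (C p)) -
            (if l' = l \<and> Y = T then ext_mult (Gam D l) (Bas D l) (r X S) g c else 0) \<noteq> 0"
          using nz rep_A3_sum[OF l rc g ST p[unfolded p']] unfolding rep_diff e p' by simp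
        show "(fst p, l) \<in> leq D \<and> fst p \<noteq> l"
        proof (cases "l' = l")
          case False
          then have "(\<Sum>b | k b \<noteq> 0. of_int (k b) * rep (a * C (l, S, b, T)) (C p)) \<noteq> 0" using nz' by simp
          then obtain b where b': "b \<in> {b. k b \<noteq> 0}" "of_int (k b) * rep (a * C (l, S, b, T)) (C p) \<noteq> 0"
            by (rule sum.not_neutral_contains_not_neutral)
          then have b: "k b \<noteq> 0" "rep (a * C (l, S, b, T)) (C p) \<noteq> 0" by auto
          have "(l, S, b, T) \<in> cells D" using l ST kB[OF b(1)] by simp
          then show ?thesis using a p b False unfolding left_triangular_def p' by fastforce
        next
          case True
          have i: "X \<in> Idx D l" "Y \<in> Idx D l" "c \<in> Bas D l" using p p' True by auto
          have rX: "finite {d. r X S d \<noteq> 0}" "{d. r X S d \<noteq> 0} \<subseteq> carrier (Gam D l)"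
            using rc i ST t(7) unfolding ext_carrier_def by blast+
          have "rep (a * C (l, S, b, T)) (C p) =
              (if Y = T then \<Sum>d | r X S d \<noteq> 0. r X S d * of_int (kappa (Gam D l) (Bas D l) c (d \<otimes>\<^bsub>Gam D l\<^esub> b)) else 0)"
            if "k b \<noteq> 0" for b
            using r kB[OF that] i ST unfolding left_coeffs_def p' True by blast
          then have "(\<Sum>b | k b \<noteq> 0. of_int (k b) * rep (a * C (l, S, b, T)) (C p)) =
            (\<Sum>b | k b \<noteq> 0. of_int (k b) * (if Y = T then \<Sum>d | r X S d \<noteq> 0. r X S d *
                of_int (kappa (Gam D l) (Bas D l) c (d \<otimes>\<^bsub>Gam D l\<^esub> b)) else 0))"
            by (intro sum.cong) auto
          also have "\<dots> = (if Y = T then (\<Sum>d | r X S d \<noteq> 0. r X S d *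
              (\<Sum>b | k b \<noteq> 0. of_int (k b * kappa (Gam D l) (Bas D l) c (d \<otimes>\<^bsub>Gam D l\<^esub> b)))) else 0)"
            unfolding sum_distrib_left
            by (auto simp: sum.swap[of _ "{d. r X S d \<noteq> 0}"] sum_distrib_left algebra_simps)
          also have "\<dots> = (if Y = T then ext_mult (Gam D l) (Bas D l) (r X S) g c else 0)"
            using rX(2) kappa_mult_right[OF t(4,5) _ g, of _ c]
            unfolding ext_mult_def ext_of_def k_def
            by (auto intro!: sum.cong simp: subset_iff)
          finally show ?thesis using nz' True by simp
        qed
      qed
    qed (use rc in auto)
  qed
qed

end

end

section \<open>Leading coefficients\<close>

text \<open>As a relation this gives equalities between values of the a-function: two values agree
  if both are the degree of one and the same polynomial.\<close>

definition top_deg :: "laurent \<Rightarrow> int \<Rightarrow> bool" where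
  "top_deg f k \<longleftrightarrow> Poly_Mapping.lookup f k \<noteq> 0 \<and> (\<forall>j. Poly_Mapping.lookup f j \<noteq> 0 \<longrightarrow> j \<le> k)"

lemma top_deg_unique: "top_deg f k \<Longrightarrow> top_deg f k' \<Longrightarrow> k = k'"
  unfolding top_deg_def by (meson order_antisym)

lemma top_deg_laurent_deg: "f \<noteq> 0 \<Longrightarrow> top_deg f (laurent_deg f)"
  unfolding top_deg_def laurent_deg_def
  using Max_in[of "Poly_Mapping.keys f"] by (auto simp: in_keys_iff[symmetric] simp del: not_in_keys_iff_lookup_eq_zero)

text \<open>Integers are constants among Laurent polynomials and do not shift exponents, so
  extracting the coefficient of one power passes through the sums supplied by (A3).\<close>

lemma lookup_sum_of_int:
  "Poly_Mapping.lookup (\<Sum>d\<in>S. r d * of_int (h d)) k = (\<Sum>d\<in>S. Poly_Mapping.lookup (r d) k * h d)"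
  for r :: "'d \<Rightarrow> laurent"
proof -
  have *: "Poly_Mapping.lookup (f * of_int n) k = Poly_Mapping.lookup f k * n" for f :: laurent and n :: int
  proof (induction n rule: int_induct[where k=0])
    case (step1 i)
    then show ?case by (simp add: lookup_add algebra_simps)
  next
    case (step2 i)
    then show ?case by (simp add: lookup_minus algebra_simps)
  qed simp
  show ?thesis by (simp add: Poly_Mapping.lookup_sum *)
qed

context laurent_basis
begin

abbreviation g_const :: "(('l, 'g, 'm) cell_index \<Rightarrow> 'a) \<Rightarrow> ('l, 'g, 'm) cell_index \<Rightarrow>
    ('l, 'g, 'm) cell_index \<Rightarrow> ('l, 'g, 'm) cell_index \<Rightarrow> laurent" where
  "g_const C p q r \<equiv> str_const scale BB (C p) (C q) (C r)"

context
  fixes D :: "('l, 'g, 'm, 'a) table_tuple" and C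
  assumes DC: "indexing D C" and A4: "axiom_A4 scale D C"
begin

lemma C_image: "C ` cells D = BB"
  using DC unfolding indexing_def bij_betw_def by blast

lemma laurent_deg_le_a_fun:
  assumes "p \<in> cells D" "q \<in> cells D" "r \<in> cells D" "g_const C p q r \<noteq> 0"
  shows "laurent_deg (g_const C p q r) \<le> a_fun scale BB (C r)"
proof -
  have m: "laurent_deg (g_const C p q r) \<in> str_degs scale BB (C r)"
    using assms indexing_in[OF DC] unfolding str_degs_def by blast
  obtain d where d: "d \<in> str_degs scale BB (C r)" "\<forall>e\<in>str_degs scale BB (C r). e \<le> d"
    using A4 indexing_in[OF DC assms(3)] unfolding axiom_A4_def Let_def C_image a_defined_def by blast
  then have "a_fun scale BB (C r) = d" unfolding a_fun_def by (intro Greatest_equality) auto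
  then show ?thesis using d m by blast
qed

lemma axiom_A4_at:
  assumes p: "(l, S, b, T) \<in> cells D" and q: "(l', U, b', V) \<in> cells D" and r: "(l'', X, b'', Y) \<in> cells D"
  defines "match \<equiv> l = l' \<and> l' = l'' \<and> X = S \<and> T = U \<and> Y = V \<and>
    kappa (Gam D l) (Bas D l) b'' (b \<otimes>\<^bsub>Gam D l\<^esub> b') \<noteq> 0"
  shows "g_const C (l, S, b, T) (l', U, b', V) (l'', X, b'', Y) \<noteq> 0 \<and>
      laurent_deg (g_const C (l, S, b, T) (l', U, b', V) (l'', X, b'', Y)) = a_fun scale BB (C (l'', X, b'', Y)) \<longleftrightarrow> match"
    and "match \<and> b = \<one>\<^bsub>Gam D l\<^esub> \<and> b' = \<one>\<^bsub>Gam D l\<^esub> \<and> b'' = \<one>\<^bsub>Gam D l\<^esub> \<longrightarrow>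
      gamma scale BB (C (l, S, b, T)) (C (l', U, b', V)) (C (l'', X, b'', Y)) = 1"
proof -
  note 1 = conjunct2[OF A4[unfolded axiom_A4_def Let_def C_image]]
  note 2 = bspec[OF bspec[OF bspec[OF 1 p, unfolded prod.case] q, unfolded prod.case] r, unfolded prod.case]
  show "g_const C (l, S, b, T) (l', U, b', V) (l'', X, b'', Y) \<noteq> 0 \<and>
      laurent_deg (g_const C (l, S, b, T) (l', U, b', V) (l'', X, b'', Y)) = a_fun scale BB (C (l'', X, b'', Y)) \<longleftrightarrow> match"
    using conjunct1[OF 2] unfolding match_def .
  show "match \<and> b = \<one>\<^bsub>Gam D l\<^esub> \<and> b' = \<one>\<^bsub>Gam D l\<^esub> \<and> b'' = \<one>\<^bsub>Gam D l\<^esub> \<longrightarrow>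
      gamma scale BB (C (l, S, b, T)) (C (l', U, b', V)) (C (l'', X, b'', Y)) = 1"
    using conjunct2[OF 2] unfolding match_def .
qed

lemma axiom_A4_cell_kappa:
  assumes "p \<in> cells D" "q \<in> cells D" "r \<in> cells D"
  shows "g_const C p q r \<noteq> 0 \<and> laurent_deg (g_const C p q r) = a_fun scale BB (C r) \<longleftrightarrow> cell_kappa D p q r \<noteq> 0"
proof -
  obtain l S b T where p: "p = (l, S, b, T)" by (cases p)
  obtain l' U b' V where q: "q = (l', U, b', V)" by (cases q)
  obtain l'' X b'' Y where r: "r = (l'', X, b'', Y)" by (cases r)
  show ?thesis
    using axiom_A4_at(1)[OF assms[unfolded p q r]] unfolding p q r cell_kappa_simp if_split[of "\<lambda>x. x \<noteq> 0"] by blast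
qed

lemma top_deg_g_const:
  assumes "p \<in> cells D" "q \<in> cells D" "r \<in> cells D" "cell_kappa D p q r \<noteq> 0"
  shows "top_deg (g_const C p q r) (a_fun scale BB (C r))"
  using axiom_A4_cell_kappa[OF assms(1-3)] assms(4) top_deg_laurent_deg by metis

text \<open>A nonzero coefficient at the exponent a, which bounds the degree, makes the degree equal
  to a; then (A4) produces a nonzero structure constant.\<close>

lemma gamma_eq_0:
  assumes "p \<in> cells D" "q \<in> cells D" "r \<in> cells D" "cell_kappa D p q r = 0"
  shows "gamma scale BB (C p) (C q) (C r) = 0"
proof (rule ccontr)
  assume "gamma scale BB (C p) (C q) (C r) \<noteq> 0"
  then have a: "Poly_Mapping.lookup (g_const C p q r) (a_fun scale BB (C r)) \<noteq> 0"
    unfolding gamma_def .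
  then have nz: "g_const C p q r \<noteq> 0" by auto
  have "a_fun scale BB (C r) \<le> laurent_deg (g_const C p q r)"
    using a top_deg_laurent_deg[OF nz] unfolding top_deg_def by blast
  then show False
    using laurent_deg_le_a_fun[OF assms(1-3) nz] axiom_A4_cell_kappa[OF assms(1-3)] nz assms(4) by simp
qed

lemma gamma_one:
  assumes "l \<in> Lam D" "S \<in> Idx D l" "T \<in> Idx D l" "V \<in> Idx D l"
  shows "gamma scale BB (C (l, S, \<one>\<^bsub>Gam D l\<^esub>, T)) (C (l, T, \<one>\<^bsub>Gam D l\<^esub>, V)) (C (l, S, \<one>\<^bsub>Gam D l\<^esub>, V)) = 1"
proof -
  note t = table_familyD[OF indexing_family[OF DC] assms(1)]
  have "kappa (Gam D l) (Bas D l) \<one>\<^bsub>Gam D l\<^esub> (\<one>\<^bsub>Gam D l\<^esub> \<otimes>\<^bsub>Gam D l\<^esub> \<one>\<^bsub>Gam D l\<^esub>) \<noteq> 0"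
    using kappa_table_algebra(1)[OF t(1,6)] by simp
  moreover have "(l, S, \<one>\<^bsub>Gam D l\<^esub>, T) \<in> cells D" "(l, T, \<one>\<^bsub>Gam D l\<^esub>, V) \<in> cells D" "(l, S, \<one>\<^bsub>Gam D l\<^esub>, V) \<in> cells D"
    using assms t(6) by auto
  ultimately show ?thesis using axiom_A4_at(2) by blast
qed

context
  assumes A2: "axiom_A2 scale D C" and A3: "axiom_A3 scale D C"
begin

lemma star_C: "p \<in> cells D \<Longrightarrow> star D (C p) = C (cell_star D p)"
  using A2 unfolding axiom_A2_def cell_star_def by (cases p) fastforce

lemma star_BB: "Z \<in> BB \<Longrightarrow> star D Z \<in> BB"
  using indexing_surj[OF DC] star_C indexing_in[OF DC] cell_star_in(1)[OF indexing_family[OF DC]] by metis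

text \<open>The anti-automorphism is linear and permutes the basis, so it permutes coordinates in
  the same way.\<close>

lemma rep_star:
  shows "rep (star D x) (star D Z) = rep x Z"
proof -
  have inv: "star D (star D y) = y" for y using A2 unfolding axiom_A2_def by blast
  have hom: "module_hom scale scale (star D)" using A2 unfolding axiom_A2_def by blast
  have inj: "inj_on (star D) A" for A using inv by (metis inj_onI)
  have "star D x = (\<Sum>W | rep x W \<noteq> 0. scale (rep x W) (star D W))"
    using rep_expand[of x] module_hom.sum[OF hom] module_hom.scale[OF hom] by (metis (no_types, lifting) sum.cong)
  then have "rep (star D x) (star D Z) = (\<Sum>W | rep x W \<noteq> 0. rep x W * rep (star D W) (star D Z))"
    by (simp add: rep_sum rep_scale)
  also have "\<dots> = (\<Sum>W | rep x W \<noteq> 0. if W = Z then rep x Z else 0)"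
  proof (rule sum.cong[OF refl])
    fix W assume "W \<in> {W. rep x W \<noteq> 0}"
    then have "W \<in> BB" using representation_ne_zero by blast
    then show "rep x W * rep (star D W) (star D Z) = (if W = Z then rep x Z else 0)"
      using star_BB inv by (auto simp: rep_basis) metis
  qed
  also have "\<dots> = rep x Z" using finite_representation[of BB x] by (auto simp: sum.delta)
  finally show ?thesis .
qed

lemma g_const_star:
  assumes "p \<in> cells D" "q \<in> cells D" "r \<in> cells D"
  shows "g_const C (cell_star D q) (cell_star D p) (cell_star D r) = g_const C p q r"
proof -
  have "star D (x * y) = star D y * star D x" for x y using A2 unfolding axiom_A2_def by blast
  then show ?thesis
    using rep_star[of "C p * C q" "C r"] assms by (simp add: str_const_def star_C)
qed

text \<open>Both values are degrees of one polynomial: the coefficient of \<open>p\<close> in its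
  product with the diagonal unit of its column, which the anti-automorphism turns into the
  corresponding coefficient for \<open>cell_star D p\<close>.\<close>

lemma a_fun_star:
  assumes "p \<in> cells D"
  shows "a_fun scale BB (C (cell_star D p)) = a_fun scale BB (C p)"
proof -
  obtain l S b T where p: "p = (l, S, b, T)" by (cases p)
  have l: "l \<in> Lam D" using assms p by simp
  note t = table_familyD[OF indexing_family[OF DC] l]
  let ?u = "(l, T, \<one>\<^bsub>Gam D l\<^esub>, T)"
  have u: "?u \<in> cells D" "cell_star D ?u = ?u" using assms p t table_bar_one[OF t(1)] by (auto simp: cell_star_simp)
  have ps: "cell_star D p \<in> cells D" using cell_star_in(1)[OF indexing_family[OF DC] assms] .
  have "cell_kappa D p ?u p \<noteq> 0" "cell_kappa D ?u (cell_star D p) (cell_star D p) \<noteq> 0"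
    using kappa_table_algebra[OF t(1)] assms ps unfolding p by (auto simp: cell_kappa_simp cell_star_simp)
  then have "top_deg (g_const C p ?u p) (a_fun scale BB (C p))"
    "top_deg (g_const C ?u (cell_star D p) (cell_star D p)) (a_fun scale BB (C (cell_star D p)))"
    using top_deg_g_const u(1) assms ps by blast+
  then show ?thesis using g_const_star[OF assms u(1) assms] u(2) top_deg_unique by metis
qed

text \<open>Here \<open>r\<close> is the coefficient r_a of (A3) for a = C_{S,T}^b. Multiplying by 1
  reveals all its coordinates; multiplying by the involute of b and looking at 1 isolates the
  coordinate at b. None of this depends on the column V.\<close>

lemma g_const_coeffs:
  assumes "(l, S, b, T) \<in> cells D"
  shows "\<exists>r. (finite {d. r d \<noteq> 0}) \<and>
    (\<forall>d. r d \<noteq> 0 \<longrightarrow> d \<in> Bas D l) \<and>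
    (\<forall>V\<in>Idx D l. \<forall>b'\<in>Bas D l. \<forall>b''\<in>Bas D l.
        g_const C (l, S, b, T) (l, T, b', V) (l, S, b'', V) =
        (\<Sum>d | r d \<noteq> 0. r d * of_int (kappa (Gam D l) (Bas D l) b'' (d \<otimes>\<^bsub>Gam D l\<^esub> b')))) \<and>
    (\<forall>V\<in>Idx D l. \<forall>d\<in>Bas D l. g_const C (l, S, b, T) (l, T, \<one>\<^bsub>Gam D l\<^esub>, V) (l, S, d, V) = r d) \<and>
    (\<forall>V\<in>Idx D l. g_const C (l, S, b, T) (l, T, table_bar (Gam D l) (Bas D l) b, V) (l, S, \<one>\<^bsub>Gam D l\<^esub>, V) = r b)"
proof -
  have l: "l \<in> Lam D" using assms by simp
  note t = table_familyD[OF indexing_family[OF DC] l]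
  obtain r where r: "left_coeffs D C (C (l, S, b, T)) l r"
    using A3 l unfolding axiom_A3_iff[OF DC] by blast
  \<comment> \<open>\<open>S\<close> is the row of the result and \<open>T\<close> the row of the
    second factor.\<close>
  define f where "f = r S T"
  have "f \<in> ext_carrier (Bas D l)" using r assms unfolding left_coeffs_def f_def by simp
  then have f: "finite {d. f d \<noteq> 0}" "f d \<noteq> 0 \<Longrightarrow> d \<in> Bas D l" for d
    unfolding ext_carrier_def by auto
  have g: "g_const C (l, S, b, T) (l, T, b', V) (l, S, b'', V) =
       (\<Sum>d | f d \<noteq> 0. f d * of_int (kappa (Gam D l) (Bas D l) b'' (d \<otimes>\<^bsub>Gam D l\<^esub> b')))"
    if "V \<in> Idx D l" "b' \<in> Bas D l" "b'' \<in> Bas D l" for V b' b''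
    using r assms that unfolding left_coeffs_def str_const_def f_def by simp
  have "g_const C (l, S, b, T) (l, T, \<one>\<^bsub>Gam D l\<^esub>, V) (l, S, d, V) = f d" if "V \<in> Idx D l" "d \<in> Bas D l" for V d
  proof -
    have "g_const C (l, S, b, T) (l, T, \<one>\<^bsub>Gam D l\<^esub>, V) (l, S, d, V) = (\<Sum>d' | f d' \<noteq> 0. if d = d' then f d else 0)"
      unfolding g[OF that(1) t(6) that(2)]
      by (rule sum.cong) (use f(2) kappa_table_algebra(2)[OF t(1)] in auto)
    then show ?thesis using f(1) by (auto simp: sum.delta)
  qed
  moreover have "g_const C (l, S, b, T) (l, T, table_bar (Gam D l) (Bas D l) b, V) (l, S, \<one>\<^bsub>Gam D l\<^esub>, V) = f b"
    if "V \<in> Idx D l" for V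
  proof -
    have b: "b \<in> Bas D l" using assms by simp
    note bar = table_bar[OF t(1) b]
    have "g_const C (l, S, b, T) (l, T, table_bar (Gam D l) (Bas D l) b, V) (l, S, \<one>\<^bsub>Gam D l\<^esub>, V) =
        (\<Sum>d' | f d' \<noteq> 0. if b = d' then f b else 0)"
      unfolding g[OF that bar(1) t(6)]
      by (rule sum.cong) (use f(2) kappa_table_algebra(3)[OF t(1) bar(1)] bar(2) in auto)
    then show ?thesis using f(1) by (auto simp: sum.delta)
  qed
  ultimately show ?thesis using f g by (intro exI[of _ f]) blast
qed

text \<open>By (A3), \<open>\<^bold>a\<close> does not depend on the column \<open>V\<close>, hence by \<open>*\<close> not on the row either; multiplying
  by the involute of \<open>b\<close> compares it with the value at \<open>1\<close>.\<close>

lemma a_fun_block: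
  assumes p: "(l, S, b, V) \<in> cells D" and q: "(l, S', b', V') \<in> cells D"
  shows "a_fun scale BB (C (l, S, b, V)) = a_fun scale BB (C (l, S', b', V'))"
proof -
  have l: "l \<in> Lam D" using p by simp
  note t = table_familyD[OF indexing_family[OF DC] l]
  let ?a = "\<lambda>S b V. a_fun scale BB (C (l, S, b, V))"
  let ?e = "\<one>\<^bsub>Gam D l\<^esub>"
  have col: "?a S b V = ?a S b V'" and one: "?a S b V = ?a S ?e V"
    if i: "S \<in> Idx D l" "b \<in> Bas D l" "V \<in> Idx D l" "V' \<in> Idx D l" for S b V V'
  proof -
    have p: "(l, S, b, S) \<in> cells D" using i l by simp
    obtain r where r: "finite {d. r d \<noteq> 0}" "\<forall>d. r d \<noteq> 0 \<longrightarrow> d \<in> Bas D l"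
      "\<forall>V\<in>Idx D l. \<forall>b'\<in>Bas D l. \<forall>b''\<in>Bas D l.
        g_const C (l, S, b, S) (l, S, b', V) (l, S, b'', V) =
        (\<Sum>d | r d \<noteq> 0. r d * of_int (kappa (Gam D l) (Bas D l) b'' (d \<otimes>\<^bsub>Gam D l\<^esub> b')))"
      "\<forall>V\<in>Idx D l. \<forall>d\<in>Bas D l. g_const C (l, S, b, S) (l, S, ?e, V) (l, S, d, V) = r d"
      "\<forall>V\<in>Idx D l. g_const C (l, S, b, S) (l, S, table_bar (Gam D l) (Bas D l) b, V) (l, S, ?e, V) = r b"
      using g_const_coeffs[OF p] by blast
    have top: "top_deg (r b) (?a S b V)" if "V \<in> Idx D l" for V
      using top_deg_g_const[of "(l, S, b, S)" "(l, S, ?e, V)" "(l, S, b, V)"] r(4)[rule_format, OF that i(2)] that i l t(6)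
        kappa_table_algebra(2)[OF t(1) i(2)] by (simp add: cell_kappa_simp)
    note bar = table_bar[OF t(1) i(2)]
    have "top_deg (r b) (?a S ?e V)"
      using top_deg_g_const[of "(l, S, b, S)" "(l, S, table_bar (Gam D l) (Bas D l) b, V)" "(l, S, ?e, V)"]
        r(5)[rule_format, OF i(3)] i l t(6) bar kappa_table_algebra(3)[OF t(1) bar(1) i(2)] by (simp add: cell_kappa_simp)
    then show "?a S b V = ?a S ?e V" "?a S b V = ?a S b V'" using top i top_deg_unique by blast+
  qed
  have star: "?a S ?e V = ?a V ?e S" if "S \<in> Idx D l" "V \<in> Idx D l" for S V
    using a_fun_star[of "(l, S, ?e, V)"] that l t(6) table_bar_one[OF t(1)] by (simp add: cell_star_simp)
  have i: "S \<in> Idx D l" "b \<in> Bas D l" "V \<in> Idx D l" "S' \<in> Idx D l" "b' \<in> Bas D l" "V' \<in> Idx D l"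
    using p q by auto
  \<comment> \<open>Columns can be changed freely, rows only by way of the anti-automorphism; it is
    applied at basis element 1, which it fixes.\<close>
  have "?a S b V = ?a S ?e V" using one i by blast
  also have "\<dots> = ?a S ?e S'" using col i t(6) by blast
  also have "\<dots> = ?a S' ?e S" using star i by blast
  also have "\<dots> = ?a S' ?e V'" using col i t(6) by blast
  also have "\<dots> = ?a S' b' V'" using one[of S' b' V' V'] i by simp
  finally show ?thesis .
qed

text \<open>By (A4) the leading part of r_a for a = C_{S,T}^b can only be an integer multiple of b,
  so (A3) gives the structure constants up to this factor. The factor is 1 by the normalization in
  (A4), after the anti-automorphism has moved b to the other side.\<close>

theorem gamma_eq_cell_kappa:
  assumes p: "p \<in> cells D" and q: "q \<in> cells D" and r: "r \<in> cells D"
  shows "gamma scale BB (C p) (C q) (C r) = cell_kappa D p q r"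
proof (cases "cell_kappa D p q r = 0")
  case True
  then show ?thesis using gamma_eq_0[OF assms] by simp
next
  case False
  obtain l S b T where p': "p = (l, S, b, T)" by (cases p)
  obtain l' U b' V where q0: "q = (l', U, b', V)" by (cases q)
  obtain l'' X b'' Y where r0: "r = (l'', X, b'', Y)" by (cases r)
  have q': "q = (l, T, b', V)" and r': "r = (l, S, b'', V)"
    using False unfolding p' q0 r0 by (auto simp: cell_kappa_simp split: if_splits)
  have l: "l \<in> Lam D" using p p' by simp
  note t = table_familyD[OF indexing_family[OF DC] l]
  have i: "S \<in> Idx D l" "b \<in> Bas D l" "T \<in> Idx D l" "V \<in> Idx D l" "b' \<in> Bas D l" "b'' \<in> Bas D l"
    using p q r p' q' r' by auto
  let ?e = "\<one>\<^bsub>Gam D l\<^esub>" and ?k = "kappa (Gam D l) (Bas D l)"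
  let ?\<gamma> = "\<lambda>p q r. gamma scale BB (C p) (C q) (C r)"
  have expand: "?\<gamma> (l, S, b, T) (l, T, b', V) (l, S, b'', V) =
      ?\<gamma> (l, S, b, T) (l, T, ?e, V) (l, S, b, V) * ?k b'' (b \<otimes>\<^bsub>Gam D l\<^esub> b')"
    if i: "S \<in> Idx D l" "b \<in> Bas D l" "T \<in> Idx D l" "V \<in> Idx D l" "b' \<in> Bas D l" "b'' \<in> Bas D l"
    for S b T V b' b''
  proof -
    have p: "(l, S, b, T) \<in> cells D" using i l by simp
    obtain r where r: "finite {d. r d \<noteq> 0}" "\<forall>d. r d \<noteq> 0 \<longrightarrow> d \<in> Bas D l"
      "\<forall>V\<in>Idx D l. \<forall>b'\<in>Bas D l. \<forall>b''\<in>Bas D l.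
        g_const C (l, S, b, T) (l, T, b', V) (l, S, b'', V) =
        (\<Sum>d | r d \<noteq> 0. r d * of_int (kappa (Gam D l) (Bas D l) b'' (d \<otimes>\<^bsub>Gam D l\<^esub> b')))"
      "\<forall>V\<in>Idx D l. \<forall>d\<in>Bas D l. g_const C (l, S, b, T) (l, T, ?e, V) (l, S, d, V) = r d"
      "\<forall>V\<in>Idx D l. g_const C (l, S, b, T) (l, T, table_bar (Gam D l) (Bas D l) b, V) (l, S, ?e, V) = r b"
      using g_const_coeffs[OF p] by blast
    \<comment> \<open>By \<open>a_fun_block\<close> this one exponent serves every basis element
      \<open>d\<close> in this row and column, so the coefficient at \<open>A\<close> is the leading
      coefficient for all of them at once.\<close>
    define A where "A = a_fun scale BB (C (l, S, b'', V))"
    have A: "a_fun scale BB (C (l, S, d, V)) = A" if "d \<in> Bas D l" for d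
      unfolding A_def by (rule a_fun_block) (use i l that in auto)
    have top: "Poly_Mapping.lookup (r d) A = ?\<gamma> (l, S, b, T) (l, T, ?e, V) (l, S, d, V)" if "d \<in> Bas D l" for d
      unfolding gamma_def A[OF that] r(4)[rule_format, OF i(4) that] ..
    \<comment> \<open>In the product of b and 1 only b occurs, so (A4) excludes the exponent
      \<open>A\<close> from the other coordinates.\<close>
    have zero: "Poly_Mapping.lookup (r d) A = 0" if "d \<in> Bas D l" "d \<noteq> b" for d
      unfolding top[OF that(1)]
      by (rule gamma_eq_0) (use i l t(6) that kappa_table_algebra(2)[OF t(1) i(2)] in \<open>auto simp: cell_kappa_simp\<close>)
    have "?\<gamma> (l, S, b, T) (l, T, b', V) (l, S, b'', V) =
        (\<Sum>d | r d \<noteq> 0. Poly_Mapping.lookup (r d) A * ?k b'' (d \<otimes>\<^bsub>Gam D l\<^esub> b'))"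
      unfolding gamma_def A_def r(3)[rule_format, OF i(4-6)] lookup_sum_of_int ..
    also have "\<dots> = (\<Sum>d | r d \<noteq> 0. if d = b then Poly_Mapping.lookup (r b) A * ?k b'' (b \<otimes>\<^bsub>Gam D l\<^esub> b') else 0)"
      by (rule sum.cong) (use r(2) zero in auto)
    also have "\<dots> = Poly_Mapping.lookup (r b) A * ?k b'' (b \<otimes>\<^bsub>Gam D l\<^esub> b')"
      using r(1) by (auto simp: sum.delta)
    finally show ?thesis using top[OF i(2)] by simp
  qed
  \<comment> \<open>The anti-automorphism exchanges the factors. Afterwards the left one carries 1,
    and \<open>expand\<close> reduces to the case that (A4) normalizes.\<close>
  have one: "?\<gamma> (l, S, b, T) (l, T, ?e, V) (l, S, b, V) = 1"
  proof -
    let ?b = "table_bar (Gam D l) (Bas D l) b"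
    have c: "(l, S, b, T) \<in> cells D" "(l, T, ?e, V) \<in> cells D" "(l, S, b, V) \<in> cells D" using i l t(6) by auto
    have "?\<gamma> (l, S, b, T) (l, T, ?e, V) (l, S, b, V) = ?\<gamma> (l, V, ?e, T) (l, T, ?b, S) (l, V, ?b, S)"
      using g_const_star[OF c] a_fun_star[OF c(3)] table_bar_one[OF t(1)]
      by (simp add: cell_star_simp gamma_def)
    also have "\<dots> = ?\<gamma> (l, V, ?e, T) (l, T, ?e, S) (l, V, ?e, S) * ?k ?b (?e \<otimes>\<^bsub>Gam D l\<^esub> ?b)"
      by (rule expand) (use i t(6) table_bar[OF t(1)] in auto)
    also have "\<dots> = 1"
      using gamma_one[OF l i(4) i(3) i(1)] kappa_table_algebra(1)[OF t(1) table_bar(1)[OF t(1) i(2)]] by simp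
    finally show ?thesis .
  qed
  show ?thesis
    unfolding p' q' r' expand[OF i] one by (simp add: cell_kappa_simp)
qed

end
end
end

section \<open>Left multiplication and the asymptotic product\<close>

context laurent_basis
begin

text \<open>With \<open>X \<bullet> Y = \<Sum>Z. \<gamma>\<^sub>X\<^sub>,\<^sub>Y\<^sub>,\<^sub>Z Z\<close>, this compares the coefficients of \<open>C p\<close> in \<open>a (C q \<bullet> C s)\<close> and
  \<open>(a C q) \<bullet> C s\<close>. Unlike (A3), it refers to the parametrization only through the cells.\<close>

definition left_commutes :: "('l, 'g, 'm, 'a) table_tuple \<Rightarrow> (('l, 'g, 'm) cell_index \<Rightarrow> 'a) \<Rightarrow> bool" where
  "left_commutes D C \<longleftrightarrow> (\<forall>a. \<forall>p\<in>cells D. \<forall>q\<in>cells D. \<forall>s\<in>cells D. fst p = fst q \<longrightarrow>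
     (\<Sum>Z | Z \<in> BB \<and> gamma scale BB (C q) (C s) Z \<noteq> 0. of_int (gamma scale BB (C q) (C s) Z) * rep (a * Z) (C p)) =
     (\<Sum>W | rep (a * C q) W \<noteq> 0. rep (a * C q) W * of_int (gamma scale BB W (C s) (C p))))"

context
  fixes D :: "('l, 'g, 'm, 'a) table_tuple" and C
  assumes DC: "indexing D C"
    and gam: "\<And>p q r. p \<in> cells D \<Longrightarrow> q \<in> cells D \<Longrightarrow> r \<in> cells D \<Longrightarrow>
      gamma scale BB (C p) (C q) (C r) = cell_kappa D p q r"
begin

text \<open>The asymptotic product stays in row S and column V of the cell, so its support is
  indexed by basis elements of the table algebra.\<close>

lemma gamma_sum_left:
  assumes q: "(l, S, b, T) \<in> cells D" and s: "(l, T, b', V) \<in> cells D"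
  shows "(\<Sum>Z | Z \<in> BB \<and> gamma scale BB (C (l, S, b, T)) (C (l, T, b', V)) Z \<noteq> 0.
      of_int (gamma scale BB (C (l, S, b, T)) (C (l, T, b', V)) Z) * h Z) =
    (\<Sum>c | kappa (Gam D l) (Bas D l) c (b \<otimes>\<^bsub>Gam D l\<^esub> b') \<noteq> 0.
      of_int (kappa (Gam D l) (Bas D l) c (b \<otimes>\<^bsub>Gam D l\<^esub> b')) * (h (C (l, S, c, V)) :: laurent))"
proof -
  have l: "l \<in> Lam D" using q by simp
  note t = table_familyD[OF indexing_family[OF DC] l]
  interpret R: ring "Gam D l" by (rule t(4))
  define K where "K c = kappa (Gam D l) (Bas D l) c (b \<otimes>\<^bsub>Gam D l\<^esub> b')" for c
  have "b \<otimes>\<^bsub>Gam D l\<^esub> b' \<in> carrier (Gam D l)" using q s t(7) by auto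
  then have cB: "c \<in> Bas D l" if "K c \<noteq> 0" for c
    using kappa_nonzero_in[OF t(5)] that unfolding K_def by blast
  then have cc: "(l, S, c, V) \<in> cells D" if "K c \<noteq> 0" for c
    using q s that by simp
  have g: "gamma scale BB (C (l, S, b, T)) (C (l, T, b', V)) (C (l, S, c, V)) = K c" if "c \<in> Bas D l" for c
    using gam[OF q s, of "(l, S, c, V)"] q s that by (simp add: K_def cell_kappa_simp)
  have img: "{Z. Z \<in> BB \<and> gamma scale BB (C (l, S, b, T)) (C (l, T, b', V)) Z \<noteq> 0} = (\<lambda>c. C (l, S, c, V)) ` {c. K c \<noteq> 0}"
  proof (intro equalityI subsetI)
    fix Z assume Z: "Z \<in> {Z. Z \<in> BB \<and> gamma scale BB (C (l, S, b, T)) (C (l, T, b', V)) Z \<noteq> 0}"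
    then obtain r where r: "r \<in> cells D" "Z = C r" using indexing_surj[OF DC] by blast
    obtain k X c Y where r': "r = (k, X, c, Y)" by (cases r)
    have "k = l \<and> X = S \<and> Y = V \<and> K c \<noteq> 0"
      using Z gam[OF q s r(1)] unfolding r(2) r' by (auto simp: K_def cell_kappa_simp split: if_splits)
    then show "Z \<in> (\<lambda>c. C (l, S, c, V)) ` {c. K c \<noteq> 0}" unfolding r(2) r' by auto
  next
    fix Z assume "Z \<in> (\<lambda>c. C (l, S, c, V)) ` {c. K c \<noteq> 0}"
    then show "Z \<in> {Z. Z \<in> BB \<and> gamma scale BB (C (l, S, b, T)) (C (l, T, b', V)) Z \<noteq> 0}"
      using g cB cc indexing_in[OF DC] by auto
  qed
  have inj: "inj_on (\<lambda>c. C (l, S, c, V)) {c. K c \<noteq> 0}"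
    by (rule inj_onI) (use indexing_eq[OF DC] cc in auto)
  show ?thesis
    unfolding img sum.reindex[OF inj] K_def[symmetric]
    by (rule sum.cong) (use g cB in auto)
qed

text \<open>Only elements of the cell with row X and column T can contribute to row X after right
  multiplication by an element of row T; all other coordinates of \<open>x\<close> drop out.\<close>

lemma gamma_sum_right:
  assumes s: "(l, T, b', V) \<in> cells D" and p: "(l, X, c, Y) \<in> cells D"
  shows "(\<Sum>W | rep x W \<noteq> 0. rep x W * of_int (gamma scale BB W (C (l, T, b', V)) (C (l, X, c, Y)))) =
    (if Y = V then \<Sum>d | d \<in> Bas D l \<and> rep x (C (l, X, d, T)) \<noteq> 0.
      rep x (C (l, X, d, T)) * of_int (kappa (Gam D l) (Bas D l) c (d \<otimes>\<^bsub>Gam D l\<^esub> b')) else 0)"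
proof -
  let ?F = "{d. d \<in> Bas D l \<and> rep x (C (l, X, d, T)) \<noteq> 0}"
  have dc: "(l, X, d, T) \<in> cells D" if "d \<in> ?F" for d using s p that by simp
  have inj: "inj_on (\<lambda>d. C (l, X, d, T)) ?F"
    by (rule inj_onI) (use indexing_eq[OF DC] dc in auto)
  have "(\<Sum>W | rep x W \<noteq> 0. rep x W * of_int (gamma scale BB W (C (l, T, b', V)) (C (l, X, c, Y)))) =
      (\<Sum>W \<in> (\<lambda>d. C (l, X, d, T)) ` ?F. rep x W * of_int (gamma scale BB W (C (l, T, b', V)) (C (l, X, c, Y))))"
  proof (rule sum.mono_neutral_right)
    show "\<forall>W\<in>{W. rep x W \<noteq> 0} - (\<lambda>d. C (l, X, d, T)) ` ?F.
        rep x W * of_int (gamma scale BB W (C (l, T, b', V)) (C (l, X, c, Y))) = 0"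
    proof
      fix W assume W: "W \<in> {W. rep x W \<noteq> 0} - (\<lambda>d. C (l, X, d, T)) ` ?F"
      then have "W \<in> BB" using representation_ne_zero by blast
      then obtain w where w: "w \<in> cells D" "W = C w" using indexing_surj[OF DC] by blast
      obtain k X' d T' where w': "w = (k, X', d, T')" by (cases w)
      have "\<not> (k = l \<and> X' = X \<and> T' = T)"
        using W w unfolding w' by auto
      then have "cell_kappa D w (l, T, b', V) (l, X, c, Y) = 0"
        unfolding w' by (auto simp: cell_kappa_simp)
      then show "rep x W * of_int (gamma scale BB W (C (l, T, b', V)) (C (l, X, c, Y))) = 0"
        using gam[OF w(1) s p] w(2) by simp
    qed
  qed (use finite_representation in auto)
  also have "\<dots> = (\<Sum>d\<in>?F. rep x (C (l, X, d, T)) * of_int (cell_kappa D (l, X, d, T) (l, T, b', V) (l, X, c, Y)))"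
    unfolding sum.reindex[OF inj] by (rule sum.cong) (use gam[OF dc s p] in auto)
  also have "\<dots> = (if Y = V then \<Sum>d\<in>?F.
      rep x (C (l, X, d, T)) * of_int (kappa (Gam D l) (Bas D l) c (d \<otimes>\<^bsub>Gam D l\<^esub> b')) else 0)"
    by (simp add: cell_kappa_simp)
  finally show ?thesis .
qed

text \<open>An endomorphism of a matrix ring as a right module over itself is left multiplication by
  a matrix. Here the endomorphism is the action of \<open>a\<close> cut down to a cell, and the
  matrix, over the scalar extension, is r_a. One direction is associativity, the other reads the
  matrix off the diagonal units.\<close>

lemma left_coeffs_iff_commutes:
  "(\<forall>l\<in>Lam D. \<forall>a. \<exists>r. left_coeffs D C a l r) \<longleftrightarrow> left_commutes D C"
proof
  assume L: "\<forall>l\<in>Lam D. \<forall>a. \<exists>r. left_coeffs D C a l r"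
  show "left_commutes D C"
    unfolding left_commutes_def
  proof (intro allI ballI impI)
    fix a p q s assume p: "p \<in> cells D" and q: "q \<in> cells D" and s: "s \<in> cells D" and pq: "fst p = fst q"
    obtain l S b T where q': "q = (l, S, b, T)" by (cases q)
    obtain X c Y where p': "p = (l, X, c, Y)" using pq q' by (cases p) auto
    obtain k U b' V where s': "s = (k, U, b', V)" by (cases s)
    have l: "l \<in> Lam D" using q q' by simp
    note t = table_familyD[OF indexing_family[OF DC] l]
    interpret R: ring "Gam D l" by (rule t(4))
    let ?k = "kappa (Gam D l) (Bas D l)"
    obtain r where r: "left_coeffs D C a l r" using L l by blast
    define f where "f = r X S"
    have i: "S \<in> Idx D l" "T \<in> Idx D l" "X \<in> Idx D l" "Y \<in> Idx D l" "b \<in> Bas D l" "c \<in> Bas D l"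
      using p q p' q' by auto
    have "f \<in> ext_carrier (Bas D l)" using r i unfolding left_coeffs_def f_def by simp
    then have f: "finite {d. f d \<noteq> 0}" "\<And>d. f d \<noteq> 0 \<Longrightarrow> d \<in> carrier (Gam D l)"
      using t(7) unfolding ext_carrier_def by auto
    have g: "rep (a * C (l, S, b, T)) (C (l, X, c, Y)) =
        (if Y = T then \<Sum>d | f d \<noteq> 0. f d * of_int (?k c (d \<otimes>\<^bsub>Gam D l\<^esub> b)) else 0)"
      if "b \<in> Bas D l" "c \<in> Bas D l" "T \<in> Idx D l" "Y \<in> Idx D l" for b c T Y
      using r that i(1,3) unfolding left_coeffs_def f_def by blast
    show "(\<Sum>Z | Z \<in> BB \<and> gamma scale BB (C q) (C s) Z \<noteq> 0. of_int (gamma scale BB (C q) (C s) Z) * rep (a * Z) (C p)) =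
       (\<Sum>W | rep (a * C q) W \<noteq> 0. rep (a * C q) W * of_int (gamma scale BB W (C s) (C p)))"
    \<comment> \<open>If the factors do not fit together, the left side is empty; the right side
      vanishes because the action of \<open>a\<close> inside the cell keeps the column T.\<close>
    proof (cases "k = l \<and> U = T")
      case False
      have "gamma scale BB (C q) (C s) Z = 0" if Z: "Z \<in> BB" for Z
      proof -
        obtain z where z: "z \<in> cells D" "Z = C z" using indexing_surj[OF DC Z] by blast
        then show ?thesis using gam[OF q s z(1)] False unfolding q' s' by (cases z) (auto simp: cell_kappa_simp)
      qed
      then have 0: "{Z. Z \<in> BB \<and> gamma scale BB (C q) (C s) Z \<noteq> 0} = {}" by blast
      have "rep (a * C q) W * of_int (gamma scale BB W (C s) (C p)) = 0" if W: "rep (a * C q) W \<noteq> 0" for W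
      proof -
        have "W \<in> BB" using representation_ne_zero[OF W] .
        then obtain w where w: "w \<in> cells D" "W = C w" using indexing_surj[OF DC] by blast
        obtain m X' d T' where w': "w = (m, X', d, T')" by (cases w)
        show ?thesis
        proof (cases "cell_kappa D w s p = 0")
          case True
          then show ?thesis using gam[OF w(1) s p] w(2) by simp
        next
          case nz: False
          then have "m = l" "k = l" "X' = X" "T' = U" 
            unfolding w' s' p' by (auto simp: cell_kappa_simp split: if_splits)
          then have "rep (a * C q) W = 0"
            using g[of b d T T'] False i w(1) unfolding q' w(2) w' by auto
          then show ?thesis by simp
        qed
      qed
      then show ?thesis unfolding 0 by simp
    next
      case True
      have b': "b' \<in> Bas D l" "V \<in> Idx D l" "b' \<in> carrier (Gam D l)" "b \<in> carrier (Gam D l)"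
        using s s' True i t(7) by auto
      have s2: "s = (l, T, b', V)" using s' True by simp
      have L: "(\<Sum>Z | Z \<in> BB \<and> gamma scale BB (C q) (C s) Z \<noteq> 0. of_int (gamma scale BB (C q) (C s) Z) * rep (a * Z) (C p)) =
          (\<Sum>c' | ?k c' (b \<otimes>\<^bsub>Gam D l\<^esub> b') \<noteq> 0. of_int (?k c' (b \<otimes>\<^bsub>Gam D l\<^esub> b')) * rep (a * C (l, S, c', V)) (C p))"
        unfolding q' s2 by (rule gamma_sum_left) (use q s q' s2 in auto)
      have R: "(\<Sum>W | rep (a * C q) W \<noteq> 0. rep (a * C q) W * of_int (gamma scale BB W (C s) (C p))) =
          (if Y = V then \<Sum>d | d \<in> Bas D l \<and> rep (a * C q) (C (l, X, d, T)) \<noteq> 0.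
            rep (a * C q) (C (l, X, d, T)) * of_int (?k c (d \<otimes>\<^bsub>Gam D l\<^esub> b')) else 0)"
        unfolding s2 p' by (rule gamma_sum_right) (use p s p' s2 in auto)
      define K where "K = {c'. ?k c' (b \<otimes>\<^bsub>Gam D l\<^esub> b') \<noteq> 0}"
      have K: "c' \<in> Bas D l" if "c' \<in> K" for c'
        using kappa_nonzero_in[OF t(5)] b' that unfolding K_def by auto
      show ?thesis
      proof (cases "Y = V")
        case False
        have "rep (a * C (l, S, c', V)) (C p) = 0" if "c' \<in> K" for c'
          using g[OF K[OF that] i(6) b'(2) i(4)] False unfolding p' by simp
        then show ?thesis unfolding L R K_def[symmetric] using False by simp
      next
        case True
        \<comment> \<open>The coordinate at \<open>c\<close> of f (b b') = (f b) b'. The left side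
          reaches it by expanding b b', the right side by expanding f b.\<close>
        let ?t = "\<Sum>d | f d \<noteq> 0. f d * of_int (?k c (d \<otimes>\<^bsub>Gam D l\<^esub> (b \<otimes>\<^bsub>Gam D l\<^esub> b')))"
        have "(\<Sum>c'\<in>K. of_int (?k c' (b \<otimes>\<^bsub>Gam D l\<^esub> b')) * rep (a * C (l, S, c', V)) (C p)) =
            (\<Sum>c'\<in>K. of_int (?k c' (b \<otimes>\<^bsub>Gam D l\<^esub> b')) * (\<Sum>d | f d \<noteq> 0. f d * of_int (?k c (d \<otimes>\<^bsub>Gam D l\<^esub> c'))))"
          by (rule sum.cong) (use g[OF K i(6) b'(2) i(4)] True p' in auto)
        also have "\<dots> = (\<Sum>d | f d \<noteq> 0. f d * of_int (\<Sum>c'\<in>K. ?k c' (b \<otimes>\<^bsub>Gam D l\<^esub> b') * ?k c (d \<otimes>\<^bsub>Gam D l\<^esub> c')))"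
          by (simp add: sum_distrib_left sum.swap[of _ K] algebra_simps)
        also have "\<dots> = ?t"
          by (rule sum.cong)
            (use f(2) b' kappa_mult_right[OF t(4,5), of _ "b \<otimes>\<^bsub>Gam D l\<^esub> b'" c] in \<open>auto simp: K_def\<close>)
        finally have Lt: "(\<Sum>c'\<in>K. of_int (?k c' (b \<otimes>\<^bsub>Gam D l\<^esub> b')) * rep (a * C (l, S, c', V)) (C p)) = ?t" .
        \<comment> \<open>A finite set that contains the supports of all the products d b; the
          support of the sum itself could be smaller because of cancellation and is unsuitable for
          interchanging sums.\<close>
        define F where "F = (\<Union>d\<in>{d. f d \<noteq> 0}. {e. ?k e (d \<otimes>\<^bsub>Gam D l\<^esub> b) \<noteq> 0})"
        have F: "finite F"
          unfolding F_def using f b' finite_kappa[OF t(5)] by (intro finite_UN_I) auto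
        have FB: "e \<in> Bas D l" if eF: "e \<in> F" for e
        proof -
          obtain d where "f d \<noteq> 0" "?k e (d \<otimes>\<^bsub>Gam D l\<^esub> b) \<noteq> 0" using eF unfolding F_def by blast
          then show ?thesis using kappa_nonzero_in[OF t(5), of "d \<otimes>\<^bsub>Gam D l\<^esub> b"] f(2) b' by simp
        qed
        have re: "rep (a * C q) (C (l, X, e, T)) = (\<Sum>d | f d \<noteq> 0. f d * of_int (?k e (d \<otimes>\<^bsub>Gam D l\<^esub> b)))"
          if "e \<in> Bas D l" for e
          using g[OF i(5) that i(2) i(2)] unfolding q' by simp
        have re0: "(\<Sum>d | f d \<noteq> 0. f d * of_int (?k e (d \<otimes>\<^bsub>Gam D l\<^esub> b))) = 0" if "e \<notin> F" for e
          by (rule sum.neutral) (use that in \<open>auto simp: F_def\<close>)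
        have "(\<Sum>e | e \<in> Bas D l \<and> rep (a * C q) (C (l, X, e, T)) \<noteq> 0.
            rep (a * C q) (C (l, X, e, T)) * of_int (?k c (e \<otimes>\<^bsub>Gam D l\<^esub> b'))) =
            (\<Sum>e\<in>F. rep (a * C q) (C (l, X, e, T)) * of_int (?k c (e \<otimes>\<^bsub>Gam D l\<^esub> b')))"
        proof (rule sum.mono_neutral_left[OF F])
          show "{e. e \<in> Bas D l \<and> rep (a * C q) (C (l, X, e, T)) \<noteq> 0} \<subseteq> F"
          proof
            fix e assume "e \<in> {e. e \<in> Bas D l \<and> rep (a * C q) (C (l, X, e, T)) \<noteq> 0}"
            then have "e \<in> Bas D l" "rep (a * C q) (C (l, X, e, T)) \<noteq> 0" by blast+
            then show "e \<in> F" using re[of e] re0[of e] by metis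
          qed
          show "\<forall>e\<in>F - {e. e \<in> Bas D l \<and> rep (a * C q) (C (l, X, e, T)) \<noteq> 0}.
              rep (a * C q) (C (l, X, e, T)) * of_int (?k c (e \<otimes>\<^bsub>Gam D l\<^esub> b')) = 0"
            using FB by simp
        qed
        also have "\<dots> = (\<Sum>e\<in>F. (\<Sum>d | f d \<noteq> 0. f d * of_int (?k e (d \<otimes>\<^bsub>Gam D l\<^esub> b))) * of_int (?k c (e \<otimes>\<^bsub>Gam D l\<^esub> b')))"
          by (rule sum.cong) (use re FB in auto)
        also have "\<dots> = (\<Sum>d | f d \<noteq> 0. f d * of_int (\<Sum>e\<in>F. ?k e (d \<otimes>\<^bsub>Gam D l\<^esub> b) * ?k c (e \<otimes>\<^bsub>Gam D l\<^esub> b')))"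
          unfolding sum_distrib_right of_int_sum sum_distrib_left of_int_mult
          by (subst sum.swap) (simp only: mult.assoc)
        also have "\<dots> = ?t"
        proof (rule sum.cong[OF refl])
          fix d assume "d \<in> {d. f d \<noteq> 0}"
          then have d: "f d \<noteq> 0" "d \<in> carrier (Gam D l)" using f by auto
          have "?k c (d \<otimes>\<^bsub>Gam D l\<^esub> (b \<otimes>\<^bsub>Gam D l\<^esub> b')) = ?k c ((d \<otimes>\<^bsub>Gam D l\<^esub> b) \<otimes>\<^bsub>Gam D l\<^esub> b')"
            using d b' by (simp add: R.m_assoc)
          also have "\<dots> = (\<Sum>e | ?k e (d \<otimes>\<^bsub>Gam D l\<^esub> b) \<noteq> 0. ?k e (d \<otimes>\<^bsub>Gam D l\<^esub> b) * ?k c (e \<otimes>\<^bsub>Gam D l\<^esub> b'))"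
            using kappa_mult_left[OF t(4,5)] d b' by simp
          also have "\<dots> = (\<Sum>e\<in>F. ?k e (d \<otimes>\<^bsub>Gam D l\<^esub> b) * ?k c (e \<otimes>\<^bsub>Gam D l\<^esub> b'))"
            by (rule sum.mono_neutral_left) (use F d in \<open>auto simp: F_def\<close>)
          finally show "f d * of_int (\<Sum>e\<in>F. ?k e (d \<otimes>\<^bsub>Gam D l\<^esub> b) * ?k c (e \<otimes>\<^bsub>Gam D l\<^esub> b')) =
              f d * of_int (?k c (d \<otimes>\<^bsub>Gam D l\<^esub> (b \<otimes>\<^bsub>Gam D l\<^esub> b')))" by simp
        qed
        finally show ?thesis unfolding L R K_def[symmetric] Lt using True by simp
      qed
    qed
  qed
next
  assume L: "left_commutes D C"
  show "\<forall>l\<in>Lam D. \<forall>a. \<exists>r. left_coeffs D C a l r"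
  proof (intro ballI allI)
    fix l a assume l: "l \<in> Lam D"
    note t = table_familyD[OF indexing_family[OF DC] l]
    interpret R: ring "Gam D l" by (rule t(4))
    let ?k = "kappa (Gam D l) (Bas D l)" and ?e = "\<one>\<^bsub>Gam D l\<^esub>"
    \<comment> \<open>The column S of \<open>a\<close> applied to the diagonal unit at S.\<close>
    define r where "r X S d = (if d \<in> Bas D l then rep (a * C (l, S, ?e, S)) (C (l, X, d, S)) else 0)" for X S d
    have supp: "{d. r X S d \<noteq> 0} = {d. d \<in> Bas D l \<and> rep (a * C (l, S, ?e, S)) (C (l, X, d, S)) \<noteq> 0}" for X S
      unfolding r_def by auto
    have "r X S \<in> ext_carrier (Bas D l)" if "X \<in> Idx D l" "S \<in> Idx D l" for X S
    proof -
      have "inj_on (\<lambda>d. C (l, X, d, S)) {d. r X S d \<noteq> 0}"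
        by (rule inj_onI) (use indexing_eq[OF DC] that l in \<open>auto simp: supp\<close>)
      moreover have "(\<lambda>d. C (l, X, d, S)) ` {d. r X S d \<noteq> 0} \<subseteq> {W. rep (a * C (l, S, ?e, S)) W \<noteq> 0}"
        unfolding supp by auto
      ultimately have "finite {d. r X S d \<noteq> 0}"
        using finite_representation by (meson finite_imageD finite_subset)
      then show ?thesis unfolding ext_carrier_def by (auto simp: supp)
    qed
    moreover have "rep (a * C (l, S, b, T)) (C (l, X, c, Y)) =
          (if Y = T then \<Sum>d | r X S d \<noteq> 0. r X S d * of_int (?k c (d \<otimes>\<^bsub>Gam D l\<^esub> b)) else 0)"
      if i: "S \<in> Idx D l" "T \<in> Idx D l" "X \<in> Idx D l" "Y \<in> Idx D l" "b \<in> Bas D l" "c \<in> Bas D l" for S T X Y b c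
    proof -
      have q: "(l, S, ?e, S) \<in> cells D" and s: "(l, S, b, T) \<in> cells D" and p: "(l, X, c, Y) \<in> cells D"
        using i l t(6) by auto
      have K: "{c'. ?k c' (?e \<otimes>\<^bsub>Gam D l\<^esub> b) \<noteq> 0} = {b}" and k1: "?k b (?e \<otimes>\<^bsub>Gam D l\<^esub> b) = 1"
        using kappa_table_algebra(1)[OF t(1) i(5)] by auto
      \<comment> \<open>C_{S,T}^b is its own asymptotic product with the diagonal unit at S, so the
        sum has a single term.\<close>
      have "rep (a * C (l, S, b, T)) (C (l, X, c, Y)) =
          (\<Sum>Z | Z \<in> BB \<and> gamma scale BB (C (l, S, ?e, S)) (C (l, S, b, T)) Z \<noteq> 0.
            of_int (gamma scale BB (C (l, S, ?e, S)) (C (l, S, b, T)) Z) * rep (a * Z) (C (l, X, c, Y)))"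
        unfolding gamma_sum_left[OF q s] K by (simp add: k1)
      also have "\<dots> = (\<Sum>W | rep (a * C (l, S, ?e, S)) W \<noteq> 0. rep (a * C (l, S, ?e, S)) W *
          of_int (gamma scale BB W (C (l, S, b, T)) (C (l, X, c, Y))))"
        by (rule L[unfolded left_commutes_def, rule_format, OF p q s]) simp
      also have "\<dots> = (if Y = T then \<Sum>d | r X S d \<noteq> 0. rep (a * C (l, S, ?e, S)) (C (l, X, d, S)) * of_int (?k c (d \<otimes>\<^bsub>Gam D l\<^esub> b)) else 0)"
        unfolding gamma_sum_right[OF s p] supp ..
      also have "\<dots> = (if Y = T then \<Sum>d | r X S d \<noteq> 0. r X S d * of_int (?k c (d \<otimes>\<^bsub>Gam D l\<^esub> b)) else 0)"
        by (auto simp: r_def intro!: sum.cong)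
      finally show ?thesis .
    qed
    ultimately have "left_coeffs D C a l r" unfolding left_coeffs_def by simp
    then show "\<exists>r. left_coeffs D C a l r" by (intro exI)
  qed
qed

end
end

section \<open>Comparison of parametrizations\<close>

lemma cells_leq_update [simp]: "cells (D\<lparr>leq := r\<rparr>) = cells D"
  by (simp add: cells_def)

lemma block_nonempty:
  assumes "table_family D" "l \<in> Lam D"
  shows "\<exists>p\<in>cells D. fst p = l"
proof -
  obtain S where "S \<in> Idx D l" using table_familyD(3)[OF assms] by blast
  then have "(l, S, \<one>\<^bsub>Gam D l\<^esub>, S) \<in> cells D" using assms table_familyD(6)[OF assms] by simp
  then show ?thesis by (rule rev_bexI) simp
qed

context laurent_basis
begin

lemma datum_mapsD:
  assumes "C \<in> datum_maps scale \<tau> BB D"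
  shows "indexing D C" "C ` cells D = BB" "axiom_A1 scale D C" "axiom_A2 scale D C" "axiom_A3 scale D C"
    "axiom_A4 scale D C" "axiom_A5 scale \<tau> D C" "reduced_datum scale D C" "table_datum scale D C"
    "table_family D"
    "\<And>p q r. p \<in> cells D \<Longrightarrow> q \<in> cells D \<Longrightarrow> r \<in> cells D \<Longrightarrow>
      gamma scale BB (C p) (C q) (C r) = cell_kappa D p q r"
proof -
  show d: "C ` cells D = BB" "axiom_A1 scale D C" "axiom_A2 scale D C" "axiom_A3 scale D C"
    "axiom_A4 scale D C" "axiom_A5 scale \<tau> D C" "reduced_datum scale D C" "table_datum scale D C"
    using assms unfolding datum_maps_def reduced_datum_with_trace_def reduced_datum_def table_datum_def by auto
  show i: "indexing D C"
    using d(1,2) unfolding indexing_def axiom_A1_def table_family_def bij_betw_def by blast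
  then show "table_family D" unfolding indexing_def by blast
  show "\<And>p q r. p \<in> cells D \<Longrightarrow> q \<in> cells D \<Longrightarrow> r \<in> cells D \<Longrightarrow>
      gamma scale BB (C p) (C q) (C r) = cell_kappa D p q r"
    using gamma_eq_cell_kappa[OF i d(5) d(3,4)] .
qed

text \<open>The order enters only through its own axioms in (A1) and through triangularity, so a
  change of order leaves all other conditions intact.\<close>

lemma table_datum_leq_update:
  assumes DC: "indexing D C" and T: "table_datum scale D C"
  shows "table_datum scale (D\<lparr>leq := r\<rparr>) C \<longleftrightarrow> partial_order_on (Lam D) r \<and> left_triangular D C r"
proof -
  have DC': "indexing (D\<lparr>leq := r\<rparr>) C" using DC by (simp add: indexing_def table_family_def)
  have A1: "axiom_A1 scale (D\<lparr>leq := r\<rparr>) C \<longleftrightarrow> partial_order_on (Lam D) r"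
    using T unfolding table_datum_def axiom_A1_def by simp
  have A2: "axiom_A2 scale (D\<lparr>leq := r\<rparr>) C"
    using T unfolding table_datum_def axiom_A2_def by simp
  have "left_coeffs (D\<lparr>leq := r\<rparr>) C = left_coeffs D C"
    unfolding left_coeffs_def by (intro ext) simp
  moreover have "left_triangular (D\<lparr>leq := r\<rparr>) C r' = left_triangular D C r'" for r'
    unfolding left_triangular_def by simp
  moreover have "\<forall>l\<in>Lam D. \<forall>a. \<exists>q. left_coeffs D C a l q"
    using T axiom_A3_iff[OF DC] unfolding table_datum_def by blast
  ultimately have "axiom_A3 scale (D\<lparr>leq := r\<rparr>) C \<longleftrightarrow> left_triangular D C r"
    unfolding axiom_A3_iff[OF DC'] by simp
  then show ?thesis unfolding table_datum_def using A1 A2 by simp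
qed

definition reach :: "('l, 'g, 'm, 'a) table_tuple \<Rightarrow> (('l, 'g, 'm) cell_index \<Rightarrow> 'a) \<Rightarrow> ('l \<times> 'l) set" where
  "reach D C = {(fst p, fst q) | p q a. p \<in> cells D \<and> q \<in> cells D \<and> rep (a * C q) (C p) \<noteq> 0}"

text \<open>The closure of \<open>reach D C\<close>, cut down to the given order, still satisfies (A3), so reducedness
  excludes any further relation.\<close>

lemma reduced_leq:
  assumes DC: "indexing D C" and red: "reduced_datum scale D C"
  shows "leq D \<subseteq> (reach D C)\<^sup>*"
proof -
  have T: "table_datum scale D C" using red unfolding reduced_datum_def by blast
  have po: "partial_order_on (Lam D) (leq D)"
    using T unfolding table_datum_def axiom_A1_def by blast
  note po' = partial_order_onD[OF po]
  define r where "r = (reach D C)\<^sup>* \<inter> leq D"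
  have "antisym r" "r \<subseteq> Lam D \<times> Lam D" using po'(3,4) unfolding r_def antisym_def by blast+
  moreover have "refl_on (Lam D) r" using po'(1) unfolding r_def refl_on_def by blast
  moreover have "trans r" using po'(2) unfolding r_def trans_def by (blast intro: rtrancl_trans)
  ultimately have "partial_order_on (Lam D) r"
    unfolding partial_order_on_def preorder_on_def by blast
  moreover have "left_triangular D C r"
    using T unfolding table_datum_def axiom_A3_iff[OF DC] left_triangular_def r_def reach_def
    by (blast intro: r_into_rtrancl)
  ultimately have "table_datum scale (D\<lparr>leq := r\<rparr>) C"
    using table_datum_leq_update[OF DC T] by blast
  then have "\<not> r \<subset> leq D" using red unfolding reduced_datum_def by blast
  then show ?thesis unfolding r_def by blast
qed

text \<open>A reduced order is generated by steps of \<open>reach\<close>, and each step is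
  witnessed by an element of the algebra. The same witness, seen through \<open>C'\<close>, puts the
  step into any order \<open>r\<close> that is triangular for \<open>C'\<close>. With
  \<open>r\<close> the order of \<open>D'\<close> this compares two data; with a smaller
  \<open>r\<close> it proves reducedness.\<close>

lemma leq_transport:
  assumes DC: "indexing D C" and red: "reduced_datum scale D C"
    and DC': "indexing D' C'"
    and \<sigma>: "\<And>p. p \<in> cells D \<Longrightarrow> \<sigma> p \<in> cells D' \<and> C' (\<sigma> p) = C p"
    and block: "\<And>p q. p \<in> cells D \<Longrightarrow> q \<in> cells D \<Longrightarrow> fst p = fst q \<Longrightarrow> fst (\<sigma> p) = fst (\<sigma> q)"
    and po: "partial_order_on (Lam D') r" and tri: "left_triangular D' C' r"
    and p: "p \<in> cells D" and q: "q \<in> cells D" and pq: "(fst p, fst q) \<in> leq D"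
  shows "(fst (\<sigma> p), fst (\<sigma> q)) \<in> r"
proof -
  note po' = partial_order_onD[OF po]
  have refl: "(fst (\<sigma> p), fst (\<sigma> p)) \<in> r" if "p \<in> cells D" for p
    using po'(1) fst_cells \<sigma>[OF that] unfolding refl_on_def by blast
  have "(fst p, fst q) \<in> (reach D C)\<^sup>*" using reduced_leq[OF DC red] pq by blast
  \<comment> \<open>Consecutive steps may use different elements of the same cell, so the induction
    runs over all representatives of the end point.\<close>
  then have "\<forall>q\<in>cells D. fst q = l \<longrightarrow> (fst (\<sigma> p), fst (\<sigma> q)) \<in> r" if "l = fst q" for l
    unfolding that
  proof (induction rule: rtrancl_induct)
    case base
    then show ?case using block[OF p] refl[OF p] by metis
  next
    case (step k l)
    then obtain p1 q1 a where s: "p1 \<in> cells D" "q1 \<in> cells D" "k = fst p1" "l = fst q1" "rep (a * C q1) (C p1) \<noteq> 0"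
      unfolding reach_def by blast
    have "(fst (\<sigma> p), fst (\<sigma> p1)) \<in> r" using step.IH s by blast
    moreover have "(fst (\<sigma> p1), fst (\<sigma> q1)) \<in> r"
      using tri s(5) \<sigma>[OF s(1)] \<sigma>[OF s(2)] refl[OF s(1)] unfolding left_triangular_def by metis
    ultimately have "(fst (\<sigma> p), fst (\<sigma> q1)) \<in> r" using po'(2) by (meson transD)
    then show ?case using block[OF s(2)] s(4) by metis
  qed
  then show ?thesis using q by blast
qed

text \<open>The normalization clause comes for free: 1 occurs in the product of 1 and 1 with
  coefficient 1.\<close>

lemma axiom_A4I:
  assumes D: "table_family D" and img: "C ` cells D = BB" and a: "a_defined scale BB"
    and iff: "\<And>p q r. p \<in> cells D \<Longrightarrow> q \<in> cells D \<Longrightarrow> r \<in> cells D \<Longrightarrow>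
      g_const C p q r \<noteq> 0 \<and> laurent_deg (g_const C p q r) = a_fun scale BB (C r) \<longleftrightarrow> cell_kappa D p q r \<noteq> 0"
    and gam: "\<And>p q r. p \<in> cells D \<Longrightarrow> q \<in> cells D \<Longrightarrow> r \<in> cells D \<Longrightarrow>
      gamma scale BB (C p) (C q) (C r) = cell_kappa D p q r"
  shows "axiom_A4 scale D C"
  unfolding axiom_A4_def Let_def img Ball_def split_paired_All prod.case
proof (intro conjI[OF a[unfolded Ball_def]] allI impI)
  fix l S b T l' U b' V l'' X b'' Y
  assume p: "(l, S, b, T) \<in> cells D" and q: "(l', U, b', V) \<in> cells D" and r: "(l'', X, b'', Y) \<in> cells D"
  let ?m = "l = l' \<and> l' = l'' \<and> X = S \<and> T = U \<and> Y = V \<and>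
    kappa (Gam D l) (Bas D l) b'' (b \<otimes>\<^bsub>Gam D l\<^esub> b') \<noteq> 0"
  have m: "cell_kappa D (l, S, b, T) (l', U, b', V) (l'', X, b'', Y) \<noteq> 0 \<longleftrightarrow> ?m"
    unfolding cell_kappa_simp if_split[of "\<lambda>x. x \<noteq> 0"] by blast
  have l: "l \<in> Lam D" using p by simp
  note t = table_familyD[OF D l]
  have "gamma scale BB (C (l, S, b, T)) (C (l', U, b', V)) (C (l'', X, b'', Y)) = 1"
    if "?m" "b = \<one>\<^bsub>Gam D l\<^esub>" "b' = \<one>\<^bsub>Gam D l\<^esub>" "b'' = \<one>\<^bsub>Gam D l\<^esub>"
    unfolding gam[OF p q r] using that kappa_table_algebra(1)[OF t(1,6)] by (simp add: cell_kappa_simp)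
  then show "(g_const C (l, S, b, T) (l', U, b', V) (l'', X, b'', Y) \<noteq> 0 \<and>
      laurent_deg (g_const C (l, S, b, T) (l', U, b', V) (l'', X, b'', Y)) = a_fun scale BB (C (l'', X, b'', Y)) \<longleftrightarrow> ?m) \<and>
      (?m \<and> b = \<one>\<^bsub>Gam D l\<^esub> \<and> b' = \<one>\<^bsub>Gam D l\<^esub> \<and> b'' = \<one>\<^bsub>Gam D l\<^esub> \<longrightarrow>
        gamma scale BB (C (l, S, b, T)) (C (l', U, b', V)) (C (l'', X, b'', Y)) = 1)"
    using iff[OF p q r] m by blast
qed

text \<open>Both families of structure constants are leading coefficients for the same basis
  \<open>BB\<close>, and the map matches indices of equal basis elements.\<close>

lemma compare_datum_maps:
  assumes C: "C \<in> datum_maps scale \<tau> BB D" and C': "C' \<in> datum_maps scale \<tau> BB D'"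
    and \<sigma>_def: "\<sigma> = compose (cells D) (inv_into (cells D') C') C"
  shows "bij_betw \<sigma> (cells D) (cells D')"
    "\<And>p. p \<in> cells D \<Longrightarrow> C' (\<sigma> p) = C p"
    "\<And>p q r. p \<in> cells D \<Longrightarrow> q \<in> cells D \<Longrightarrow> r \<in> cells D \<Longrightarrow>
      cell_kappa D' (\<sigma> p) (\<sigma> q) (\<sigma> r) = cell_kappa D p q r"
proof -
  have b: "bij_betw C (cells D) BB" "bij_betw C' (cells D') BB"
    using datum_mapsD(1)[OF C] datum_mapsD(1)[OF C'] unfolding indexing_def by auto
  show bij: "bij_betw \<sigma> (cells D) (cells D')"
    using bij_betw_trans[OF b(1) bij_betw_inv_into[OF b(2)]] unfolding \<sigma>_def
    by (simp add: compose_def cong: bij_betw_cong)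
  show eq: "C' (\<sigma> p) = C p" if "p \<in> cells D" for p
  proof -
    have "C p \<in> C' ` cells D'" using b that unfolding bij_betw_def by blast
    then show ?thesis using that unfolding \<sigma>_def by (simp add: compose_def f_inv_into_f)
  qed
  fix p q r assume pqr: "p \<in> cells D" "q \<in> cells D" "r \<in> cells D"
  then have "\<sigma> p \<in> cells D'" "\<sigma> q \<in> cells D'" "\<sigma> r \<in> cells D'" using bij_betw_apply[OF bij] by auto
  then show "cell_kappa D' (\<sigma> p) (\<sigma> q) (\<sigma> r) = cell_kappa D p q r"
    using datum_mapsD(11)[OF C] datum_mapsD(11)[OF C'] eq pqr by metis
qed

lemma cell_iso_of_datum_maps:
  assumes C: "C \<in> datum_maps scale \<tau> BB D" and C': "C' \<in> datum_maps scale \<tau> BB D'"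
  shows "cell_iso D D' (compose (cells D) (inv_into (cells D') C') C)"
proof -
  define \<sigma> where "\<sigma> = compose (cells D) (inv_into (cells D') C') C"
  define \<rho> where "\<rho> = compose (cells D') (inv_into (cells D) C) C'"
  note s = compare_datum_maps[OF C C' \<sigma>_def] and r = compare_datum_maps[OF C' C \<rho>_def]
  note d = datum_mapsD[OF C] and d' = datum_mapsD[OF C']
  \<comment> \<open>Stated for arbitrary data so that it applies to the map and to its inverse; the
    two inclusions give the equivalence of the orders.\<close>
  have mono: "(fst (\<sigma> p), fst (\<sigma> q)) \<in> leq D'"
    if C: "C \<in> datum_maps scale \<tau> BB D" and C': "C' \<in> datum_maps scale \<tau> BB D'"
      and \<sigma>: "\<sigma> = compose (cells D) (inv_into (cells D') C') C"
      and pq: "p \<in> cells D" "q \<in> cells D" "(fst p, fst q) \<in> leq D"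
    for C C' p q and \<sigma> :: "('l, 'g, 'm) cell_index \<Rightarrow> ('l, 'g, 'm) cell_index" and D D' :: "('l, 'g, 'm, 'a) table_tuple"
  proof (rule leq_transport[OF datum_mapsD(1,8)[OF C] datum_mapsD(1)[OF C'] _ _ _ _ pq])
    note s = compare_datum_maps[OF C C' \<sigma>]
    show "\<And>p. p \<in> cells D \<Longrightarrow> \<sigma> p \<in> cells D' \<and> C' (\<sigma> p) = C p"
      using s bij_betw_apply by fast
    show "\<And>p q. p \<in> cells D \<Longrightarrow> q \<in> cells D \<Longrightarrow> fst p = fst q \<Longrightarrow> fst (\<sigma> p) = fst (\<sigma> q)"
      using same_block_transport[OF datum_mapsD(10)[OF C] datum_mapsD(10)[OF C'] s(1,3)] by blast
    show "partial_order_on (Lam D') (leq D')"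
      using datum_mapsD(3)[OF C'] unfolding axiom_A1_def by blast
    show "left_triangular D' C' (leq D')"
      using datum_mapsD(5)[OF C'] axiom_A3_iff[OF datum_mapsD(1)[OF C']] by blast
  qed
  have \<rho>\<sigma>: "\<rho> (\<sigma> p) = p" if "p \<in> cells D" for p
    using r(2)[OF bij_betw_apply[OF s(1) that]] s(2)[OF that] indexing_eq[OF d(1)]
      bij_betw_apply[OF r(1) bij_betw_apply[OF s(1) that]] that by metis
  have "(fst p, fst q) \<in> leq D \<longleftrightarrow> (fst (\<sigma> p), fst (\<sigma> q)) \<in> leq D'" if "p \<in> cells D" "q \<in> cells D" for p q
    using mono[OF C C' \<sigma>_def that]
      mono[OF C' C \<rho>_def bij_betw_apply[OF s(1) that(1)] bij_betw_apply[OF s(1) that(2)]] \<rho>\<sigma> that by auto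
  then show ?thesis
    unfolding cell_iso_def \<sigma>_def[symmetric] using s by (auto simp: \<sigma>_def compose_def)
qed

text \<open>The given \<open>C0\<close> supplies whatever concerns \<open>D'\<close> and the set
  \<open>BB\<close> alone: the table algebras, the partial order, the idempotents, and the laws of
  \<open>star D'\<close> and of the trace. What depends on the parametrization is carried over from
  \<open>C\<close>.\<close>

lemma cell_iso_datum_maps:
  assumes C: "C \<in> datum_maps scale \<tau> BB D" and C0: "C0 \<in> datum_maps scale \<tau> BB D'"
    and iso: "cell_iso D D' \<sigma>"
  defines "C' \<equiv> \<lambda>p. C (inv_into (cells D) \<sigma> p)"
  shows "C' \<in> datum_maps scale \<tau> BB D'"
proof -
  note d = datum_mapsD[OF C] and d0 = datum_mapsD[OF C0]
  have bij: "bij_betw \<sigma> (cells D) (cells D')"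
    and kap: "\<And>p q r. p \<in> cells D \<Longrightarrow> q \<in> cells D \<Longrightarrow> r \<in> cells D \<Longrightarrow>
      cell_kappa D' (\<sigma> p) (\<sigma> q) (\<sigma> r) = cell_kappa D p q r"
    and leq: "\<And>p q. p \<in> cells D \<Longrightarrow> q \<in> cells D \<Longrightarrow>
      (fst p, fst q) \<in> leq D \<longleftrightarrow> (fst (\<sigma> p), fst (\<sigma> q)) \<in> leq D'"
    using iso unfolding cell_iso_def by auto
  note tr = d(10) d0(10) bij kap
  have img: "cells D' = \<sigma> ` cells D" using bij unfolding bij_betw_def by blast
  have \<sigma>in: "\<sigma> p \<in> cells D'" if "p \<in> cells D" for p using img that by blast
  have C'\<sigma>: "C' (\<sigma> p) = C p" if "p \<in> cells D" for p
    using bij that unfolding C'_def bij_betw_def by (simp add: inv_into_f_f)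
  have bC: "bij_betw C (cells D) BB" using d(1) unfolding indexing_def by blast
  have bC': "bij_betw C' (cells D') BB"
    using bij_betw_trans[OF bij_betw_inv_into[OF bij] bC] unfolding C'_def comp_def .
  then have DC': "indexing D' C'" using d0(10) unfolding indexing_def by blast
  have C'img: "C' ` cells D' = BB" using bC' unfolding bij_betw_def by blast
  have gam': "gamma scale BB (C' p) (C' q) (C' r) = cell_kappa D' p q r"
    if "p \<in> cells D'" "q \<in> cells D'" "r \<in> cells D'" for p q r
    using that kap d(11) unfolding img by (auto simp: C'\<sigma>)
  have A1: "axiom_A1 scale D' C'"
    using d0(3) bC' unfolding axiom_A1_def C'img d0(2) bij_betw_def by blast
  \<comment> \<open>\<open>star D\<close> and \<open>star D'\<close> are different components of the
    two tuples; comparing \<open>C\<close> with \<open>C0\<close> shows that they agree on the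
    basis, since both are determined by the leading coefficients.\<close>
  have star: "star D' (C p) = C (cell_star D p)" if p: "p \<in> cells D" for p
  proof -
    define \<rho> where "\<rho> = compose (cells D) (inv_into (cells D') C0) C"
    note r = compare_datum_maps[OF C C0 \<rho>_def]
    have "star D' (C p) = star D' (C0 (\<rho> p))" using r(2)[OF p] by simp
    also have "\<dots> = C0 (cell_star D' (\<rho> p))"
      using star_C[OF d0(1,6,4,5)] bij_betw_apply[OF r(1) p] by blast
    also have "\<dots> = C0 (\<rho> (cell_star D p))"
      using cell_star_transport[OF d(10) d0(10) r(1,3)] p by simp
    also have "\<dots> = C (cell_star D p)" using r(2) cell_star_in(1)[OF d(10) p] by blast
    finally show ?thesis .
  qed
  have star': "star D' (C' p) = C' (cell_star D' p)" if p: "p \<in> cells D'" for p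
  proof -
    obtain q where q: "q \<in> cells D" "p = \<sigma> q" using p img by blast
    have "star D' (C' p) = C (cell_star D q)" unfolding q(2) C'\<sigma>[OF q(1)] by (rule star[OF q(1)])
    also have "\<dots> = C' (\<sigma> (cell_star D q))" using C'\<sigma>[OF cell_star_in(1)[OF d(10) q(1)]] by simp
    also have "\<dots> = C' (cell_star D' p)" unfolding q(2) using cell_star_transport[OF tr q(1)] by simp
    finally show ?thesis .
  qed
  have A2: "axiom_A2 scale D' C'"
    using d0(4) star' unfolding axiom_A2_def by (auto simp: cell_star_simp)
  have block: "fst (\<sigma> p) = fst (\<sigma> q) \<longleftrightarrow> fst p = fst q" if "p \<in> cells D" "q \<in> cells D" for p q
    using same_block_transport[OF tr that] .
  have tri: "left_triangular D' C' (leq D')"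
    using d(5) leq block unfolding axiom_A3_iff[OF d(1)] left_triangular_def img
    by (auto simp: C'\<sigma>)
  \<comment> \<open>The detour around r_a: this condition mentions only basis elements and cells,
    both of which are matched, and it yields new coefficients for \<open>D'\<close>.\<close>
  have com: "left_commutes D C"
    using d(5) axiom_A3_iff[OF d(1)] left_coeffs_iff_commutes[OF d(1,11)] by blast
  have "left_commutes D' C'"
    unfolding left_commutes_def
  proof (intro allI ballI impI)
    fix a p' q' s' assume "p' \<in> cells D'" "q' \<in> cells D'" "s' \<in> cells D'" and eq: "fst p' = fst q'"
    then obtain p q s where pqs: "p \<in> cells D" "q \<in> cells D" "s \<in> cells D" "p' = \<sigma> p" "q' = \<sigma> q" "s' = \<sigma> s"
      using img by blast
    have "fst p = fst q" using eq block pqs by blast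
    then show "(\<Sum>Z | Z \<in> BB \<and> gamma scale BB (C' q') (C' s') Z \<noteq> 0. of_int (gamma scale BB (C' q') (C' s') Z) * rep (a * Z) (C' p')) =
     (\<Sum>W | rep (a * C' q') W \<noteq> 0. rep (a * C' q') W * of_int (gamma scale BB W (C' s') (C' p')))"
      unfolding pqs C'\<sigma>[OF pqs(1)] C'\<sigma>[OF pqs(2)] C'\<sigma>[OF pqs(3)]
      using com pqs(1-3) unfolding left_commutes_def by blast
  qed
  then have A3: "axiom_A3 scale D' C'"
    using axiom_A3_iff[OF DC'] tri left_coeffs_iff_commutes[OF DC' gam'] by blast
  have T: "table_datum scale D' C'" unfolding table_datum_def using A1 A2 A3 by blast
  have red: "reduced_datum scale D' C'"
    unfolding reduced_datum_def
  proof (intro conjI notI)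
    assume "\<exists>r. r \<subset> leq D' \<and> table_datum scale (D'\<lparr>leq := r\<rparr>) C'"
    then obtain r where r: "r \<subset> leq D'" "table_datum scale (D'\<lparr>leq := r\<rparr>) C'" by blast
    then have po: "partial_order_on (Lam D') r" and tri: "left_triangular D' C' r"
      using table_datum_leq_update[OF DC' T] by auto
    have po0: "partial_order_on (Lam D') (leq D')" using A1 unfolding axiom_A1_def by blast
    \<comment> \<open>Pulled back to \<open>D\<close>, the order of \<open>D'\<close> is the reduced
      order of \<open>D\<close>, which embeds into every admissible order.\<close>
    have "leq D' \<subseteq> r"
    proof
      fix x assume x: "x \<in> leq D'"
      obtain k l where kl: "x = (k, l)" by (cases x)
      have "k \<in> Lam D'" "l \<in> Lam D'" using partial_order_onD(4)[OF po0] x kl by auto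
      then obtain p' q' where "p' \<in> cells D'" "q' \<in> cells D'" and f: "fst p' = k" "fst q' = l"
        using block_nonempty[OF d0(10)] by metis
      then obtain p q where pq: "p \<in> cells D" "q \<in> cells D" "p' = \<sigma> p" "q' = \<sigma> q" using img by blast
      have "(fst p, fst q) \<in> leq D" using leq[OF pq(1,2)] x kl f pq by simp
      then have "(fst (\<sigma> p), fst (\<sigma> q)) \<in> r"
        using leq_transport[OF d(1,8) DC' _ _ po tri pq(1,2), of \<sigma>] \<sigma>in C'\<sigma> block by blast
      then show "x \<in> r" using kl f pq by simp
    qed
    then show False using r(1) by blast
  qed (rule T)
  have A4: "axiom_A4 scale D' C'"
  proof (rule axiom_A4I[OF d0(10) C'img _ _ gam'])
    show "a_defined scale BB"
      using d(6) unfolding axiom_A4_def Let_def d(2) by blast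
    fix p' q' r' assume "p' \<in> cells D'" "q' \<in> cells D'" "r' \<in> cells D'"
    then obtain p q r where pqr: "p \<in> cells D" "q \<in> cells D" "r \<in> cells D" "p' = \<sigma> p" "q' = \<sigma> q" "r' = \<sigma> r"
      using img by blast
    then show "g_const C' p' q' r' \<noteq> 0 \<and> laurent_deg (g_const C' p' q' r') = a_fun scale BB (C' r') \<longleftrightarrow>
        cell_kappa D' p' q' r' \<noteq> 0"
      using axiom_A4_cell_kappa[OF d(1,6) pqr(1-3)] kap[OF pqr(1-3)] by (simp add: C'\<sigma>)
  qed
  have A5: "axiom_A5 scale \<tau> D' C'"
  proof -
    \<comment> \<open>The condition S = T and b = 1 is replaced by \<open>cell_unit\<close>, which
      is transported.\<close>
    have "\<forall>p\<in>cells D'. \<tau> (scale (v_pow (a_fun scale BB (C' p))) (C' p)) - (if cell_unit D' p then 1 else 0) \<in> vinv_Aminus"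
    proof
      fix p' assume "p' \<in> cells D'"
      then obtain p where p: "p \<in> cells D" "p' = \<sigma> p" using img by blast
      obtain l S b T where p': "p = (l, S, b, T)" by (cases p)
      note 5 = d(7)[unfolded axiom_A5_def d(2), THEN conjunct2, THEN conjunct2, THEN conjunct2]
      have "\<tau> (scale (v_pow (a_fun scale BB (C p))) (C p)) - (if cell_unit D p then 1 else 0) \<in> vinv_Aminus"
        using bspec[OF 5 p(1)] cell_unit_iff[OF d(10) p(1)[unfolded p']] unfolding p' prod.case by simp
      then show "\<tau> (scale (v_pow (a_fun scale BB (C' p'))) (C' p')) - (if cell_unit D' p' then 1 else 0) \<in> vinv_Aminus"
        using cell_unit_transport[OF tr p(1)] C'\<sigma>[OF p(1)] p(2) by simp
    qed
    then have "\<forall>(l, S, b, T)\<in>cells D'. \<tau> (scale (v_pow (a_fun scale BB (C' (l, S, b, T)))) (C' (l, S, b, T)))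
        - (if S = T \<and> b = \<one>\<^bsub>Gam D' l\<^esub> then 1 else 0) \<in> vinv_Aminus"
      by (auto simp: cell_unit_iff[OF d0(10)])
    then show ?thesis using d0(7) unfolding axiom_A5_def C'img d0(2) by blast
  qed
  show ?thesis
    unfolding datum_maps_def reduced_datum_with_trace_def using red A4 A5 C'img by blast
qed

end

section \<open>Matrix units and isomorphisms of based posets\<close>

lemma cell_iso_id:
  "cell_iso D D (\<lambda>p\<in>cells D. p)"
  unfolding cell_iso_def by (simp add: bij_betw_def inj_on_def)

lemma cell_iso_compose:
  assumes \<sigma>: "cell_iso D D' \<sigma>" and \<rho>: "cell_iso D' D'' \<rho>"
  shows "cell_iso D D'' (compose (cells D) \<rho> \<sigma>)"
proof -
  have s: "\<sigma> p \<in> cells D'" if "p \<in> cells D" for p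
    using \<sigma> that unfolding cell_iso_def by (blast intro: bij_betw_apply)
  have "bij_betw (compose (cells D) \<rho> \<sigma>) (cells D) (cells D'')"
    using bij_betw_trans[of \<sigma> "cells D" "cells D'" \<rho> "cells D''"] \<sigma> \<rho> unfolding cell_iso_def
    by (simp add: compose_def cong: bij_betw_cong)
  then show ?thesis
    using \<sigma> \<rho> s unfolding cell_iso_def by (simp add: compose_def)
qed

definition block :: "('l, 'g, 'm, 'a) table_tuple \<Rightarrow> 'l \<Rightarrow> ('l, 'g, 'm) cell_index set" where
  "block D l = {p \<in> cells D. fst p = l}"

text \<open>The chosen numbering of M depends on the cell alone, so it is the same for all indices
  of a cell and for rows and columns; products would not match otherwise.\<close>

definition cell_matrix :: "('l, 'g, 'm, 'a) table_tuple \<Rightarrow> ('l, 'g, 'm) cell_index \<Rightarrow> nat \<times> nat \<Rightarrow> 'g" where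
  "cell_matrix D = (\<lambda>(l, S, b, T). let e = (SOME e. bij_betw e (Idx D l) {..<card (Idx D l)})
     in elem_matrix (card (Idx D l)) (Gam D l) (e S) (e T) b)"

abbreviation block_based_ring :: "('l, 'g, 'm, 'a) table_tuple \<Rightarrow> 'l \<Rightarrow> (nat \<times> nat \<Rightarrow> 'g) ring \<times> (nat \<times> nat \<Rightarrow> 'g) set" where
  "block_based_ring D l \<equiv> matrix_based_ring (card (Idx D l)) (Gam D l) (Bas D l)"

lemma ring_block:
  assumes "table_family D" "l \<in> Lam D"
  shows "ring (fst (block_based_ring D l))" "zbasis (fst (block_based_ring D l)) (snd (block_based_ring D l))"
  using ring.ring_matrix_ring ring.zbasis_matrix_ring table_familyD[OF assms]
  unfolding matrix_based_ring_def by fastforce+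

lemma cell_matrix_bij:
  assumes D: "table_family D" and l: "l \<in> Lam D"
  shows "bij_betw (cell_matrix D) (block D l) (snd (block_based_ring D l))"
    and "\<And>p q r. p \<in> block D l \<Longrightarrow> q \<in> block D l \<Longrightarrow> r \<in> block D l \<Longrightarrow>
      kappa (fst (block_based_ring D l)) (snd (block_based_ring D l)) (cell_matrix D r)
        (cell_matrix D p \<otimes>\<^bsub>fst (block_based_ring D l)\<^esub> cell_matrix D q) = cell_kappa D p q r"
proof -
  note t = table_familyD[OF D l]
  interpret R: ring "Gam D l" by (rule t(4))
  define n where "n = card (Idx D l)"
  define e where "e = (SOME e. bij_betw e (Idx D l) {..<n})"
  have "\<exists>e. bij_betw e (Idx D l) {..<n}"
    using ex_bij_betw_finite_nat[OF t(2)] unfolding n_def atLeast0LessThan .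
  then have e: "bij_betw e (Idx D l) {..<n}" unfolding e_def by (rule someI_ex)
  have en: "e S < n" if "S \<in> Idx D l" for S using bij_betw_apply[OF e that] by simp
  have ee: "e S = e T \<longleftrightarrow> S = T" if "S \<in> Idx D l" "T \<in> Idx D l" for S T
    using e that unfolding bij_betw_def inj_on_def by blast
  have m: "cell_matrix D (l, S, b, T) = elem_matrix n (Gam D l) (e S) (e T) b" for S b T
    unfolding cell_matrix_def n_def e_def by (simp add: Let_def)
  have pl: "\<exists>S b T. p = (l, S, b, T) \<and> S \<in> Idx D l \<and> b \<in> Bas D l \<and> T \<in> Idx D l" if "p \<in> block D l" for p
    using that unfolding block_def by (cases p) auto
  have lp: "(l, S, b, T) \<in> block D l" if "S \<in> Idx D l" "b \<in> Bas D l" "T \<in> Idx D l" for S b T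
    using that l unfolding block_def by simp
  have "inj_on (cell_matrix D) (block D l)"
  proof (rule inj_onI)
    fix p q assume pq: "p \<in> block D l" "q \<in> block D l" "cell_matrix D p = cell_matrix D q"
    obtain S b T where p: "p = (l, S, b, T)" "S \<in> Idx D l" "b \<in> Bas D l" "T \<in> Idx D l" using pl[OF pq(1)] by blast
    obtain U c V where q: "q = (l, U, c, V)" "U \<in> Idx D l" "c \<in> Bas D l" "V \<in> Idx D l" using pl[OF pq(2)] by blast
    have "b \<noteq> \<zero>\<^bsub>Gam D l\<^esub>" using p(3) R.zbasis_zero_notin[OF t(5)] by metis
    then show "p = q"
      using R.elem_matrix_inj[of n "e S" "e T" b "e U" "e V" c] pq(3) p q en ee unfolding p(1) q(1) m by blast
  qed
  moreover have "cell_matrix D ` block D l = snd (block_based_ring D l)"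
  proof (intro equalityI subsetI)
    fix X assume "X \<in> cell_matrix D ` block D l"
    then obtain S b T where "X = elem_matrix n (Gam D l) (e S) (e T) b" "S \<in> Idx D l" "b \<in> Bas D l" "T \<in> Idx D l"
      using pl m by blast
    then show "X \<in> snd (block_based_ring D l)"
      using en unfolding matrix_based_ring_def n_def[symmetric] snd_conv by blast
  next
    fix X assume "X \<in> snd (block_based_ring D l)"
    then obtain i j b where X: "X = elem_matrix n (Gam D l) i j b" "i < n" "j < n" "b \<in> Bas D l"
      unfolding matrix_based_ring_def n_def by auto
    have "i \<in> e ` Idx D l" "j \<in> e ` Idx D l" using e X(2,3) unfolding bij_betw_def by auto
    then obtain S T where ST: "S \<in> Idx D l" "T \<in> Idx D l" "i = e S" "j = e T" by blast
    show "X \<in> cell_matrix D ` block D l"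
      by (rule image_eqI[of _ _ "(l, S, b, T)"]) (use X ST lp m in auto)
  qed
  ultimately show "bij_betw (cell_matrix D) (block D l) (snd (block_based_ring D l))"
    unfolding bij_betw_def by blast
  fix p q r assume "p \<in> block D l" "q \<in> block D l" "r \<in> block D l"
  then obtain S b T U c V X d Y where p: "p = (l, S, b, T)" "S \<in> Idx D l" "b \<in> Bas D l" "T \<in> Idx D l"
    and q: "q = (l, U, c, V)" "U \<in> Idx D l" "c \<in> Bas D l" "V \<in> Idx D l"
    and r: "r = (l, X, d, Y)" "X \<in> Idx D l" "d \<in> Bas D l" "Y \<in> Idx D l"
    using pl by metis
  have f: "fst (matrix_based_ring n (Gam D l) (Bas D l)) = matrix_ring n (Gam D l)"
    unfolding matrix_based_ring_def by simp
  show "kappa (fst (block_based_ring D l)) (snd (block_based_ring D l)) (cell_matrix D r)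
        (cell_matrix D p \<otimes>\<^bsub>fst (block_based_ring D l)\<^esub> cell_matrix D q) = cell_kappa D p q r"
    unfolding p(1) q(1) r(1) m f n_def[symmetric]
    using R.kappa_elem_matrix_mult[OF t(5), of "e S" n "e T" "e U" "e V" "e X" "e Y" b c d] p q r en ee
    by (simp add: cell_kappa_simp)
qed

lemma cell_matrix_carrier:
  assumes "table_family D" "l \<in> Lam D" "p \<in> block D l"
  shows "cell_matrix D p \<in> carrier (fst (block_based_ring D l))"
    "cell_matrix D p \<in> snd (block_based_ring D l)"
  using bij_betw_apply[OF cell_matrix_bij(1)[OF assms(1,2)] assms(3)] ring_block(2)[OF assms(1,2)]
  unfolding zbasis_def by auto

text \<open>The relation to be used in \<open>equivalent_categoriesI\<close>:
  \<open>\<sigma>\<close> is the restriction of \<open>g\<close> to the matrix bases.\<close>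

definition induces :: "('l, 'g, 'm, 'a) table_tuple \<Rightarrow> ('l, 'g, 'm, 'a) table_tuple \<Rightarrow>
    (('l, 'g, 'm) cell_index \<Rightarrow> ('l, 'g, 'm) cell_index) \<Rightarrow> ('l, nat \<times> nat \<Rightarrow> 'g) based_poset_map \<Rightarrow> bool" where
  "induces D D' \<sigma> g \<longleftrightarrow> cell_iso D D' \<sigma> \<and> g \<in> based_poset_isos (P_obj D) (P_obj D') \<and>
     (\<forall>p\<in>cells D. fst (\<sigma> p) = fst g (fst p) \<and> cell_matrix D' (\<sigma> p) = snd g (fst p) (cell_matrix D p))"

lemma P_obj_isos_iff:
  "(\<alpha>, \<phi>) \<in> based_poset_isos (P_obj D) (P_obj D') \<longleftrightarrow>
    \<alpha> \<in> extensional (Lam D) \<and> bij_betw \<alpha> (Lam D) (Lam D') \<and>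
    (\<forall>x\<in>Lam D. \<forall>y\<in>Lam D. (x, y) \<in> leq D \<longleftrightarrow> (\<alpha> x, \<alpha> y) \<in> leq D') \<and>
    \<phi> \<in> extensional (Lam D) \<and>
    (\<forall>l\<in>Lam D. \<phi> l \<in> based_ring_iso (block_based_ring D l) (block_based_ring D' (\<alpha> l)))"
  unfolding P_obj_def based_poset_isos_def prod.case mem_Collect_eq
  by (auto dest: bij_betw_apply)

section \<open>Cell isomorphisms correspond bijectively to isomorphisms of based posets\<close>

context
  fixes D D' :: "('l, 'g, 'm, 'a) table_tuple"
  assumes D: "table_family D" and D': "table_family D'"
begin

lemma induces_unique_iso:
  assumes g: "induces D D' \<sigma> g" and h: "induces D D' \<sigma> h"
  shows "g = h"
proof -
  obtain \<alpha> \<phi> where g': "g = (\<alpha>, \<phi>)" by (cases g)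
  obtain \<beta> \<psi> where h': "h = (\<beta>, \<psi>)" by (cases h)
  note gi = g[unfolded induces_def g' P_obj_isos_iff fst_conv snd_conv]
  note hi = h[unfolded induces_def h' P_obj_isos_iff fst_conv snd_conv]
  have \<alpha>\<beta>: "\<alpha> l = \<beta> l" if "l \<in> Lam D" for l
    using block_nonempty[OF D that] gi hi by metis
  have "\<alpha> = \<beta>" by (rule extensionalityI[of _ "Lam D"]) (use gi hi \<alpha>\<beta> in auto)
  moreover have "\<phi> = \<psi>"
  proof (rule extensionalityI[of _ "Lam D"])
    fix l assume l: "l \<in> Lam D"
    have l': "\<alpha> l \<in> Lam D'" using gi l bij_betw_apply by fast
    show "\<phi> l = \<psi> l"
    proof (rule based_ring_iso_eqI[OF ring_block[OF D l] ring_block(1)[OF D' l']])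
      show "\<phi> l \<in> based_ring_iso (fst (block_based_ring D l), snd (block_based_ring D l))
          (fst (block_based_ring D' (\<alpha> l)), snd (block_based_ring D' (\<alpha> l)))"
        using gi l by simp
      show "\<psi> l \<in> based_ring_iso (fst (block_based_ring D l), snd (block_based_ring D l))
          (fst (block_based_ring D' (\<alpha> l)), snd (block_based_ring D' (\<alpha> l)))"
        using hi l \<alpha>\<beta>[OF l] by simp
      fix b assume "b \<in> snd (block_based_ring D l)"
      then obtain p where p: "p \<in> block D l" "b = cell_matrix D p"
        using cell_matrix_bij(1)[OF D l] unfolding bij_betw_def by blast
      then show "\<phi> l b = \<psi> l b"
        using gi hi unfolding block_def by auto
    qed
  qed (use gi hi in auto)
  ultimately show ?thesis using g' h' by simp
qed

text \<open>Since \<open>\<sigma>\<close> maps cells onto cells, it descends to the posets; on each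
  cell it preserves structure constants of matrix rings and hence extends to a ring
  isomorphism.\<close>

lemma induces_ex_iso:
  assumes iso: "cell_iso D D' \<sigma>"
  shows "\<exists>g. induces D D' \<sigma> g"
proof -
  have bij: "bij_betw \<sigma> (cells D) (cells D')"
    and kap: "\<And>p q r. p \<in> cells D \<Longrightarrow> q \<in> cells D \<Longrightarrow> r \<in> cells D \<Longrightarrow>
      cell_kappa D' (\<sigma> p) (\<sigma> q) (\<sigma> r) = cell_kappa D p q r"
    and leq: "\<And>p q. p \<in> cells D \<Longrightarrow> q \<in> cells D \<Longrightarrow>
      (fst p, fst q) \<in> leq D \<longleftrightarrow> (fst (\<sigma> p), fst (\<sigma> q)) \<in> leq D'"
    using iso unfolding cell_iso_def by auto
  have same: "fst (\<sigma> p) = fst (\<sigma> q) \<longleftrightarrow> fst p = fst q" if "p \<in> cells D" "q \<in> cells D" for p q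
    by (rule same_block_transport[OF D D' bij]) (use kap that in auto)
  have \<sigma>in: "\<sigma> p \<in> cells D'" if "p \<in> cells D" for p using bij_betw_apply[OF bij that] .
  \<comment> \<open>A representative of each cell; the value of \<open>\<alpha>\<close> does not
    depend on it by \<open>same\<close>.\<close>
  define c where "c l = (SOME p. p \<in> cells D \<and> fst p = l)" for l
  have c: "c l \<in> cells D" "fst (c l) = l" if "l \<in> Lam D" for l
    using someI_ex[of "\<lambda>p. p \<in> cells D \<and> fst p = l"] block_nonempty[OF D that] unfolding c_def by blast+
  define \<alpha> where "\<alpha> = (\<lambda>l\<in>Lam D. fst (\<sigma> (c l)))"
  have \<alpha>: "\<alpha> (fst p) = fst (\<sigma> p)" if "p \<in> cells D" for p
    using same[OF c(1) that] c fst_cells[OF that] unfolding \<alpha>_def by simp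
  have \<alpha>in: "\<alpha> l \<in> Lam D'" if "l \<in> Lam D" for l
    using fst_cells[OF \<sigma>in[OF c(1)[OF that]]] that unfolding \<alpha>_def by simp
  have \<alpha>inj: "inj_on \<alpha> (Lam D)"
  proof (rule inj_onI)
    fix k l assume kl: "k \<in> Lam D" "l \<in> Lam D" "\<alpha> k = \<alpha> l"
    then show "k = l" using same[OF c(1)[OF kl(1)] c(1)[OF kl(2)]] c(2)[OF kl(1)] c(2)[OF kl(2)] by (simp add: \<alpha>_def)
  qed
  have "\<exists>l\<in>Lam D. \<alpha> l = l'" if l': "l' \<in> Lam D'" for l'
  proof -
    obtain p' where p': "p' \<in> cells D'" "fst p' = l'" using block_nonempty[OF D' l'] by blast
    then obtain p where "p \<in> cells D" "p' = \<sigma> p" using bij unfolding bij_betw_def by blast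
    then show ?thesis using \<alpha> p' fst_cells by metis
  qed
  then have \<alpha>bij: "bij_betw \<alpha> (Lam D) (Lam D')"
    using \<alpha>inj \<alpha>in unfolding bij_betw_def by blast
  have \<alpha>leq: "(x, y) \<in> leq D \<longleftrightarrow> (\<alpha> x, \<alpha> y) \<in> leq D'" if "x \<in> Lam D" "y \<in> Lam D" for x y
    using leq[OF c(1)[OF that(1)] c(1)[OF that(2)]] c that unfolding \<alpha>_def by simp
  have \<sigma>block: "bij_betw \<sigma> (block D l) (block D' (\<alpha> l))" if l: "l \<in> Lam D" for l
  proof (rule bij_betw_subset[OF bij])
    show "block D l \<subseteq> cells D" unfolding block_def by blast
    show "\<sigma> ` block D l = block D' (\<alpha> l)"
    proof (intro equalityI subsetI)
      fix p' assume "p' \<in> \<sigma> ` block D l"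
      then obtain p where "p \<in> cells D" "fst p = l" "p' = \<sigma> p" unfolding block_def by blast
      then show "p' \<in> block D' (\<alpha> l)" using \<alpha>[of p] \<sigma>in[of p] unfolding block_def by simp
    next
      fix p' assume p': "p' \<in> block D' (\<alpha> l)"
      then obtain p where p: "p \<in> cells D" "p' = \<sigma> p" using bij unfolding block_def bij_betw_def by blast
      then have "\<alpha> (fst p) = \<alpha> l" using p' \<alpha> unfolding block_def by simp
      then have "fst p = l" using \<alpha>inj l fst_cells[OF p(1)] unfolding inj_on_def by blast
      then show "p' \<in> \<sigma> ` block D l" using p unfolding block_def by blast
    qed
  qed
  have "\<exists>\<psi>. \<psi> \<in> based_ring_iso (block_based_ring D l) (block_based_ring D' (\<alpha> l)) \<and>
      (\<forall>p\<in>block D l. \<psi> (cell_matrix D p) = cell_matrix D' (\<sigma> p))" if l: "l \<in> Lam D" for l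
  proof -
    let ?inv = "inv_into (block D l) (cell_matrix D)"
    define f where "f = cell_matrix D' \<circ> (\<sigma> \<circ> ?inv)"
    note b = cell_matrix_bij[OF D l] and b' = cell_matrix_bij[OF D' \<alpha>in[OF l]]
    have inv: "?inv (cell_matrix D p) = p" if "p \<in> block D l" for p
      using b(1) that unfolding bij_betw_def by (simp add: inv_into_f_f)
    have bl: "p \<in> cells D" if "p \<in> block D l" for p using that unfolding block_def by blast
    have f: "f (cell_matrix D p) = cell_matrix D' (\<sigma> p)" if "p \<in> block D l" for p
      unfolding f_def using inv[OF that] by simp
    have fbij: "bij_betw f (snd (block_based_ring D l)) (snd (block_based_ring D' (\<alpha> l)))"
      unfolding f_def by (intro bij_betw_trans[OF _ b'(1)] bij_betw_trans[OF _ \<sigma>block[OF l]] bij_betw_inv_into b(1))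
    have "kappa (fst (block_based_ring D' (\<alpha> l))) (snd (block_based_ring D' (\<alpha> l))) (f z)
        (f x \<otimes>\<^bsub>fst (block_based_ring D' (\<alpha> l))\<^esub> f y) =
        kappa (fst (block_based_ring D l)) (snd (block_based_ring D l)) z (x \<otimes>\<^bsub>fst (block_based_ring D l)\<^esub> y)"
      if xyz: "x \<in> snd (block_based_ring D l)" "y \<in> snd (block_based_ring D l)" "z \<in> snd (block_based_ring D l)" for x y z
    proof -
      obtain p q r where pqr: "p \<in> block D l" "q \<in> block D l" "r \<in> block D l"
        and x: "x = cell_matrix D p" "y = cell_matrix D q" "z = cell_matrix D r"
        using xyz b(1) unfolding bij_betw_def by blast
      note s = bij_betw_apply[OF \<sigma>block[OF l]]
      show ?thesis
        unfolding x f[OF pqr(1)] f[OF pqr(2)] f[OF pqr(3)]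
          b(2)[OF pqr] b'(2)[OF s[OF pqr(1)] s[OF pqr(2)] s[OF pqr(3)]]
        by (rule kap[OF bl[OF pqr(1)] bl[OF pqr(2)] bl[OF pqr(3)]])
    qed
    then obtain \<psi> where "\<psi> \<in> based_ring_iso (fst (block_based_ring D l), snd (block_based_ring D l))
        (fst (block_based_ring D' (\<alpha> l)), snd (block_based_ring D' (\<alpha> l)))"
      "\<forall>x\<in>snd (block_based_ring D l). \<psi> x = f x"
      using based_ring_iso_extend[OF ring_block[OF D l] ring_block[OF D' \<alpha>in[OF l]] fbij] by blast
    then show ?thesis
      using f cell_matrix_carrier(2)[OF D l] unfolding prod.collapse by metis
  qed
  then obtain \<phi> where \<phi>: "\<And>l. l \<in> Lam D \<Longrightarrow> \<phi> l \<in> based_ring_iso (block_based_ring D l) (block_based_ring D' (\<alpha> l))"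
    "\<And>l p. l \<in> Lam D \<Longrightarrow> p \<in> block D l \<Longrightarrow> \<phi> l (cell_matrix D p) = cell_matrix D' (\<sigma> p)"
    by metis
  have "induces D D' \<sigma> (\<alpha>, \<lambda>l\<in>Lam D. \<phi> l)"
    unfolding induces_def P_obj_isos_iff fst_conv snd_conv
    using iso \<alpha>bij \<alpha>leq \<phi> \<alpha> fst_cells by (auto simp: \<alpha>_def block_def)
  then show ?thesis by blast
qed

lemma induces_unique_cell_iso:
  assumes s: "induces D D' \<sigma> g" and r: "induces D D' \<rho> g"
  shows "\<sigma> = \<rho>"
proof (rule extensionalityI[of _ "cells D"])
  fix p assume p: "p \<in> cells D"
  have "\<sigma> p \<in> cells D'" "\<rho> p \<in> cells D'"
    using s r bij_betw_apply p unfolding induces_def cell_iso_def by fast+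
  then have "\<sigma> p \<in> block D' (fst (\<sigma> p))" "\<rho> p \<in> block D' (fst (\<sigma> p))"
    "cell_matrix D' (\<sigma> p) = cell_matrix D' (\<rho> p)" "fst (\<sigma> p) \<in> Lam D'"
    using fst_cells[of "\<sigma> p" D'] s r p unfolding block_def induces_def by auto
  then show "\<sigma> p = \<rho> p"
    using cell_matrix_bij(1)[OF D', of "fst (\<sigma> p)"] unfolding bij_betw_def inj_on_def by blast
qed (use s r in \<open>auto simp: induces_def cell_iso_def\<close>)

lemma induces_ex_cell_iso:
  assumes g: "g \<in> based_poset_isos (P_obj D) (P_obj D')"
  shows "\<exists>\<sigma>. induces D D' \<sigma> g"
proof -
  obtain \<alpha> \<phi> where g': "g = (\<alpha>, \<phi>)" by (cases g)
  note gi = g[unfolded g' P_obj_isos_iff]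
  have \<alpha>in: "\<alpha> l \<in> Lam D'" if "l \<in> Lam D" for l using gi that bij_betw_apply by fast
  have \<alpha>eq: "\<alpha> k = \<alpha> l \<longleftrightarrow> k = l" if "k \<in> Lam D" "l \<in> Lam D" for k l
    using gi that unfolding bij_betw_def inj_on_def by blast
  have \<phi>iso: "\<phi> l \<in> based_ring_iso (fst (block_based_ring D l), snd (block_based_ring D l))
      (fst (block_based_ring D' (\<alpha> l)), snd (block_based_ring D' (\<alpha> l)))" if "l \<in> Lam D" for l
    using gi that by simp
  have \<phi>bij: "bij_betw (\<phi> l) (snd (block_based_ring D l)) (snd (block_based_ring D' (\<alpha> l)))"
    and \<phi>mult: "\<And>x y. x \<in> carrier (fst (block_based_ring D l)) \<Longrightarrow> y \<in> carrier (fst (block_based_ring D l)) \<Longrightarrow>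
      \<phi> l (x \<otimes>\<^bsub>fst (block_based_ring D l)\<^esub> y) = \<phi> l x \<otimes>\<^bsub>fst (block_based_ring D' (\<alpha> l))\<^esub> \<phi> l y"
    if "l \<in> Lam D" for l
    using \<phi>iso[OF that] unfolding based_ring_iso_def ring_iso_def ring_hom_def by auto
  \<comment> \<open>The inverse is taken on one block: basis matrices of different cells may
    coincide as functions, so \<open>cell_matrix D'\<close> need not be injective on all of
    \<open>cells D'\<close>.\<close>
  define \<sigma> where "\<sigma> = (\<lambda>p\<in>cells D. inv_into (block D' (\<alpha> (fst p))) (cell_matrix D') (\<phi> (fst p) (cell_matrix D p)))"
  have bl: "p \<in> block D (fst p)" if "p \<in> cells D" for p using that unfolding block_def by simp
  have \<sigma>: "\<sigma> p \<in> block D' (\<alpha> (fst p))" "cell_matrix D' (\<sigma> p) = \<phi> (fst p) (cell_matrix D p)"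
    if p: "p \<in> cells D" for p
  proof -
    have "cell_matrix D p \<in> snd (block_based_ring D (fst p))"
      using bl[OF p] cell_matrix_carrier(2)[OF D fst_cells[OF p]] by blast
    then have "\<phi> (fst p) (cell_matrix D p) \<in> cell_matrix D' ` block D' (\<alpha> (fst p))"
      using bij_betw_apply[OF \<phi>bij[OF fst_cells[OF p]]] cell_matrix_bij(1)[OF D' \<alpha>in[OF fst_cells[OF p]]]
      unfolding bij_betw_def by blast
    then show "\<sigma> p \<in> block D' (\<alpha> (fst p))" "cell_matrix D' (\<sigma> p) = \<phi> (fst p) (cell_matrix D p)"
      using p unfolding \<sigma>_def by (auto simp: inv_into_into f_inv_into_f)
  qed
  have \<sigma>c: "\<sigma> p \<in> cells D'" "fst (\<sigma> p) = \<alpha> (fst p)" if "p \<in> cells D" for p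
    using \<sigma>(1)[OF that] unfolding block_def by auto
  have "inj_on \<sigma> (cells D)"
  proof (rule inj_onI)
    fix p q assume pq: "p \<in> cells D" "q \<in> cells D" "\<sigma> p = \<sigma> q"
    then have f: "fst p = fst q" using \<sigma>c(2) \<alpha>eq fst_cells by metis
    note l = fst_cells[OF pq(1)]
    have "\<phi> (fst p) (cell_matrix D p) = \<phi> (fst p) (cell_matrix D q)" using \<sigma>(2) pq f by metis
    moreover have "cell_matrix D p \<in> snd (block_based_ring D (fst p))" "cell_matrix D q \<in> snd (block_based_ring D (fst p))"
      using cell_matrix_carrier(2)[OF D l] bl[OF pq(1)] bl[OF pq(2)] f by auto
    ultimately have "cell_matrix D p = cell_matrix D q"
      using \<phi>bij[OF l] unfolding bij_betw_def inj_on_def by blast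
    then show "p = q"
      using cell_matrix_bij(1)[OF D l] bl[OF pq(1)] bl[OF pq(2)] f unfolding bij_betw_def inj_on_def by metis
  qed
  moreover have "\<exists>p\<in>cells D. \<sigma> p = p'" if p': "p' \<in> cells D'" for p'
  proof -
    have "bij_betw \<alpha> (Lam D) (Lam D')" using gi by blast
    then obtain l where l: "l \<in> Lam D" "fst p' = \<alpha> l" using fst_cells[OF p'] unfolding bij_betw_def by blast
    have b': "p' \<in> block D' (\<alpha> l)" using p' l unfolding block_def by simp
    then have "cell_matrix D' p' \<in> snd (block_based_ring D' (\<alpha> l))"
      using cell_matrix_carrier(2)[OF D' \<alpha>in[OF l(1)]] by blast
    then have "cell_matrix D' p' \<in> \<phi> l ` (cell_matrix D ` block D l)"
      using \<phi>bij[OF l(1)] cell_matrix_bij(1)[OF D l(1)] unfolding bij_betw_def by simp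
    then obtain p where p: "p \<in> block D l" "cell_matrix D' p' = \<phi> l (cell_matrix D p)" by blast
    then have pc: "p \<in> cells D" "fst p = l" unfolding block_def by auto
    then have "cell_matrix D' (\<sigma> p) = cell_matrix D' p'" "\<sigma> p \<in> block D' (\<alpha> l)"
      using \<sigma>[OF pc(1)] p by auto
    then have "\<sigma> p = p'"
      using cell_matrix_bij(1)[OF D' \<alpha>in[OF l(1)]] b' unfolding bij_betw_def inj_on_def by blast
    then show ?thesis using pc by blast
  qed
  ultimately have bij: "bij_betw \<sigma> (cells D) (cells D')"
    using \<sigma>c(1) unfolding bij_betw_def by blast
  have kap: "cell_kappa D' (\<sigma> p) (\<sigma> q) (\<sigma> r) = cell_kappa D p q r"
    if pqr: "p \<in> cells D" "q \<in> cells D" "r \<in> cells D" for p q r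
  \<comment> \<open>The ring isomorphisms see only one cell at a time; across cells both constants
    are 0, and \<open>\<alpha>\<close> is injective.\<close>
  proof (cases "fst p = fst q \<and> fst q = fst r")
    case False
    then have "\<not> (fst (\<sigma> p) = fst (\<sigma> q) \<and> fst (\<sigma> q) = fst (\<sigma> r))"
      using \<sigma>c(2) pqr \<alpha>eq fst_cells by metis
    moreover have "cell_kappa E x y z = 0" if "\<not> (fst x = fst y \<and> fst y = fst z)" for E :: "('l, 'g, 'm, 'a) table_tuple" and x y z
      using that unfolding cell_kappa_def by (auto split: prod.splits)
    ultimately show ?thesis using False by metis
  next
    case True
    define l where "l = fst p"
    have l: "l \<in> Lam D" unfolding l_def using fst_cells[OF pqr(1)] .
    have b: "p \<in> block D l" "q \<in> block D l" "r \<in> block D l" using pqr True unfolding l_def block_def by auto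
    have b': "\<sigma> p \<in> block D' (\<alpha> l)" "\<sigma> q \<in> block D' (\<alpha> l)" "\<sigma> r \<in> block D' (\<alpha> l)"
      using \<sigma>(1) pqr True unfolding l_def by metis+
    have m: "cell_matrix D' (\<sigma> p) = \<phi> l (cell_matrix D p)" "cell_matrix D' (\<sigma> q) = \<phi> l (cell_matrix D q)"
      "cell_matrix D' (\<sigma> r) = \<phi> l (cell_matrix D r)"
      using \<sigma>(2) pqr True unfolding l_def by metis+
    note cb = cell_matrix_carrier[OF D l]
    interpret M: ring "fst (block_based_ring D l)" by (rule ring_block(1)[OF D l])
    show ?thesis
      unfolding cell_matrix_bij(2)[OF D' \<alpha>in[OF l] b', symmetric] cell_matrix_bij(2)[OF D l b, symmetric]
        m \<phi>mult[OF l cb(1)[OF b(1)] cb(1)[OF b(2)], symmetric]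
      by (rule based_ring_iso_kappa[OF ring_block[OF D l] ring_block[OF D' \<alpha>in[OF l]] \<phi>iso[OF l]])
        (use cb b in auto)
  qed
  have "(fst p, fst q) \<in> leq D \<longleftrightarrow> (fst (\<sigma> p), fst (\<sigma> q)) \<in> leq D'" if "p \<in> cells D" "q \<in> cells D" for p q
    using gi \<sigma>c(2) that fst_cells by metis
  then have "cell_iso D D' \<sigma>"
    unfolding cell_iso_def using bij kap by (auto simp: \<sigma>_def)
  then have "induces D D' \<sigma> g"
    unfolding induces_def using g \<sigma>(2) \<sigma>c(2) by (simp add: g')
  then show ?thesis by blast
qed

end

lemma induces_id:
  assumes D: "table_family D"
  shows "induces D D (\<lambda>p\<in>cells D. p) (based_poset_id (P_obj D))"
proof -
  have e: "based_poset_id (P_obj D) = (\<lambda>l\<in>Lam D. l, \<lambda>l\<in>Lam D. \<lambda>y\<in>carrier (fst (block_based_ring D l)). y)"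
    unfolding based_poset_id_def P_obj_def prod.case by (auto simp: restrict_def fun_eq_iff)
  have iso: "(\<lambda>y\<in>carrier (fst (block_based_ring D l)). y) \<in> based_ring_iso (block_based_ring D l) (block_based_ring D l)"
    if l: "l \<in> Lam D" for l
  proof -
    interpret M: ring "fst (block_based_ring D l)" by (rule ring_block(1)[OF D l])
    have "snd (block_based_ring D l) \<subseteq> carrier (fst (block_based_ring D l))"
      using ring_block(2)[OF D l] unfolding zbasis_def by blast
    then have "bij_betw (\<lambda>y\<in>carrier (fst (block_based_ring D l)). y) (snd (block_based_ring D l)) (snd (block_based_ring D l))"
      by (auto simp: bij_betw_def inj_on_def subset_iff image_iff)
    moreover have "(\<lambda>y\<in>carrier (fst (block_based_ring D l)). y) \<in> ring_iso (fst (block_based_ring D l)) (fst (block_based_ring D l))"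
      by (auto simp: ring_iso_def ring_hom_def bij_betw_def inj_on_def)
    ultimately show ?thesis unfolding based_ring_iso_def by simp
  qed
  have "bij_betw (\<lambda>l\<in>Lam D. l) (Lam D) (Lam D)" by (auto simp: bij_betw_def inj_on_def)
  then show ?thesis
    unfolding induces_def e P_obj_isos_iff fst_conv snd_conv
    using iso cell_iso_id cell_matrix_carrier(1)[OF D] fst_cells
    by (auto simp: block_def)
qed

lemma based_ring_iso_compose:
  assumes \<phi>: "\<phi> \<in> based_ring_iso X Y" and \<psi>: "\<psi> \<in> based_ring_iso Y Z"
    and X: "ring (fst X)" "snd X \<subseteq> carrier (fst X)"
  shows "compose (carrier (fst X)) \<psi> \<phi> \<in> based_ring_iso X Z"
proof -
  interpret R: ring "fst X" by (rule X(1))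
  have "\<psi> \<circ> \<phi> \<in> ring_iso (fst X) (fst Z)"
    using ring_iso_set_trans[of \<phi> "fst X" "fst Y" \<psi> "fst Z"] \<phi> \<psi> unfolding based_ring_iso_def by blast
  then have "compose (carrier (fst X)) \<psi> \<phi> \<in> ring_iso (fst X) (fst Z)"
    by (rule R.ring_iso_restrict) (simp add: compose_def)
  moreover have "bij_betw (\<psi> \<circ> \<phi>) (snd X) (snd Z)"
    using \<phi> \<psi> unfolding based_ring_iso_def by (blast intro: bij_betw_trans)
  then have "bij_betw (compose (carrier (fst X)) \<psi> \<phi>) (snd X) (snd Z)"
    using X(2) by (subst bij_betw_cong[where g="\<psi> \<circ> \<phi>"]) (auto simp: compose_def)
  ultimately show ?thesis unfolding based_ring_iso_def by simp
qed

lemma induces_compose: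
  assumes D: "table_family D"
    and s: "induces D D' \<sigma> g" and r: "induces D' D'' \<rho> h"
  shows "induces D D'' (compose (cells D) \<rho> \<sigma>) (based_poset_comp (P_obj D) h g)"
proof -
  obtain \<alpha> \<phi> where g': "g = (\<alpha>, \<phi>)" by (cases g)
  obtain \<beta> \<psi> where h': "h = (\<beta>, \<psi>)" by (cases h)
  note gi = s[unfolded induces_def g' P_obj_isos_iff fst_conv snd_conv]
  note hi = r[unfolded induces_def h' P_obj_isos_iff fst_conv snd_conv]
  have e: "based_poset_comp (P_obj D) h g =
      (compose (Lam D) \<beta> \<alpha>, \<lambda>l\<in>Lam D. compose (carrier (fst (block_based_ring D l))) (\<psi> (\<alpha> l)) (\<phi> l))"
    unfolding based_poset_comp_def P_obj_def g' h' prod.case by (auto simp: restrict_def fun_eq_iff)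
  have \<alpha>in: "\<alpha> l \<in> Lam D'" if "l \<in> Lam D" for l using gi that bij_betw_apply by fast
  have \<sigma>in: "\<sigma> p \<in> cells D'" if "p \<in> cells D" for p
    using gi that bij_betw_apply unfolding cell_iso_def by fast
  have "bij_betw (compose (Lam D) \<beta> \<alpha>) (Lam D) (Lam D'')"
    using bij_betw_trans[of \<alpha> "Lam D" "Lam D'" \<beta> "Lam D''"] gi hi
    by (simp add: compose_def cong: bij_betw_cong)
  moreover have "compose (carrier (fst (block_based_ring D l))) (\<psi> (\<alpha> l)) (\<phi> l) \<in>
      based_ring_iso (block_based_ring D l) (block_based_ring D'' (\<beta> (\<alpha> l)))" if l: "l \<in> Lam D" for l
    by (rule based_ring_iso_compose[of _ _ "block_based_ring D' (\<alpha> l)"])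
      (use gi hi l \<alpha>in ring_block[OF D l] in \<open>auto simp: zbasis_def\<close>)
  moreover have "cell_matrix D'' (\<rho> (\<sigma> p)) = \<psi> (\<alpha> (fst p)) (\<phi> (fst p) (cell_matrix D p))"
    "fst (\<rho> (\<sigma> p)) = \<beta> (\<alpha> (fst p))" if "p \<in> cells D" for p
    using gi hi that \<sigma>in by auto
  ultimately show ?thesis
    unfolding induces_def e P_obj_isos_iff fst_conv snd_conv
    using cell_iso_compose gi hi \<alpha>in fst_cells cell_matrix_carrier(1)[OF D]
    by (auto simp: compose_def block_def)
qed

section \<open>The hom-sets of the category of table data\<close>

context laurent_basis
begin

text \<open>An isomorphism is realized by precomposing the chosen \<open>C\<close> with its inverse.
  The description is free of \<open>C\<close>, which also shows that the choice in
  \<open>D_hom\<close> is immaterial.\<close>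

lemma D_hom_eq:
  assumes D: "D \<in> D_objects scale \<tau> BB" and D': "D' \<in> D_objects scale \<tau> BB"
  shows "D_hom scale \<tau> BB D D' = {\<sigma>. cell_iso D D' \<sigma>}"
proof -
  define C where "C = (SOME C. C \<in> datum_maps scale \<tau> BB D)"
  have C: "C \<in> datum_maps scale \<tau> BB D"
    using D someI_ex[of "\<lambda>C. C \<in> datum_maps scale \<tau> BB D"] unfolding D_objects_def C_def by blast
  obtain C0 where C0: "C0 \<in> datum_maps scale \<tau> BB D'" using D' unfolding D_objects_def by blast
  have e: "D_hom scale \<tau> BB D D' =
      {compose (cells D) (inv_into (cells D') C') C | C'. C' \<in> datum_maps scale \<tau> BB D'}"
    unfolding D_hom_def Let_def C_def ..
  show ?thesis
    unfolding e
  proof (intro equalityI subsetI)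
    fix \<sigma> assume "\<sigma> \<in> {compose (cells D) (inv_into (cells D') C') C | C'. C' \<in> datum_maps scale \<tau> BB D'}"
    then show "\<sigma> \<in> {\<sigma>. cell_iso D D' \<sigma>}" using cell_iso_of_datum_maps[OF C] by blast
  next
    fix \<sigma> assume "\<sigma> \<in> {\<sigma>. cell_iso D D' \<sigma>}"
    then have iso: "cell_iso D D' \<sigma>" by simp
    define C' where "C' = (\<lambda>p. C (inv_into (cells D) \<sigma> p))"
    have C': "C' \<in> datum_maps scale \<tau> BB D'"
      unfolding C'_def by (rule cell_iso_datum_maps[OF C C0 iso])
    have bij: "bij_betw \<sigma> (cells D) (cells D')" and ext: "\<sigma> \<in> extensional (cells D)"
      using iso unfolding cell_iso_def by auto
    have inj: "inj_on C' (cells D')"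
      using datum_mapsD(1)[OF C'] unfolding indexing_def bij_betw_def by blast
    have "compose (cells D) (inv_into (cells D') C') C = \<sigma>"
    proof (rule extensionalityI[of _ "cells D"])
      fix p assume p: "p \<in> cells D"
      have "C p = C' (\<sigma> p)" unfolding C'_def using bij p unfolding bij_betw_def by (simp add: inv_into_f_f)
      then show "compose (cells D) (inv_into (cells D') C') C p = \<sigma> p"
        using inj bij_betw_apply[OF bij p] p by (simp add: compose_def inv_into_f_f)
    qed (use ext in auto)
    then show "\<sigma> \<in> {compose (cells D) (inv_into (cells D') C') C | C'. C' \<in> datum_maps scale \<tau> BB D'}"
      using C' by blast
  qed
qed

lemma D_objects_family: "D \<in> D_objects scale \<tau> BB \<Longrightarrow> table_family D"
  unfolding D_objects_def using datum_mapsD(10) by blast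

lemma category_D_cat: "category (D_cat scale \<tau> BB)"
proof -
  have s: "\<sigma> p \<in> cells D'" if "cell_iso D D' \<sigma>" "p \<in> cells D"
    for D D' :: "('l, 'g, 'm, 'a) table_tuple" and \<sigma> p
    using that bij_betw_apply unfolding cell_iso_def by fast
  have ext: "\<sigma> \<in> extensional (cells D)" if "cell_iso D D' \<sigma>" for D D' :: "('l, 'g, 'm, 'a) table_tuple" and \<sigma>
    using that unfolding cell_iso_def by blast
  have idl: "compose (cells D) \<sigma> (\<lambda>p\<in>cells D. p) = \<sigma>" "compose (cells D) (\<lambda>p\<in>cells D'. p) \<sigma> = \<sigma>"
    if "cell_iso D D' \<sigma>" for D D' :: "('l, 'g, 'm, 'a) table_tuple" and \<sigma>
    by (rule extensionalityI[of _ "cells D"]; use ext[OF that] s[OF that] in \<open>simp add: compose_def\<close>)+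
  have assoc: "compose (cells D) (compose (cells D') \<rho>' \<rho>) \<sigma> = compose (cells D) \<rho>' (compose (cells D) \<rho> \<sigma>)"
    if "cell_iso D D' \<sigma>"
    for D D' :: "('l, 'g, 'm, 'a) table_tuple" and \<sigma> and \<rho> \<rho>' :: "('l, 'g, 'm) cell_index \<Rightarrow> ('l, 'g, 'm) cell_index"
    by (rule extensionalityI[of _ "cells D"]) (use s[OF that] in \<open>simp_all add: compose_def\<close>)
  show ?thesis
    unfolding category_def D_cat_def cat.simps
    by (intro conjI ballI; simp add: D_hom_eq cell_iso_id idl; (rule cell_iso_compose assoc; assumption)?)
qed

end

theorem theorem3p1p6:
  fixes scale :: "laurent \<Rightarrow> 'a::ring \<Rightarrow> 'a"
    and \<tau> :: "'a \<Rightarrow> laurent"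
    and BB :: "'a set"
    and D\<^sub>0 :: "('l, 'g, 'm, 'a) table_tuple"
    and C\<^sub>0 :: "('l, 'g, 'm) cell_index \<Rightarrow> 'a"
  assumes "laurent_algebra scale"
    and "reduced_datum_with_trace scale \<tau> D\<^sub>0 C\<^sub>0"
    and "C\<^sub>0 ` cells D\<^sub>0 = BB"
  shows "equivalent_categories
    (D_cat scale \<tau> BB ::
      (('l, 'g, 'm, 'a) table_tuple, ('l, 'g, 'm) cell_index \<Rightarrow> ('l, 'g, 'm) cell_index) cat)
    (P_cat TYPE('m) scale \<tau> BB ::
      (('l, nat \<times> nat \<Rightarrow> 'g) based_poset, ('l, nat \<times> nat \<Rightarrow> 'g) based_poset_map) cat)"
proof -
  have "axiom_A1 scale D\<^sub>0 C\<^sub>0"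
    using assms(2) unfolding reduced_datum_with_trace_def reduced_datum_def table_datum_def by blast
  then interpret laurent_basis scale BB
    using assms(1,3) by unfold_locales (auto simp: axiom_A1_def)
  let ?K = "D_cat scale \<tau> BB :: (('l, 'g, 'm, 'a) table_tuple, ('l, 'g, 'm) cell_index \<Rightarrow> ('l, 'g, 'm) cell_index) cat"
  let ?L = "P_cat TYPE('m) scale \<tau> BB :: (('l, nat \<times> nat \<Rightarrow> 'g) based_poset, ('l, nat \<times> nat \<Rightarrow> 'g) based_poset_map) cat"
  have K: "Obj ?K = D_objects scale \<tau> BB" "Ident ?K = (\<lambda>D. \<lambda>p\<in>cells D. p)"
    "Comp ?K = (\<lambda>D D' D'' g f. compose (cells D) g f)"
    "Hom ?K = D_hom scale \<tau> BB"
    unfolding D_cat_def by simp_all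
  have L: "Obj ?L = P_obj ` (D_objects scale \<tau> BB :: ('l, 'g, 'm, 'a) table_tuple set)"
    "Hom ?L = based_poset_isos" "Ident ?L = based_poset_id" "Comp ?L = (\<lambda>X Y Z g f. based_poset_comp X g f)"
    unfolding P_cat_def by simp_all
  show ?thesis
  \<comment> \<open>Cases 4 and 5 carry the content: existence and uniqueness of the partner of an
    arrow, in each direction.\<close>
  proof (rule equivalent_categoriesI[where P=P_obj and R=induces], goal_cases)
    case 1 show ?case by (rule category_D_cat)
  next
    case 2 show ?case unfolding K L ..
  next
    case (3 X Y f g) then show ?case unfolding K L by (simp add: D_hom_eq induces_def)
  next
    case (4 X Y f)
    then have o: "X \<in> D_objects scale \<tau> BB" "Y \<in> D_objects scale \<tau> BB" and f: "cell_iso X Y f"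
      unfolding K by (simp_all add: D_hom_eq)
    show ?case
      using induces_ex_iso[OF D_objects_family[OF o(1)] D_objects_family[OF o(2)] f]
        induces_unique_iso[OF D_objects_family[OF o(1)] D_objects_family[OF o(2)]] by blast
  next
    case (5 X Y g)
    then have o: "X \<in> D_objects scale \<tau> BB" "Y \<in> D_objects scale \<tau> BB" and g: "g \<in> based_poset_isos (P_obj X) (P_obj Y)"
      unfolding K L by simp_all
    show ?case
      using induces_ex_cell_iso[OF D_objects_family[OF o(1)] D_objects_family[OF o(2)] g]
        induces_unique_cell_iso[OF D_objects_family[OF o(1)] D_objects_family[OF o(2)]] by blast
  next
    case (6 X) then show ?case unfolding K L using induces_id D_objects_family by blast
  next
    case (7 X Y Z f g u v) then show ?case unfolding K L using induces_compose D_objects_family by blast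
  qed
qed

end
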